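(* Consider the generalized linear model with natural link and the Bridge estimator $\hat{\boldsymbol\beta}_\lambda$ described in the context, with known $\gamma\in(0,1)$ and tuning parameter $\lambda_n=n^{(\gamma_0-2)/2}\lambda$, where $\lambda>0$ is fixed and $\gamma_0\in(\gamma,1]$. Assume conditions (C1) and (C2) on the regressors, as listed in the context. Let $z^{\rm limit}$ be the limit in distribution, as $n\to\infty$, of $$\sum_{i=1}^n\{g_i(\hat{\boldsymbol\beta}_\lambda)-g_i(\boldsymbol\beta^* )\}-\sum_{i=1}^n\{\tilde g_i(\hat{\boldsymbol\beta}_\lambda)-\tilde g_i(\boldsymbol\beta^* )\},$$ where $\tilde g_i$ is the log-likelihood based on an independent copy of the data. Then the asymptotic bias is $$\mathrm E[z^{\rm limit}]=|\mathcal J^{(2)}|,$$ where $\mathcal J^{(2)}=\{j:\beta_j^*\neq0\}$.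
   Context: Model. Let $f(\boldsymbol y;\boldsymbol\theta)=\exp\{\boldsymbol y^{\rm T}\boldsymbol\theta-a(\boldsymbol\theta)+b(\boldsymbol y)\}$ be a natural exponential family of densities on $\mathbb R^r$ with respect to a $\sigma$-finite measure, where $\boldsymbol\theta\in\Theta\subset\mathbb R^r$ and $\Theta$ is the natural parameter space (those $\boldsymbol\theta$ for which the normalizing integral of $\exp\{\boldsymbol y^{\rm T}\boldsymbol\theta+b(\boldsymbol y)\}$ is positive and finite); $\Theta^\circ$ is its interior. It is assumed that $\mathrm V[\boldsymbol y]=a''(\boldsymbol\theta)$ is positive definite (primes denote gradient and Hessian). The data are $(\boldsymbol y_i,\boldsymbol X_i)$, $i=1,\dots,n$, with $\boldsymbol y_i$ independent $r$-dimensional random vectors and $\boldsymbol X_i\in\mathcal X\subset\mathbb R^{r\times p}$ known constant matrices; $\boldsymbol y_i$ has density $f(\cdot;\boldsymbol X_i\boldsymbol\beta^* )$, where $\boldsymbol\beta^*\in\mathcal B$ is the true parameter and $\mathcal B\subset\mathbb R^p$ is an open convex set; $p$ and $r$ are fixed and $n\to\infty$. The log-likelihood of $\boldsymbol y_i$ is $g_i(\boldsymbol\beta)=\boldsymbol y_i^{\rm T}\boldsymbol X_i\boldsymbol\beta-a(\boldsymbol X_i\boldsymbol\beta)+b(\boldsymbol y_i)$. Copy of the data. $(\tilde{\boldsymbol y}_1,\dots,\tilde{\boldsymbol y}_n)$ has the same distribution as $(\boldsymbol y_1,\dots,\boldsymbol y_n)$ and is independent of it; $\tilde g_i(\boldsymbol\beta)=\log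 f(\tilde{\boldsymbol y}_i;\boldsymbol X_i\boldsymbol\beta)$. Conditions on regressors. (C1) $\mathcal X$ is compact and $\boldsymbol X\boldsymbol\beta\in\Theta^\circ$ for all $\boldsymbol X\in\mathcal X$, $\boldsymbol\beta\in\mathcal B$. (C2) There exists an invariant distribution $\mu$ on $\mathcal X$; in particular, $n^{-1}\sum_{i=1}^n\boldsymbol X_i^{\rm T}a''(\boldsymbol X_i\boldsymbol\beta)\boldsymbol X_i$ converges to a positive-definite matrix $\boldsymbol J(\boldsymbol\beta)=\int_{\mathcal X}\boldsymbol X^{\rm T}a''(\boldsymbol X\boldsymbol\beta)\boldsymbol X\,\mu(\mathrm d\boldsymbol X)$. Bridge estimator. $\hat{\boldsymbol\beta}_\lambda=\mathrm{argmin}_{\boldsymbol\beta\in\mathcal B}\{-\sum_{i=1}^n g_i(\boldsymbol\beta)+n\lambda_n\sum_{j=1}^p|\beta_j|^\gamma\}$. *)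

theory Defs
  imports "HOL-Probability.Probability"
begin

definition gradient :: "(real^'m \<Rightarrow> real) \<Rightarrow> real^'m \<Rightarrow> real^'m" where
  "gradient f x = (\<chi> i. frechet_derivative f (at x) (axis i 1))"

definition hessian :: "(real^'m \<Rightarrow> real) \<Rightarrow> real^'m \<Rightarrow> real^'m^'m" where
  "hessian f x = jacobian (gradient f) (at x)"

definition pos_def_matrix :: "real^'m^'m \<Rightarrow> bool" where
  "pos_def_matrix A \<longleftrightarrow> transpose A = A \<and> (\<forall>x. x \<noteq> 0 \<longrightarrow> 0 < x \<bullet> (A *v x))"

section \<open>Natural exponential families\<close>

definition partition_fn :: "(real^'r) measure \<Rightarrow> (real^'r \<Rightarrow> real) \<Rightarrow> real^'r \<Rightarrow> ennreal" where
  "partition_fn \<nu> b \<theta> = (\<integral>\<^sup>+ y. ennreal (exp (y \<bullet> \<theta> + b y)) \<partial>\<nu>)"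

definition natural_space :: "(real^'r) measure \<Rightarrow> (real^'r \<Rightarrow> real) \<Rightarrow> (real^'r) set" where
  "natural_space \<nu> b = {\<theta>. 0 < partition_fn \<nu> b \<theta> \<and> partition_fn \<nu> b \<theta> < \<infinity>}"

(* The cumulant function a is determined on the natural parameter space by the requirement that
   the densities integrate to 1. *)
definition cumulant_fn :: "(real^'r) measure \<Rightarrow> (real^'r \<Rightarrow> real) \<Rightarrow> real^'r \<Rightarrow> real" where
  "cumulant_fn \<nu> b \<theta> = ln (enn2real (partition_fn \<nu> b \<theta>))"

definition nef_density :: "(real^'r) measure \<Rightarrow> (real^'r \<Rightarrow> real) \<Rightarrow> real^'r \<Rightarrow> real^'r \<Rightarrow> real" where
  "nef_density \<nu> b \<theta> y = exp (y \<bullet> \<theta> - cumulant_fn \<nu> b \<theta> + b y)"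

section \<open>Generalized linear model with natural link\<close>

definition glm_loglik ::
  "(real^'r) measure \<Rightarrow> (real^'r \<Rightarrow> real) \<Rightarrow> real^'p^'r \<Rightarrow> real^'r \<Rightarrow> real^'p \<Rightarrow> real" where
  "glm_loglik \<nu> b X y \<beta> = y \<bullet> (X *v \<beta>) - cumulant_fn \<nu> b (X *v \<beta>) + b y"

lemma glm_loglik_eq_ln_density: "glm_loglik \<nu> b X y \<beta> = ln (nef_density \<nu> b (X *v \<beta>) y)"
  by (simp add: glm_loglik_def nef_density_def)

definition fisher_term ::
  "(real^'r) measure \<Rightarrow> (real^'r \<Rightarrow> real) \<Rightarrow> real^'p \<Rightarrow> real^'p^'r \<Rightarrow> real^'p^'p" where
  "fisher_term \<nu> b \<beta> X = transpose X ** hessian (cumulant_fn \<nu> b) (X *v \<beta>) ** X"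

definition regressors_admissible ::
  "(real^'r) measure \<Rightarrow> (real^'r \<Rightarrow> real) \<Rightarrow> (real^'p^'r) set \<Rightarrow> (real^'p) set \<Rightarrow> bool" where
  "regressors_admissible \<nu> b \<X> B \<longleftrightarrow>
     compact \<X> \<and> (\<forall>X\<in>\<X>. \<forall>\<beta>\<in>B. X *v \<beta> \<in> interior (natural_space \<nu> b))"

(* The regressors are non-random, so that mu is "invariant" is understood through what it is used
   for: the averaged information matrices converge to their mu-integral.  Weak convergence of the
   empirical distributions of the regressors to mu is not required. *)
definition regressors_invariant ::
  "(real^'r) measure \<Rightarrow> (real^'r \<Rightarrow> real) \<Rightarrow> (real^'p^'r) set \<Rightarrow> (real^'p) set
     \<Rightarrow> (nat \<Rightarrow> real^'p^'r) \<Rightarrow> bool" where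
  "regressors_invariant \<nu> b \<X> B X \<longleftrightarrow>
     (\<exists>\<mu>. prob_space \<mu> \<and> sets \<mu> = sets (restrict_space borel \<X>) \<and>
        (\<forall>\<beta>\<in>B. integrable \<mu> (fisher_term \<nu> b \<beta>) \<and>
               pos_def_matrix (integral\<^sup>L \<mu> (fisher_term \<nu> b \<beta>)) \<and>
               (\<lambda>n. (1 / real n) *\<^sub>R (\<Sum>i<n. fisher_term \<nu> b \<beta> (X i)))
                 \<longlonglongrightarrow> integral\<^sup>L \<mu> (fisher_term \<nu> b \<beta>)))"

section \<open>Bridge estimator\<close>

definition bridge_objective ::
  "(real^'r) measure \<Rightarrow> (real^'r \<Rightarrow> real) \<Rightarrow> (nat \<Rightarrow> real^'p^'r) \<Rightarrow> real \<Rightarrow> real \<Rightarrow> nat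
     \<Rightarrow> (nat \<Rightarrow> real^'r) \<Rightarrow> real^'p \<Rightarrow> real" where
  "bridge_objective \<nu> b X \<gamma> lam n y \<beta> =
     - (\<Sum>i<n. glm_loglik \<nu> b (X i) (y i) \<beta>) + real n * lam * (\<Sum>j\<in>UNIV. \<bar>\<beta> $ j\<bar> powr \<gamma>)"

(* T is a Bridge estimator based on the n observations y 0, ..., y (n - 1).  As B is open, the
   objective may fail to attain its infimum for some data; T is unconstrained there.  Among several
   minimizers, T may pick any, as long as it depends measurably on the data. *)
definition bridge_estimator ::
  "(real^'r) measure \<Rightarrow> (real^'r \<Rightarrow> real) \<Rightarrow> (nat \<Rightarrow> real^'p^'r) \<Rightarrow> (real^'p) set \<Rightarrow> real \<Rightarrow> real
     \<Rightarrow> nat \<Rightarrow> ((nat \<Rightarrow> real^'r) \<Rightarrow> real^'p) \<Rightarrow> bool" where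
  "bridge_estimator \<nu> b X B \<gamma> lam n T \<longleftrightarrow>
     T \<in> borel_measurable (PiM {..<n} (\<lambda>_. borel)) \<and>
     (\<forall>y \<in> space (PiM {..<n} (\<lambda>_. borel)).
        (\<exists>\<beta>. is_arg_min (bridge_objective \<nu> b X \<gamma> lam n y) (\<lambda>\<beta>. \<beta> \<in> B) \<beta>) \<longrightarrow>
        is_arg_min (bridge_objective \<nu> b X \<gamma> lam n y) (\<lambda>\<beta>. \<beta> \<in> B) (T y))"

definition loglik_gain ::
  "(real^'r) measure \<Rightarrow> (real^'r \<Rightarrow> real) \<Rightarrow> (nat \<Rightarrow> real^'p^'r) \<Rightarrow> nat
     \<Rightarrow> (nat \<Rightarrow> real^'r) \<Rightarrow> real^'p \<Rightarrow> real^'p \<Rightarrow> real" where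
  "loglik_gain \<nu> b X n y \<beta> \<beta>' =
     (\<Sum>i<n. glm_loglik \<nu> b (X i) (y i) \<beta> - glm_loglik \<nu> b (X i) (y i) \<beta>')"

end

theory Submission
  imports Defs
begin

text \<open>
  The gain on the data minus the gain on the copy is linear in the estimation error: it equals
  \<open>(S\<^sub>n - S'\<^sub>n) \<bullet> u\<^sub>n\<close> with the normalized scores \<open>S\<^sub>n\<close>, \<open>S'\<^sub>n\<close> of the data and of the copy and
  \<open>u\<^sub>n\<close> the estimation error scaled by \<open>sqrt n\<close>.  For given data, \<open>u\<^sub>n\<close> minimizes a criterion that
  depends on the data only through \<open>S\<^sub>n\<close>.  The penalty has slope of order at most \<open>sqrt n\<close> on
  the nonzero coordinates and blows up on the others, so that, uniformly for bounded \<open>S\<^sub>n\<close>, the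
  point \<open>u\<^sub>n\<close> is close to the minimizer \<open>U (S\<^sub>n)\<close> of a quadratic function on the coordinate subspace of
  the nonzero coefficients.  In a basis \<open>e\<close> of that subspace which is orthonormal for the
  limiting information matrix, \<open>U s\<close> has the coordinates \<open>e\<^sub>k \<bullet> s - d\<^sub>k\<close>, and the variables
  \<open>e\<^sub>k \<bullet> S\<^sub>n\<close> are asymptotically independent standard normal.  Hence the limit is the law of the sum of
  \<open>(w\<^sub>k - w'\<^sub>k) (w\<^sub>k - d\<^sub>k)\<close> for independent standard normal \<open>w\<^sub>k\<close>, \<open>w'\<^sub>k\<close>, one term of mean 1 for each
  nonzero coefficient.
\<close>

section \<open>Exponential moments\<close>

text \<open>The penalty is not convex, so convexity alone does not locate the minimizer. Convexity
  of the likelihood part gives growth of order \<open>n\<close> along rays, which beats the terms of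
  order \<open>sqrt n\<close>; this first confines the minimizer to a ball of radius of order
  \<open>1 / sqrt n\<close>, where the expansions apply. There the weight
  \<open>n powr (\<gamma>0 / 2)\<close> of the penalty becomes
  \<open>n powr ((\<gamma>0 - 1) / 2)\<close> on a nonzero coordinate, with limit 1 or 0, and
  \<open>n powr ((\<gamma>0 - \<gamma>) / 2)\<close> on a zero one. The resulting shifts
  \<open>d\<close> survive in the limit law if \<open>\<gamma>0 = 1\<close>, but not in its mean:
  \<open>w'\<close> is centered and independent of \<open>w\<close>, so a term has mean
  \<open>E[w\<^sup>2] - d E[w] = 1\<close>. Minimization is a deterministic problem, solved for all
  \<open>s\<close> in a ball; large scores are cut off by their second moments. Given the data, the
  copy enters linearly, through its characteristic function at a frequency that depends on the data.
  A pointwise central limit theorem would not suffice there, whence the error bounds that are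
  uniform on balls of frequencies.\<close>

lemma abs_exp_minus_Taylor_le:
  fixes x :: real
  shows "\<bar>exp x - (\<Sum>m<n. x ^ m / fact m)\<bar> \<le> \<bar>x\<bar> ^ n * exp \<bar>x\<bar>"
proof -
  obtain t where t: "\<bar>t\<bar> \<le> \<bar>x\<bar>" "exp x = (\<Sum>m<n. x ^ m / fact m) + exp t / fact n * x ^ n"
    using Maclaurin_exp_le[of x n] by blast
  have "\<bar>exp x - (\<Sum>m<n. x ^ m / fact m)\<bar> = exp t / fact n * \<bar>x\<bar> ^ n"
    using t(2) by (simp add: abs_mult power_abs)
  also have "\<dots> \<le> exp \<bar>x\<bar> / 1 * \<bar>x\<bar> ^ n"
    using t(1) by (intro mult_right_mono frac_le) (auto simp: fact_ge_1)
  finally show ?thesis by (simp add: mult.commute)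
qed

text \<open>A single term of the exponential series is at most the whole, because the argument is
  nonnegative. Expanding to order \<open>Suc k\<close> keeps the term of degree \<open>k\<close>
  inside the partial sum.\<close>

lemma power_le_fact_mult_exp:
  fixes y c :: real
  assumes "0 \<le> y" "0 < c"
  shows "y ^ k \<le> fact k / c ^ k * exp (c * y)"
proof -
  obtain t where "exp (c * y) = (\<Sum>m<Suc k. (c * y) ^ m / fact m) + exp t / fact (Suc k) * (c * y) ^ Suc k"
    using Maclaurin_exp_le[of "c * y" "Suc k"] by blast
  moreover have "0 \<le> (\<Sum>m<k. (c * y) ^ m / fact m)" "0 \<le> exp t / fact (Suc k) * (c * y) ^ Suc k"
    using assms by (auto intro!: sum_nonneg)
  ultimately have "(c * y) ^ k / fact k \<le> exp (c * y)"
    by simp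
  then show ?thesis
    using assms by (simp add: field_simps power_mult_distrib)
qed

text \<open>The exponent \<open>c\<close> is split: one half pays for the power, the other half for
  \<open>exp (t * y)\<close>. This is the origin of the restriction to \<open>c / 2\<close> and of
  the factors \<open>2 / c\<close> below.\<close>

lemma power_mult_exp_half_le:
  fixes y c t :: real
  assumes "0 \<le> y" "0 < c" "t \<le> c / 2"
  shows "y ^ k * exp (t * y) \<le> fact k * (2 / c) ^ k * exp (c * y)"
proof -
  have "y ^ k * exp (t * y) \<le> (fact k / (c/2) ^ k * exp (c/2 * y)) * exp (c/2 * y)"
    using assms mult_right_mono[of t "c/2" y] by (intro mult_mono power_le_fact_mult_exp) auto
  also have "\<dots> = fact k * (2 / c) ^ k * exp (c * y)"
    by (simp add: power_divide flip: exp_add)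
  finally show ?thesis .
qed

text \<open>\<open>c\<close> and \<open>M\<close> are parameters because every bound derived here
  depends on the law through these two numbers alone; uniformity over a family of laws follows from
  common values.\<close>

locale exp_moment = prob_space P for P :: "'a measure" +
  fixes Y :: "'a \<Rightarrow> 'v::euclidean_space" and c M :: real
  assumes Y_meas [measurable]: "Y \<in> borel_measurable P"
    and c_pos: "0 < c"
    and exp_int: "integrable P (\<lambda>x. exp (c * norm (Y x)))"
    and exp_le: "expectation (\<lambda>x. exp (c * norm (Y x))) \<le> M"
begin

text \<open>Common source of the moment and Taylor remainder bounds: a power times an exponential of
  at most half the rate is absorbed by the one assumed exponential moment.\<close>

lemma power_exp_bound:
  fixes f :: "'a \<Rightarrow> 'u::{banach, second_countable_topology}"
  assumes [measurable]: "f \<in> borel_measurable P" and "t \<le> c / 2" "0 \<le> A"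
    and f: "\<And>x. norm (f x) \<le> A * (norm (Y x) ^ k * exp (t * norm (Y x)))"
  shows "integrable P f" and "norm (expectation f) \<le> A * (fact k * (2 / c) ^ k * M)"
proof -
  have le: "norm (f x) \<le> A * (fact k * (2 / c) ^ k * exp (c * norm (Y x)))" for x
    using f[of x] power_mult_exp_half_le[of "norm (Y x)" c t k] assms(2,3) c_pos
    by (meson mult_left_mono norm_ge_zero order_trans)
  have int: "integrable P (\<lambda>x. A * (fact k * (2 / c) ^ k * exp (c * norm (Y x))))"
    using exp_int by auto
  show "integrable P f"
    by (rule Bochner_Integration.integrable_bound[OF int])
       (auto intro!: AE_I2 order_trans[OF le] abs_ge_self)
  have "norm (expectation f) \<le> expectation (\<lambda>x. A * (fact k * (2 / c) ^ k * exp (c * norm (Y x))))"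
    by (rule order_trans[OF integral_norm_bound integral_mono]) (use \<open>integrable P f\<close> int le in auto)
  also have "\<dots> = A * (fact k * (2 / c) ^ k * expectation (\<lambda>x. exp (c * norm (Y x))))"
    by simp
  also have "\<dots> \<le> A * (fact k * (2 / c) ^ k * M)"
    using exp_le assms(3) c_pos by (intro mult_left_mono) auto
  finally show "norm (expectation f) \<le> A * (fact k * (2 / c) ^ k * M)" .
qed

lemma integrable_moment: "integrable P (\<lambda>x. norm (Y x) ^ k)"
  by (rule power_exp_bound(1)[where A=1 and k=k and t=0]) (use c_pos in auto)

lemma moment_le: "expectation (\<lambda>x. norm (Y x) ^ k) \<le> fact k * (2 / c) ^ k * M"
  using power_exp_bound(2)[where A=1 and k=k and t=0 and f="\<lambda>x. norm (Y x) ^ k"] c_pos by auto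

lemma inner_exp_bound:
  assumes "norm h \<le> c / 2"
  shows "\<bar>exp (h \<bullet> y) - (\<Sum>m<n. (h \<bullet> y) ^ m / fact m)\<bar> \<le> norm h ^ n * (norm y ^ n * exp (norm h * norm y))"
proof -
  have "\<bar>exp (h \<bullet> y) - (\<Sum>m<n. (h \<bullet> y) ^ m / fact m)\<bar> \<le> \<bar>h \<bullet> y\<bar> ^ n * exp \<bar>h \<bullet> y\<bar>"
    by (rule abs_exp_minus_Taylor_le)
  also have "\<dots> \<le> (norm h * norm y) ^ n * exp (norm h * norm y)"
    by (intro mult_mono power_mono) (auto simp: Cauchy_Schwarz_ineq2)
  finally show ?thesis by (simp add: power_mult_distrib)
qed

lemma integrable_exp_inner:
  assumes "norm h \<le> c / 2"
  shows "integrable P (\<lambda>x. exp (h \<bullet> Y x))"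
  by (rule power_exp_bound(1)[where A=1 and k=0 and t="norm h"])
     (use assms norm_cauchy_schwarz in auto)

lemma integrable_inner: "integrable P (\<lambda>x. h \<bullet> Y x)"
  by (rule power_exp_bound(1)[where A="norm h" and k=1 and t=0])
     (use c_pos in \<open>auto simp: Cauchy_Schwarz_ineq2\<close>)

lemma integrable_inner2: "integrable P (\<lambda>x. (h \<bullet> Y x)\<^sup>2)"
proof (rule power_exp_bound(1)[where A="norm h ^ 2" and k=2 and t=0])
  show "norm ((h \<bullet> Y x)\<^sup>2) \<le> (norm h)\<^sup>2 * ((norm (Y x))\<^sup>2 * exp (0 * norm (Y x)))" for x
    using power_mono[OF Cauchy_Schwarz_ineq2[of h "Y x"], of 2] by (simp add: power_mult_distrib)
qed (use c_pos in auto)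

lemma integrable_Y: "integrable P Y"
  by (rule power_exp_bound(1)[where A="1" and k=1 and t=0]) (use c_pos in auto)

lemma integrable_inner_scaleR: "integrable P (\<lambda>x. (h \<bullet> Y x) *\<^sub>R Y x)"
proof (rule power_exp_bound(1)[where A="norm h" and k=2 and t=0])
  show "norm ((h \<bullet> Y x) *\<^sub>R Y x) \<le> (norm h) * ((norm (Y x))\<^sup>2 * exp (0 * norm (Y x)))" for x
    using mult_right_mono[OF Cauchy_Schwarz_ineq2[of h "Y x"] norm_ge_zero[of "Y x"]]
    by (simp add: power2_eq_square mult.assoc)
qed (use c_pos in auto)

lemma integrable_exp_scaleR:
  assumes "norm h \<le> c / 2"
  shows "integrable P (\<lambda>x. exp (h \<bullet> Y x) *\<^sub>R Y x)"
proof (rule power_exp_bound(1)[where A=1 and k=1 and t="norm h"])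
  show "norm (exp (h \<bullet> Y x) *\<^sub>R Y x) \<le> 1 * (norm (Y x) ^ 1 * exp (norm h * norm (Y x)))" for x
    using norm_cauchy_schwarz[of h "Y x"] by (simp add: mult_left_mono mult.commute)
qed (use assms in auto)

end

locale centered_exp_moment = exp_moment +
  assumes centered: "expectation Y = 0"
begin

lemma expectation_inner: "expectation (\<lambda>x. h \<bullet> Y x) = 0"
  using centered integral_inner_right[of h P Y] integrable_Y by simp

text \<open>Centering removes the linear term, so the Taylor remainder of order 2 is all that is
  left; the leading 2 is \<open>fact 2\<close>.\<close>

lemma mgf_order2:
  assumes "norm h \<le> c / 2"
  shows "\<bar>expectation (\<lambda>x. exp (h \<bullet> Y x)) - 1\<bar> \<le> norm h ^ 2 * (2 * (2 / c) ^ 2 * M)"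
proof -
  have "expectation (\<lambda>x. exp (h \<bullet> Y x) - (1 + h \<bullet> Y x)) = expectation (\<lambda>x. exp (h \<bullet> Y x)) - 1"
    using assms by (subst Bochner_Integration.integral_diff)
      (auto simp: integrable_exp_inner integrable_inner expectation_inner prob_space)
  moreover have "norm (expectation (\<lambda>x. exp (h \<bullet> Y x) - (1 + h \<bullet> Y x))) \<le> norm h ^ 2 * (fact 2 * (2 / c) ^ 2 * M)"
    using assms inner_exp_bound[of h _ 2]
    by (intro power_exp_bound(2)[where t="norm h"]) (auto simp: numeral_2_eq_2)
  ultimately show ?thesis by (simp add: numeral_2_eq_2)
qed

lemma mgf_order3:
  assumes "norm h \<le> c / 2"
  shows "\<bar>expectation (\<lambda>x. exp (h \<bullet> Y x)) - 1 - expectation (\<lambda>x. (h \<bullet> Y x)\<^sup>2) / 2\<bar>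
    \<le> norm h ^ 3 * (6 * (2 / c) ^ 3 * M)"
proof -
  have "expectation (\<lambda>x. exp (h \<bullet> Y x) - (1 + h \<bullet> Y x + (h \<bullet> Y x)\<^sup>2 / 2))
    = expectation (\<lambda>x. exp (h \<bullet> Y x)) - 1 - expectation (\<lambda>x. (h \<bullet> Y x)\<^sup>2) / 2"
    using assms by (subst Bochner_Integration.integral_diff)
      (auto simp: integrable_exp_inner integrable_inner integrable_inner2 expectation_inner prob_space)
  moreover have "norm (expectation (\<lambda>x. exp (h \<bullet> Y x) - (1 + h \<bullet> Y x + (h \<bullet> Y x)\<^sup>2 / 2)))
     \<le> norm h ^ 3 * (fact 3 * (2 / c) ^ 3 * M)"
    using assms inner_exp_bound[of h _ 3]
    by (intro power_exp_bound(2)[where t="norm h"]) (auto simp: numeral_3_eq_3 numeral_2_eq_2)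
  ultimately show ?thesis by (simp add: fact_numeral)
qed

text \<open>The additional factor \<open>Y\<close> raises the dominating moment to degree 3 while
  the order in \<open>h\<close> remains 2; hence the constant 6, which is \<open>fact 3\<close>,
  next to \<open>norm h ^ 2\<close>.\<close>

lemma mean_order2:
  assumes "norm h \<le> c / 2"
  shows "norm (expectation (\<lambda>x. exp (h \<bullet> Y x) *\<^sub>R Y x) - expectation (\<lambda>x. (h \<bullet> Y x) *\<^sub>R Y x))
    \<le> norm h ^ 2 * (6 * (2 / c) ^ 3 * M)"
proof -
  have "expectation (\<lambda>x. exp (h \<bullet> Y x) *\<^sub>R Y x - (Y x + (h \<bullet> Y x) *\<^sub>R Y x))
    = expectation (\<lambda>x. exp (h \<bullet> Y x) *\<^sub>R Y x) - expectation (\<lambda>x. (h \<bullet> Y x) *\<^sub>R Y x)"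
    using assms by (subst Bochner_Integration.integral_diff)
      (auto simp: integrable_exp_scaleR integrable_Y integrable_inner_scaleR centered)
  moreover have "norm (expectation (\<lambda>x. exp (h \<bullet> Y x) *\<^sub>R Y x - (Y x + (h \<bullet> Y x) *\<^sub>R Y x)))
     \<le> norm h ^ 2 * (fact 3 * (2 / c) ^ 3 * M)"
  proof (rule power_exp_bound(2)[where t="norm h"])
    fix x
    have "exp (h \<bullet> Y x) *\<^sub>R Y x - (Y x + (h \<bullet> Y x) *\<^sub>R Y x) = (exp (h \<bullet> Y x) - (1 + h \<bullet> Y x)) *\<^sub>R Y x"
      by (simp add: algebra_simps)
    then have "norm (exp (h \<bullet> Y x) *\<^sub>R Y x - (Y x + (h \<bullet> Y x) *\<^sub>R Y x)) = \<bar>exp (h \<bullet> Y x) - (1 + h \<bullet> Y x)\<bar> * norm (Y x)"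
      by simp
    also have "\<dots> \<le> (norm h ^ 2 * (norm (Y x) ^ 2 * exp (norm h * norm (Y x)))) * norm (Y x)"
      using inner_exp_bound[OF assms, of "Y x" 2] by (intro mult_right_mono) (auto simp: numeral_2_eq_2)
    finally show "norm (exp (h \<bullet> Y x) *\<^sub>R Y x - (Y x + (h \<bullet> Y x) *\<^sub>R Y x))
      \<le> norm h ^ 2 * (norm (Y x) ^ 3 * exp (norm h * norm (Y x)))"
      by (simp add: power2_eq_square power3_eq_cube mult_ac)
  qed (use assms in auto)
  ultimately show ?thesis by (simp add: fact_numeral)
qed

end

lemma has_derivative_quadratic_remainder:
  fixes f :: "'a::real_normed_vector \<Rightarrow> 'b::real_normed_vector"
  assumes L: "bounded_linear L" and "0 < \<delta>"
    and rem: "\<And>h. norm h < \<delta> \<Longrightarrow> norm (f (x + h) - f x - L h) \<le> K * norm h ^ 2"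
  shows "(f has_derivative L) (at x)"
  unfolding has_derivative_at
proof (intro conjI L)
  show "(\<lambda>h. norm (f (x + h) - f x - L h) / norm h) \<midarrow>0\<rightarrow> 0"
  proof (rule Lim_null_comparison)
    show "\<forall>\<^sub>F h in at 0. norm (norm (f (x + h) - f x - L h) / norm h) \<le> K * norm h"
      unfolding eventually_at
      by (rule exI[of _ \<delta>]) (use \<open>0 < \<delta>\<close> rem in \<open>auto simp: divide_le_eq power2_eq_square mult_ac\<close>)
    show "(\<lambda>h. K * norm h) \<midarrow>0\<rightarrow> 0"
      by (auto intro!: tendsto_eq_intros)
  qed
qed

section \<open>Expansion of the cumulant generating function at the origin\<close>

context centered_exp_moment
begin

lemma M_ge_1: "1 \<le> M"
proof -
  have "1 = expectation (\<lambda>x. 1::real)"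
    by (simp add: prob_space)
  also have "\<dots> \<le> expectation (\<lambda>x. exp (c * norm (Y x)))"
    using exp_int c_pos by (intro integral_mono) auto
  finally show ?thesis using exp_le by simp
qed

text \<open>Inside this radius the moment generating function is within 1/2 of 1, as the estimate of
  the logarithm requires. The summand 2 in the denominator forces \<open>norm h \<le> 1 / 2\<close>,
  so that powers of \<open>norm h\<close> may be lowered.\<close>

definition (in exp_moment) radius where
  "radius = min (c / 2) (1 / (2 * (2 * (2 / c) ^ 2 * M) + 2))"

text \<open>The first summand is the cubic remainder of the moment generating function. The second
  is the error of replacing \<open>ln (1 + x)\<close> by \<open>x\<close>, of order 4 in
  \<open>h\<close> and hence also of order 3 inside \<open>radius\<close>.\<close>

definition (in exp_moment) order3_const where
  "order3_const = 6 * (2 / c) ^ 3 * M + 2 * (2 * (2 / c) ^ 2 * M) ^ 2"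

lemma moment_const_pos: "0 < 2 * (2 / c) ^ 2 * M"
  using M_ge_1 c_pos by auto

lemma radius_pos: "0 < radius"
  using M_ge_1 c_pos by (auto simp: radius_def intro!: divide_pos_pos add_pos_pos mult_pos_pos)

lemma radius_le: "radius \<le> c / 2" "radius \<le> 1 / 2"
proof -
  have "1 / (2 * (2 * (2 / c) ^ 2 * M) + 2) \<le> 1 / 2"
    using moment_const_pos M_ge_1 by (intro divide_left_mono) (auto intro!: mult_pos_pos add_pos_pos simp del: times_divide_eq_left)
  then show "radius \<le> 1 / 2" by (simp add: radius_def)
qed (simp add: radius_def)

lemma mgf_close_1:
  assumes "norm h \<le> radius"
  shows "\<bar>expectation (\<lambda>x. exp (h \<bullet> Y x)) - 1\<bar> \<le> 1 / 2"
proof -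
  define K where "K = 2 * (2 / c) ^ 2 * M"
  have "0 < K" unfolding K_def by (rule moment_const_pos)
  have h: "norm h \<le> c / 2" "norm h \<le> 1" "norm h \<le> 1 / (2 * K + 2)"
    using assms radius_le by (auto simp: radius_def K_def)
  have "\<bar>expectation (\<lambda>x. exp (h \<bullet> Y x)) - 1\<bar> \<le> norm h ^ 2 * K"
    unfolding K_def using h(1) by (rule mgf_order2)
  also have "\<dots> \<le> norm h * K"
    using h(2) \<open>0 < K\<close> by (intro mult_right_mono) (auto simp: power2_eq_square mult_left_le)
  also have "\<dots> \<le> 1 / (2 * K + 2) * K"
    using h(3) \<open>0 < K\<close> by (intro mult_right_mono) auto
  also have "\<dots> \<le> 1 / 2"
    using \<open>0 < K\<close> by (simp add: divide_le_eq)
  finally show ?thesis .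
qed

lemma cgf_minus_mgf:
  assumes "norm h \<le> radius"
  shows "\<bar>ln (expectation (\<lambda>x. exp (h \<bullet> Y x))) - (expectation (\<lambda>x. exp (h \<bullet> Y x)) - 1)\<bar>
    \<le> 2 * (norm h ^ 2 * (2 * (2 / c) ^ 2 * M)) ^ 2"
proof -
  let ?x = "expectation (\<lambda>x. exp (h \<bullet> Y x)) - 1"
  have "\<bar>ln (1 + ?x) - ?x\<bar> \<le> 2 * ?x ^ 2"
    using mgf_close_1[OF assms] by (rule abs_ln_one_plus_x_minus_x_bound)
  also have "?x ^ 2 \<le> (norm h ^ 2 * (2 * (2 / c) ^ 2 * M)) ^ 2"
    using mgf_order2[of h] assms radius_le(1) by (intro iffD1[OF abs_le_square_iff]) auto
  finally show ?thesis by simp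
qed

lemma cgf_order2:
  assumes "norm h \<le> radius"
  shows "\<bar>ln (expectation (\<lambda>x. exp (h \<bullet> Y x)))\<bar>
    \<le> (2 * (2 / c) ^ 2 * M + 2 * (2 * (2 / c) ^ 2 * M) ^ 2) * norm h ^ 2"
proof -
  define K where "K = 2 * (2 / c) ^ 2 * M"
  have h: "norm h \<le> c / 2" "norm h \<le> 1"
    using assms radius_le by auto
  have "norm h ^ 4 \<le> norm h ^ 2"
    using h(2) by (intro power_decreasing) auto
  then have "2 * (norm h ^ 2 * K) ^ 2 \<le> 2 * K ^ 2 * norm h ^ 2"
    by (simp add: power_mult_distrib mult.commute[of _ "K\<^sup>2"] mult_left_mono flip: power_mult)
  then show ?thesis
    using cgf_minus_mgf[OF assms] mgf_order2[OF h(1)] unfolding K_def[symmetric] by (simp add: algebra_simps)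
qed

lemma cgf_order3:
  assumes "norm h \<le> radius"
  shows "\<bar>ln (expectation (\<lambda>x. exp (h \<bullet> Y x))) - expectation (\<lambda>x. (h \<bullet> Y x)\<^sup>2) / 2\<bar>
    \<le> order3_const * norm h ^ 3"
proof -
  define K where "K = 2 * (2 / c) ^ 2 * M"
  have h: "norm h \<le> c / 2" "norm h \<le> 1"
    using assms radius_le by auto
  have "norm h ^ 4 \<le> norm h ^ 3"
    using h(2) by (intro power_decreasing) auto
  then have "2 * (norm h ^ 2 * K) ^ 2 \<le> 2 * K ^ 2 * norm h ^ 3"
    by (simp add: power_mult_distrib mult.commute[of _ "K\<^sup>2"] mult_left_mono flip: power_mult)
  then show ?thesis
    using cgf_minus_mgf[OF assms] mgf_order3[OF h(1)] unfolding order3_const_def K_def[symmetric]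
    by (simp add: algebra_simps)
qed

lemma linear_covariance: "linear (\<lambda>h. expectation (\<lambda>x. (h \<bullet> Y x) *\<^sub>R Y x))"
  by (rule linearI) (simp_all add: inner_add_left scaleR_left_distrib integrable_inner_scaleR
      flip: scaleR_scaleR)

lemma inner_covariance:
  "h \<bullet> expectation (\<lambda>x. (h \<bullet> Y x) *\<^sub>R Y x) = expectation (\<lambda>x. (h \<bullet> Y x)\<^sup>2)"
  by (subst integral_inner_right[symmetric]) (auto simp: integrable_inner_scaleR power2_eq_square)

text \<open>The quotient is the mean of the exponentially tilted law. By centering, the normalizer
  is stationary at 0 and the numerator vanishes there, so the quotient rule leaves just the
  covariance operator.\<close>

lemma tilted_mean_has_derivative:
  "((\<lambda>h. (1 / expectation (\<lambda>x. exp (h \<bullet> Y x))) *\<^sub>R expectation (\<lambda>x. exp (h \<bullet> Y x) *\<^sub>R Y x))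
     has_derivative (\<lambda>h. expectation (\<lambda>x. (h \<bullet> Y x) *\<^sub>R Y x))) (at 0)"
proof -
  have N: "((\<lambda>h. expectation (\<lambda>x. exp (h \<bullet> Y x) *\<^sub>R Y x))
     has_derivative (\<lambda>h. expectation (\<lambda>x. (h \<bullet> Y x) *\<^sub>R Y x))) (at 0)"
    by (rule has_derivative_quadratic_remainder[where \<delta>="c/2" and K="6 * (2 / c) ^ 3 * M"])
       (use c_pos linear_covariance mean_order2 in \<open>auto simp: linear_conv_bounded_linear centered mult_ac\<close>)
  have G: "((\<lambda>h. expectation (\<lambda>x. exp (h \<bullet> Y x))) has_derivative (\<lambda>h. 0)) (at 0)"
    by (rule has_derivative_quadratic_remainder[where \<delta>="c/2" and K="2 * (2 / c) ^ 2 * M"])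
       (use c_pos mgf_order2 in \<open>auto simp: prob_space mult_ac\<close>)
  show ?thesis
    by (rule has_derivative_eq_rhs, rule has_derivative_scaleR[OF has_derivative_divide[OF has_derivative_const G] N])
       (auto simp: prob_space centered)
qed

end

section \<open>Natural exponential families\<close>

lemma integrable_scaleR_right_eq:
  fixes f :: "'a \<Rightarrow> 'b::{banach, second_countable_topology}"
  assumes "c \<noteq> 0"
  shows "integrable M (\<lambda>x. c *\<^sub>R f x) \<longleftrightarrow> integrable M f"
proof
  assume "integrable M (\<lambda>x. c *\<^sub>R f x)"
  then have "integrable M (\<lambda>x. inverse c *\<^sub>R c *\<^sub>R f x)"
    by (rule integrable_scaleR_right)
  then show "integrable M f"
    using assms by simp
qed auto

locale exp_family =
  fixes \<nu> :: "(real^'r) measure" and b :: "real^'r \<Rightarrow> real"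
  assumes sets_nu [measurable_cong]: "sets \<nu> = sets borel"
    and b_meas [measurable]: "b \<in> borel_measurable borel"
begin

abbreviation "cumulant \<equiv> cumulant_fn \<nu> b"
abbreviation "Theta \<equiv> natural_space \<nu> b"

definition law where "law \<theta> = density \<nu> (\<lambda>y. ennreal (nef_density \<nu> b \<theta> y))"

definition mean where "mean \<theta> = (\<integral>y. y \<partial>law \<theta>)"

lemma sets_law [measurable_cong]: "sets (law \<theta>) = sets borel"
  by (simp add: law_def sets_nu)

lemma nef_density_meas [measurable]: "nef_density \<nu> b \<theta> \<in> borel_measurable borel"
  unfolding nef_density_def[abs_def] by measurable

lemma natural_space_integrable:
  assumes "\<theta> \<in> Theta"
  shows "integrable \<nu> (\<lambda>y. exp (y \<bullet> \<theta> + b y))" "exp (cumulant \<theta>) = (\<integral>y. exp (y \<bullet> \<theta> + b y) \<partial>\<nu>)"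
proof -
  have fin: "0 < partition_fn \<nu> b \<theta>" "partition_fn \<nu> b \<theta> < \<infinity>"
    using assms by (auto simp: natural_space_def)
  show "integrable \<nu> (\<lambda>y. exp (y \<bullet> \<theta> + b y))"
    using fin(2) by (intro integrableI_nonneg) (auto simp: partition_fn_def)
  have "(\<integral>y. exp (y \<bullet> \<theta> + b y) \<partial>\<nu>) = enn2real (partition_fn \<nu> b \<theta>)"
    unfolding partition_fn_def by (rule integral_eq_nn_integral) auto
  moreover have "0 < enn2real (partition_fn \<nu> b \<theta>)"
    using fin by (simp add: enn2real_positive_iff)
  ultimately show "exp (cumulant \<theta>) = (\<integral>y. exp (y \<bullet> \<theta> + b y) \<partial>\<nu>)"
    by (simp add: cumulant_fn_def)
qed

lemma nef_density_eq: "nef_density \<nu> b \<theta> y = exp (y \<bullet> \<theta> + b y) / exp (cumulant \<theta>)"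
  by (simp add: nef_density_def exp_diff exp_add)

lemma nef_density_integral:
  assumes "\<theta> \<in> Theta"
  shows "integrable \<nu> (nef_density \<nu> b \<theta>)" "(\<integral>y. nef_density \<nu> b \<theta> y \<partial>\<nu>) = 1"
  using natural_space_integrable[OF assms]
  by (simp_all add: nef_density_eq[abs_def] flip: natural_space_integrable(2)[OF assms])

lemma nef_density_pos: "0 < nef_density \<nu> b \<theta> y"
  by (simp add: nef_density_def)

text \<open>The integrand is positive everywhere, so positivity depends on \<open>\<nu>\<close>
  alone and not on \<open>\<theta>\<close>. It therefore passes from one parameter to any
  other.\<close>

lemma partition_fn_pos_iff: "0 < partition_fn \<nu> b \<theta> \<longleftrightarrow> \<not> (AE y in \<nu>. False)"
proof -
  have "partition_fn \<nu> b \<theta> = 0 \<longleftrightarrow> (AE y in \<nu>. False)"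
    unfolding partition_fn_def by (subst nn_integral_0_iff_AE) (auto simp: not_le)
  then show ?thesis
    by (simp only: zero_less_iff_neq_zero)
qed

text \<open>Convexity of \<open>exp\<close>, applied to the normalized log-densities, bounds the
  integrand at the convex combination by a mixture of two densities times \<open>exp ?A\<close>.
  Integrating the mixture to 1 gives finiteness and the inequality together, in place of an appeal
  to the Hoelder inequality.\<close>

lemma convex_combination_cumulant:
  assumes "\<theta> \<in> Theta" "\<eta> \<in> Theta" "0 \<le> u" "0 \<le> v" "u + v = 1"
  shows "u *\<^sub>R \<theta> + v *\<^sub>R \<eta> \<in> Theta"
    and "cumulant (u *\<^sub>R \<theta> + v *\<^sub>R \<eta>) \<le> u * cumulant \<theta> + v * cumulant \<eta>"
proof -
  let ?\<zeta> = "u *\<^sub>R \<theta> + v *\<^sub>R \<eta>" and ?A = "u * cumulant \<theta> + v * cumulant \<eta>"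
  have "u = 1 - v" using assms by simp
  have le: "exp (y \<bullet> ?\<zeta> + b y) \<le> exp ?A * (u * nef_density \<nu> b \<theta> y + v * nef_density \<nu> b \<eta> y)" for y
  proof -
    let ?s = "y \<bullet> \<theta> - cumulant \<theta> + b y" and ?t = "y \<bullet> \<eta> - cumulant \<eta> + b y"
    have "exp (u * ?s + v * ?t) \<le> u * exp ?s + v * exp ?t"
      using convex_onD[OF exp_convex, of v ?s ?t] assms(3,4) \<open>u = 1 - v\<close> by simp
    moreover have "y \<bullet> ?\<zeta> + b y = ?A + (u * ?s + v * ?t)"
    proof -
      have "b y = (u + v) * b y" using assms by simp
      then show ?thesis by (simp add: inner_add_right algebra_simps)
    qed
    ultimately show ?thesis
      by (simp add: nef_density_def exp_add mult_left_mono)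
  qed
  have int: "integrable \<nu> (\<lambda>y. exp ?A * (u * nef_density \<nu> b \<theta> y + v * nef_density \<nu> b \<eta> y))"
    using nef_density_integral assms by auto
  have int': "integrable \<nu> (\<lambda>y. exp (y \<bullet> ?\<zeta> + b y))"
    by (rule Bochner_Integration.integrable_bound[OF int])
       (auto intro!: AE_I2 order_trans[OF le] abs_ge_self)
  have "0 < partition_fn \<nu> b \<theta>"
    using assms by (auto simp: natural_space_def)
  then have pos: "0 < partition_fn \<nu> b ?\<zeta>"
    unfolding partition_fn_pos_iff .
  moreover have "partition_fn \<nu> b ?\<zeta> < \<infinity>"
    using int' unfolding partition_fn_def by (auto simp: integrable_iff_bounded)
  ultimately show \<zeta>: "?\<zeta> \<in> Theta"
    by (simp add: natural_space_def)
  have "exp (cumulant ?\<zeta>) = (\<integral>y. exp (y \<bullet> ?\<zeta> + b y) \<partial>\<nu>)"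
    by (rule natural_space_integrable[OF \<zeta>])
  also have "\<dots> \<le> (\<integral>y. exp ?A * (u * nef_density \<nu> b \<theta> y + v * nef_density \<nu> b \<eta> y) \<partial>\<nu>)"
    using int' int le by (intro integral_mono) auto
  also have "\<dots> = exp ?A"
    using nef_density_integral[OF assms(1)] nef_density_integral[OF assms(2)] assms(5) by simp
  finally show "cumulant ?\<zeta> \<le> ?A" by simp
qed

lemma convex_interior_Theta: "convex (interior Theta)"
  by (intro convex_interior convexI convex_combination_cumulant)

lemma convex_on_cumulant: "convex_on (interior Theta) cumulant"
  using convex_interior_Theta
  by (auto simp: convex_on_def intro!: convex_combination_cumulant(2) subsetD[OF interior_subset])

lemma continuous_on_cumulant: "continuous_on (interior Theta) cumulant"
  by (rule convex_on_continuous[OF open_interior convex_on_cumulant])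

lemma prob_space_law:
  assumes "\<theta> \<in> Theta"
  shows "prob_space (law \<theta>)"
proof
  have "emeasure (law \<theta>) (space (law \<theta>)) = (\<integral>\<^sup>+y. ennreal (nef_density \<nu> b \<theta> y) \<partial>\<nu>)"
    by (simp add: law_def emeasure_density cong: nn_integral_cong)
  also have "\<dots> = 1"
    using nef_density_integral[OF assms] less_imp_le[OF nef_density_pos] by (subst nn_integral_eq_integral) auto
  finally show "emeasure (law \<theta>) (space (law \<theta>)) = 1" .
qed

text \<open>Moving the natural parameter by \<open>h\<close> is exponential tilting by
  \<open>exp (h \<bullet> y)\<close>; the difference of the cumulants is the logarithm of the
  normalizing factor.\<close>

lemma law_shift:
  fixes f :: "real^'r \<Rightarrow> 'u::{banach, second_countable_topology}"
  assumes [measurable]: "f \<in> borel_measurable borel"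
  shows "integrable (law (\<theta> + h)) f \<longleftrightarrow> integrable (law \<theta>) (\<lambda>y. exp (h \<bullet> y) *\<^sub>R f y)"
    and "(\<integral>y. f y \<partial>law (\<theta> + h)) = exp (cumulant \<theta> - cumulant (\<theta> + h)) *\<^sub>R (\<integral>y. exp (h \<bullet> y) *\<^sub>R f y \<partial>law \<theta>)"
proof -
  let ?c = "exp (cumulant \<theta> - cumulant (\<theta> + h))"
  have eq: "nef_density \<nu> b (\<theta> + h) y *\<^sub>R f y = ?c *\<^sub>R (nef_density \<nu> b \<theta> y *\<^sub>R (exp (h \<bullet> y) *\<^sub>R f y))" for y
  proof -
    have "nef_density \<nu> b (\<theta> + h) y = ?c * (nef_density \<nu> b \<theta> y * exp (h \<bullet> y))"
      unfolding nef_density_def exp_add[symmetric] by (simp add: inner_add_right inner_commute[of h y])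
    then show ?thesis by simp
  qed
  have nn: "AE y in \<nu>. 0 \<le> nef_density \<nu> b \<eta> y" for \<eta>
    using less_imp_le[OF nef_density_pos] by auto
  have "integrable (law (\<theta> + h)) f \<longleftrightarrow> integrable \<nu> (\<lambda>y. ?c *\<^sub>R (nef_density \<nu> b \<theta> y *\<^sub>R (exp (h \<bullet> y) *\<^sub>R f y)))"
    unfolding law_def using nn by (subst integrable_density) (auto simp: eq)
  also have "\<dots> \<longleftrightarrow> integrable \<nu> (\<lambda>y. nef_density \<nu> b \<theta> y *\<^sub>R (exp (h \<bullet> y) *\<^sub>R f y))"
    by (rule integrable_scaleR_right_eq) simp
  also have "\<dots> \<longleftrightarrow> integrable (law \<theta>) (\<lambda>y. exp (h \<bullet> y) *\<^sub>R f y)"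
    unfolding law_def using nn by (subst integrable_density) auto
  finally show "integrable (law (\<theta> + h)) f \<longleftrightarrow> integrable (law \<theta>) (\<lambda>y. exp (h \<bullet> y) *\<^sub>R f y)" .
  have "(\<integral>y. f y \<partial>law (\<theta> + h)) = (\<integral>y. ?c *\<^sub>R (nef_density \<nu> b \<theta> y *\<^sub>R (exp (h \<bullet> y) *\<^sub>R f y)) \<partial>\<nu>)"
    unfolding law_def using nn by (subst integral_density) (auto simp: eq)
  also have "\<dots> = ?c *\<^sub>R (\<integral>y. exp (h \<bullet> y) *\<^sub>R f y \<partial>law \<theta>)"
    unfolding law_def using nn by (subst integral_density) (auto simp del: scaleR_scaleR)
  finally show "(\<integral>y. f y \<partial>law (\<theta> + h)) = ?c *\<^sub>R (\<integral>y. exp (h \<bullet> y) *\<^sub>R f y \<partial>law \<theta>)" .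
qed

lemma mgf_law:
  assumes "\<theta> \<in> Theta" "\<theta> + h \<in> Theta"
  shows "integrable (law \<theta>) (\<lambda>y. exp (h \<bullet> y))"
    and "(\<integral>y. exp (h \<bullet> y) \<partial>law \<theta>) = exp (cumulant (\<theta> + h) - cumulant \<theta>)"
proof -
  interpret prob_space "law (\<theta> + h)" by (rule prob_space_law[OF assms(2)])
  show "integrable (law \<theta>) (\<lambda>y. exp (h \<bullet> y))"
    using law_shift(1)[of "\<lambda>_. 1::real" \<theta> h] by simp
  have "1 = exp (cumulant \<theta> - cumulant (\<theta> + h)) * (\<integral>y. exp (h \<bullet> y) \<partial>law \<theta>)"
    using law_shift(2)[of "\<lambda>_. 1::real" \<theta> h] prob_space by simp
  then show "(\<integral>y. exp (h \<bullet> y) \<partial>law \<theta>) = exp (cumulant (\<theta> + h) - cumulant \<theta>)"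
    by (simp add: exp_diff field_simps)
qed

text \<open>Some coordinate is at least \<open>norm y / CARD('r)\<close> in absolute value, and the
  two signs cover both orientations of its axis.\<close>

lemma exp_norm_le_sum:
  fixes y :: "real^'r"
  assumes "0 < d"
  shows "exp (d / CARD('r) * norm y) \<le> (\<Sum>j\<in>UNIV. exp ((d *\<^sub>R axis j 1) \<bullet> y) + exp ((- d *\<^sub>R axis j 1) \<bullet> y))"
proof -
  have "\<exists>j. norm y \<le> CARD('r) * \<bar>y $ j\<bar>"
  proof (rule ccontr)
    assume "\<not> ?thesis"
    then have "\<bar>y $ j\<bar> < norm y / CARD('r)" for j
      by (simp add: not_le less_divide_eq mult.commute)
    then have "(\<Sum>j\<in>UNIV. \<bar>y $ j\<bar>) < (\<Sum>j\<in>(UNIV::'r set). norm y / CARD('r))"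
      by (intro sum_strict_mono) auto
    then show False using norm_le_l1_cart[of y] by simp
  qed
  then obtain j where j: "norm y \<le> CARD('r) * \<bar>y $ j\<bar>" ..
  have "exp (d / CARD('r) * norm y) \<le> exp (d * \<bar>y $ j\<bar>)"
    using j assms by (simp add: divide_le_eq mult_left_mono mult_ac)
  also have "\<dots> \<le> exp ((d *\<^sub>R axis j 1) \<bullet> y) + exp ((- d *\<^sub>R axis j 1) \<bullet> y)"
    by (cases "0 \<le> y $ j") (auto simp: inner_axis' )
  also have "\<dots> \<le> (\<Sum>j\<in>UNIV. exp ((d *\<^sub>R axis j 1) \<bullet> y) + exp ((- d *\<^sub>R axis j 1) \<bullet> y))"
    by (rule member_le_sum) (auto intro: add_nonneg_nonneg)
  finally show ?thesis .
qed

text \<open>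
  The exponential moment of the norm is bounded by the Laplace transforms along the coordinate axes,
  that is, by exponentials of differences of the cumulant function, which is continuous on the interior.
\<close>

lemma compact_exp_moment:
  assumes K: "compact K" "K \<subseteq> interior Theta"
  obtains c M where "0 < c"
    "\<And>\<theta>. \<theta> \<in> K \<Longrightarrow> cball \<theta> c \<subseteq> interior Theta"
    "\<And>\<theta>. \<theta> \<in> K \<Longrightarrow> centered_exp_moment (law \<theta>) (\<lambda>y. y - mean \<theta>) c M"
proof -
  obtain d where d: "0 < d" "(\<Union>\<theta>\<in>K. cball \<theta> d) \<subseteq> interior Theta"
    using compact_subset_open_imp_cball_epsilon_subset[OF K(1) open_interior K(2)] by blast
  \<comment> \<open>A compact neighbourhood of \<open>K\<close>: a single bound \<open>A\<close> for
    the cumulant on it serves all base points in \<open>K\<close> and all shifts of norm at most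
    \<open>d\<close>.\<close>
  define K' where "K' = {\<theta> + x |\<theta> x. \<theta> \<in> K \<and> x \<in> cball 0 d}"
  have "compact K'" unfolding K'_def by (intro compact_sums K compact_cball)
  have "K' \<subseteq> interior Theta"
    using d(2) by (fastforce simp: K'_def dist_norm)
  then have "compact (cumulant ` K')"
    using \<open>compact K'\<close> continuous_on_subset[OF continuous_on_cumulant] by (intro compact_continuous_image)
  then obtain A where A: "\<And>x. x \<in> K' \<Longrightarrow> \<bar>cumulant x\<bar> \<le> A"
    using compact_imp_bounded[of "cumulant ` K'"] unfolding bounded_iff by (auto simp: image_iff)
  define c where "c = d / CARD('r)"
  define M1 where "M1 = (\<Sum>j\<in>(UNIV::'r set). 2 * exp (2 * A))"
  have "0 < c" "c \<le> d"
    using d(1) by (auto simp: c_def divide_le_eq mult_le_cancel_left1)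
  have em: "exp_moment (law \<theta>) (\<lambda>y. y) c M1" if "\<theta> \<in> K" for \<theta>
  proof -
    have sub: "\<theta> + h \<in> K'" if "norm h \<le> d" for h
      using \<open>\<theta> \<in> K\<close> that by (auto simp: K'_def)
    have th: "\<theta> \<in> Theta" "\<theta> \<in> K'"
      using sub[of 0] \<open>K' \<subseteq> interior Theta\<close> interior_subset[of Theta] d(1) by auto
    have exp1: "integrable (law \<theta>) (\<lambda>y. exp (h \<bullet> y))" "(\<integral>y. exp (h \<bullet> y) \<partial>law \<theta>) \<le> exp (2 * A)"
      if "norm h \<le> d" for h
    proof -
      have "\<theta> + h \<in> K'" using sub that by auto
      then have "\<theta> + h \<in> Theta"
        using \<open>K' \<subseteq> interior Theta\<close> interior_subset[of Theta] by auto
      show "integrable (law \<theta>) (\<lambda>y. exp (h \<bullet> y))"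
        by (rule mgf_law) fact+
      have "cumulant (\<theta> + h) - cumulant \<theta> \<le> 2 * A"
        using A[OF \<open>\<theta> + h \<in> K'\<close>] A[OF th(2)] by auto
      then show "(\<integral>y. exp (h \<bullet> y) \<partial>law \<theta>) \<le> exp (2 * A)"
        using mgf_law(2)[OF th(1) \<open>\<theta> + h \<in> Theta\<close>] by simp
    qed
    note e1 = exp1[of "d *\<^sub>R axis j 1" for j] exp1[of "- d *\<^sub>R axis j 1" for j]
    have int: "integrable (law \<theta>) (\<lambda>y. \<Sum>j\<in>UNIV. exp ((d *\<^sub>R axis j 1) \<bullet> y) + exp ((- d *\<^sub>R axis j 1) \<bullet> y))"
      using e1 d(1) by auto
    have le: "exp (c * norm y) \<le> (\<Sum>j\<in>UNIV. exp ((d *\<^sub>R axis j 1) \<bullet> y) + exp ((- d *\<^sub>R axis j 1) \<bullet> y))" for y :: "real^'r"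
      unfolding c_def using exp_norm_le_sum[OF d(1)] by auto
    interpret prob_space "law \<theta>" by (rule prob_space_law[OF th(1)])
    have int': "integrable (law \<theta>) (\<lambda>y. exp (c * norm y))"
      by (rule Bochner_Integration.integrable_bound[OF int]) (auto intro!: AE_I2 order_trans[OF le] abs_ge_self)
    have "(\<integral>y. exp (c * norm y) \<partial>law \<theta>)
      \<le> (\<integral>y. (\<Sum>j\<in>UNIV. exp ((d *\<^sub>R axis j 1) \<bullet> y) + exp ((- d *\<^sub>R axis j 1) \<bullet> y)) \<partial>law \<theta>)"
      by (rule integral_mono[OF int' int le])
    also have "\<dots> = (\<Sum>j\<in>UNIV. (\<integral>y. exp ((d *\<^sub>R axis j 1) \<bullet> y) \<partial>law \<theta>) + (\<integral>y. exp ((- d *\<^sub>R axis j 1) \<bullet> y) \<partial>law \<theta>))"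
      using e1 d(1) by simp
    also have "\<dots> \<le> M1"
      unfolding M1_def mult_2 using e1(2,4) d(1) by (intro sum_mono add_mono) auto
    finally show ?thesis
      by unfold_locales (use \<open>0 < c\<close> int' in auto)
  qed
  show ?thesis
  proof
    show "0 < c" by fact
    fix \<theta> assume "\<theta> \<in> K"
    then show "cball \<theta> c \<subseteq> interior Theta"
      using d(2) \<open>c \<le> d\<close> by (meson UN_subset_iff order_trans subset_cball)
    interpret exp_moment "law \<theta>" "\<lambda>y. y" c M1 by (rule em) fact
    \<comment> \<open>Price of centering: \<open>1 * (2 / c) * M1\<close> bounds the mean, so
      subtracting the mean costs a constant factor.\<close>
    let ?e = "exp (c * (1 * (2 / c) * M1))"
    have "norm (mean \<theta>) \<le> expectation (\<lambda>y. norm y)"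
      unfolding mean_def by (rule integral_norm_bound)
    also have "\<dots> \<le> 1 * (2 / c) * M1"
      using moment_le[of 1] by simp
    finally have m: "norm (mean \<theta>) \<le> 1 * (2 / c) * M1" .
    have le: "exp (c * norm (y - mean \<theta>)) \<le> ?e * exp (c * norm y)" for y
    proof -
      have "c * norm (y - mean \<theta>) \<le> c * (1 * (2 / c) * M1 + norm y)"
        using norm_triangle_ineq4[of y "mean \<theta>"] m \<open>0 < c\<close> by (intro mult_left_mono) auto
      then show ?thesis by (simp add: distrib_left flip: exp_add)
    qed
    have int: "integrable (law \<theta>) (\<lambda>y. ?e * exp (c * norm y))"
      using exp_int by simp
    have int': "integrable (law \<theta>) (\<lambda>y. exp (c * norm (y - mean \<theta>)))"
      by (rule Bochner_Integration.integrable_bound[OF int]) (auto intro!: AE_I2 order_trans[OF le] abs_ge_self)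
    have "expectation (\<lambda>y. exp (c * norm (y - mean \<theta>))) \<le> expectation (\<lambda>y. ?e * exp (c * norm y))"
      by (rule integral_mono[OF int' int le])
    also have "\<dots> \<le> ?e * M1"
      using exp_le by simp
    finally have "expectation (\<lambda>y. exp (c * norm (y - mean \<theta>))) \<le> ?e * M1" .
    moreover have "expectation (\<lambda>y. y - mean \<theta>) = 0"
      using integrable_Y prob_space by (simp add: mean_def)
    ultimately show "centered_exp_moment (law \<theta>) (\<lambda>y. y - mean \<theta>) c (?e * M1)"
      by unfold_locales (use \<open>0 < c\<close> int' in auto)
  qed
qed

end

section \<open>Derivatives of the cumulant function and their uniform remainders\<close>

context exp_family
begin

definition covariance where
  "covariance \<theta> v = (\<integral>y. (v \<bullet> (y - mean \<theta>))\<^sup>2 \<partial>law \<theta>)"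

text \<open>The first-order remainder of the cumulant at \<open>\<theta>\<close> is the cumulant
  generating function of the centered law, which turns the preceding estimates for \<open>ln\<close>
  into Taylor estimates for the cumulant.\<close>

lemma cumulant_shift:
  assumes em: "centered_exp_moment (law \<theta>) (\<lambda>y. y - mean \<theta>) c M" and "norm h \<le> c / 2"
    and "\<theta> \<in> Theta" "\<theta> + h \<in> Theta"
  shows "cumulant (\<theta> + h) - cumulant \<theta> - mean \<theta> \<bullet> h = ln (\<integral>y. exp (h \<bullet> (y - mean \<theta>)) \<partial>law \<theta>)"
proof -
  interpret centered_exp_moment "law \<theta>" "\<lambda>y. y - mean \<theta>" c M by fact
  have "(\<integral>y. exp (h \<bullet> (y - mean \<theta>)) \<partial>law \<theta>) = (\<integral>y. exp (h \<bullet> y) * exp (- (h \<bullet> mean \<theta>)) \<partial>law \<theta>)"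
    by (simp add: inner_diff_right flip: exp_add)
  also have "\<dots> = exp (cumulant (\<theta> + h) - cumulant \<theta> - mean \<theta> \<bullet> h)"
    by (simp add: mgf_law[OF assms(3,4)] inner_commute[of "mean \<theta>" h] exp_diff exp_minus divide_inverse)
  finally show ?thesis by simp
qed

lemma interior_Theta_exp_moment:
  assumes "\<theta> \<in> interior Theta"
  obtains c M where "0 < c" "cball \<theta> c \<subseteq> interior Theta"
    "centered_exp_moment (law \<theta>) (\<lambda>y. y - mean \<theta>) c M"
  using compact_exp_moment[of "{\<theta>}"] assms by auto

lemma cumulant_has_derivative:
  assumes "\<theta> \<in> interior Theta"
  shows "(cumulant has_derivative (\<lambda>h. mean \<theta> \<bullet> h)) (at \<theta>)"
proof -
  obtain c M where cM: "0 < c" "cball \<theta> c \<subseteq> interior Theta"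
    and em: "centered_exp_moment (law \<theta>) (\<lambda>y. y - mean \<theta>) c M"
    by (rule interior_Theta_exp_moment[OF assms])
  interpret centered_exp_moment "law \<theta>" "\<lambda>y. y - mean \<theta>" c M by fact
  show ?thesis
  proof (rule has_derivative_quadratic_remainder[OF _ radius_pos])
    fix h :: "real^'r" assume h: "norm h < radius"
    have "norm h \<le> c / 2" "norm h \<le> c"
      using h radius_le(1) c_pos by linarith+
    then have "\<theta> + h \<in> cball \<theta> c"
      by (simp add: dist_norm)
    then have "\<theta> + h \<in> Theta" "\<theta> \<in> Theta"
      using cM(2) interior_subset assms by blast+
    with \<open>norm h \<le> c / 2\<close> show "norm (cumulant (\<theta> + h) - cumulant \<theta> - mean \<theta> \<bullet> h)
       \<le> (2 * (2 / c) ^ 2 * M + 2 * (2 * (2 / c) ^ 2 * M) ^ 2) * norm h ^ 2"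
      using cgf_order2[of h] h by (simp add: cumulant_shift[OF em])
  qed (rule bounded_linear_inner_right)
qed

lemma gradient_cumulant:
  assumes "\<theta> \<in> interior Theta"
  shows "gradient cumulant \<theta> = mean \<theta>"
proof -
  have "frechet_derivative cumulant (at \<theta>) = (\<lambda>h. mean \<theta> \<bullet> h)"
    by (rule frechet_derivative_at[symmetric]) (rule cumulant_has_derivative[OF assms])
  then show ?thesis
    by (simp add: gradient_def vec_eq_iff inner_axis)
qed

text \<open>Near \<open>\<theta>\<close> the mean equals \<open>mean \<theta>\<close> plus the mean
  of the tilted centered law, whose derivative at the origin is already known.\<close>

lemma mean_has_derivative:
  assumes "\<theta> \<in> interior Theta"
  shows "(mean has_derivative (\<lambda>h. \<integral>y. (h \<bullet> (y - mean \<theta>)) *\<^sub>R (y - mean \<theta>) \<partial>law \<theta>)) (at \<theta>)"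
proof -
  obtain c M where cM: "0 < c" "cball \<theta> c \<subseteq> interior Theta"
    and em: "centered_exp_moment (law \<theta>) (\<lambda>y. y - mean \<theta>) c M"
    by (rule interior_Theta_exp_moment[OF assms])
  interpret centered_exp_moment "law \<theta>" "\<lambda>y. y - mean \<theta>" c M by fact
  let ?G = "\<lambda>h. expectation (\<lambda>y. exp (h \<bullet> (y - mean \<theta>)))"
  let ?N = "\<lambda>h. expectation (\<lambda>y. exp (h \<bullet> (y - mean \<theta>)) *\<^sub>R (y - mean \<theta>))"
  define F where "F h = mean \<theta> + (1 / ?G h) *\<^sub>R ?N h" for h
  have F: "(F has_derivative (\<lambda>h. \<integral>y. (h \<bullet> (y - mean \<theta>)) *\<^sub>R (y - mean \<theta>) \<partial>law \<theta>)) (at (\<theta> - \<theta>))"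
    unfolding F_def by (rule has_derivative_eq_rhs, rule has_derivative_add[OF has_derivative_const])
      (use tilted_mean_has_derivative in auto)
  have "((\<lambda>\<eta>. F (\<eta> - \<theta>)) has_derivative (\<lambda>h. \<integral>y. (h \<bullet> (y - mean \<theta>)) *\<^sub>R (y - mean \<theta>) \<partial>law \<theta>)) (at \<theta>)"
    by (rule has_derivative_compose[where g=F and f="\<lambda>\<eta>. \<eta> - \<theta>", OF _ F]) (auto intro!: derivative_eq_intros)
  then show ?thesis
  proof (rule has_derivative_transform_within_open)
    show "open (ball \<theta> (c/2))" "\<theta> \<in> ball \<theta> (c/2)" using cM(1) by auto
    fix \<eta> assume \<eta>: "\<eta> \<in> ball \<theta> (c/2)"
    define h where "h = \<eta> - \<theta>"
    have \<eta>_eq: "\<eta> = \<theta> + h" and h: "norm h \<le> c / 2"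
      using \<eta> by (auto simp: h_def dist_norm norm_minus_commute)
    have "\<theta> + h \<in> cball \<theta> c" using h cM(1) by (simp add: dist_norm)
    then have Th: "\<theta> + h \<in> Theta" "\<theta> \<in> Theta"
      using cM(2) interior_subset assms by blast+
    \<comment> \<open>This identity makes the normalizing factor from \<open>law_shift\<close> and
      the factor from centering the exponent combine to \<open>1 / ?G h\<close>.\<close>
    have pos: "exp (h \<bullet> mean \<theta>) = exp (cumulant (\<theta> + h) - cumulant \<theta>) / ?G h"
    proof -
      have "?G h = expectation (\<lambda>y. exp (h \<bullet> y) * exp (- (h \<bullet> mean \<theta>)))"
        by (simp add: inner_diff_right flip: exp_add)
      also have "\<dots> = exp (cumulant (\<theta> + h) - cumulant \<theta>) / exp (h \<bullet> mean \<theta>)"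
        using mgf_law[OF Th(2,1)] by (simp add: exp_minus divide_inverse)
      finally show ?thesis by simp
    qed
    interpret h: prob_space "law (\<theta> + h)" by (rule prob_space_law[OF Th(1)])
    have e: "exp (h \<bullet> y) *\<^sub>R (y - mean \<theta>) = exp (h \<bullet> mean \<theta>) *\<^sub>R (exp (h \<bullet> (y - mean \<theta>)) *\<^sub>R (y - mean \<theta>))" for y
      by (simp add: inner_diff_right flip: exp_add)
    have int: "integrable (law (\<theta> + h)) (\<lambda>y. y - mean \<theta>)"
      unfolding law_shift(1)[of "\<lambda>y. y - mean \<theta>", simplified] e
      by (rule integrable_scaleR_right[OF integrable_exp_scaleR[OF h]])
    have "mean \<eta> - mean \<theta> = h.expectation (\<lambda>y. y - mean \<theta>)"
    proof -
      have "integrable (law (\<theta> + h)) (\<lambda>y. (y - mean \<theta>) + mean \<theta>)"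
        using int by (intro Bochner_Integration.integrable_add) auto
      then show ?thesis
        by (simp add: mean_def[of "\<theta> + h"] \<eta>_eq h.prob_space)
    qed
    also have "\<dots> = exp (cumulant \<theta> - cumulant (\<theta> + h)) *\<^sub>R expectation (\<lambda>y. exp (h \<bullet> y) *\<^sub>R (y - mean \<theta>))"
      by (rule law_shift) simp
    also have "\<dots> = exp (cumulant \<theta> - cumulant (\<theta> + h)) *\<^sub>R (exp (h \<bullet> mean \<theta>) *\<^sub>R ?N h)"
      unfolding e by (simp del: scaleR_scaleR)
    also have "\<dots> = (1 / ?G h) *\<^sub>R ?N h"
      unfolding pos by (simp flip: exp_add)
    finally show "F (\<eta> - \<theta>) = mean \<eta>"
      unfolding F_def h_def[symmetric] by (simp add: algebra_simps)
  qed
qed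

text \<open>The gradient is identified with \<open>mean\<close> on the open interior, so both have
  the same derivative there; the covariance operator evaluated against \<open>v\<close> is the
  variance of \<open>v \<bullet> y\<close>.\<close>

lemma inner_hessian_cumulant:
  assumes "\<theta> \<in> interior Theta"
  shows "v \<bullet> (hessian cumulant \<theta> *v v) = covariance \<theta> v"
proof -
  obtain c M where cM: "0 < c" "cball \<theta> c \<subseteq> interior Theta"
    and em: "centered_exp_moment (law \<theta>) (\<lambda>y. y - mean \<theta>) c M"
    by (rule interior_Theta_exp_moment[OF assms])
  interpret centered_exp_moment "law \<theta>" "\<lambda>y. y - mean \<theta>" c M by fact
  let ?L = "\<lambda>h. expectation (\<lambda>y. (h \<bullet> (y - mean \<theta>)) *\<^sub>R (y - mean \<theta>))"
  have "(gradient cumulant has_derivative ?L) (at \<theta>)"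
    by (rule has_derivative_transform_within_open[OF mean_has_derivative[OF assms] open_interior assms])
       (simp add: gradient_cumulant)
  then have "hessian cumulant \<theta> = matrix ?L"
    unfolding hessian_def jacobian_def by (simp add: frechet_derivative_at[symmetric])
  then have "hessian cumulant \<theta> *v v = ?L v"
    using matrix_works[of ?L v] linear_covariance by (simp add: linear_matrix_vector_mul_eq)
  then show ?thesis
    unfolding covariance_def using inner_covariance by simp
qed

lemma compact_cumulant_expansion:
  assumes K: "compact K" "K \<subseteq> interior Theta"
  obtains \<delta> M where "0 < \<delta>" "0 < M"
    "\<And>\<theta>. \<theta> \<in> K \<Longrightarrow> cball \<theta> \<delta> \<subseteq> interior Theta"
    "\<And>\<theta> h. \<theta> \<in> K \<Longrightarrow> norm h \<le> \<delta> \<Longrightarrow>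
      \<bar>cumulant (\<theta> + h) - cumulant \<theta> - mean \<theta> \<bullet> h - covariance \<theta> h / 2\<bar> \<le> M * norm h ^ 3"
    "\<And>\<theta>. \<theta> \<in> K \<Longrightarrow> integrable (law \<theta>) (\<lambda>y. y - mean \<theta>)"
    "\<And>\<theta>. \<theta> \<in> K \<Longrightarrow> (\<integral>y. y - mean \<theta> \<partial>law \<theta>) = 0"
    "\<And>\<theta> k. \<theta> \<in> K \<Longrightarrow> integrable (law \<theta>) (\<lambda>y. norm (y - mean \<theta>) ^ k)"
    "\<And>\<theta>. \<theta> \<in> K \<Longrightarrow> (\<integral>y. norm (y - mean \<theta>) ^ 2 \<partial>law \<theta>) \<le> M"
    "\<And>\<theta>. \<theta> \<in> K \<Longrightarrow> (\<integral>y. norm (y - mean \<theta>) ^ 3 \<partial>law \<theta>) \<le> M"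
proof -
  obtain c M where cM: "0 < c" "\<And>\<theta>. \<theta> \<in> K \<Longrightarrow> cball \<theta> c \<subseteq> interior Theta"
    "\<And>\<theta>. \<theta> \<in> K \<Longrightarrow> centered_exp_moment (law \<theta>) (\<lambda>y. y - mean \<theta>) c M"
    using compact_exp_moment[OF K] by metis
  \<comment> \<open>This is \<open>radius\<close>, written without a fixed \<open>\<theta>\<close>.
    The absolute value is there because \<open>1 \<le> M\<close> becomes available only once a point
    of \<open>K\<close> is given, and \<open>K\<close> may be empty.\<close>
  define \<delta> where "\<delta> = min (c / 2) (1 / (2 * (2 * (2 / c) ^ 2 * \<bar>M\<bar>) + 2))"
  \<comment> \<open>One constant above the cubic Taylor constant and both moment bounds; the summand
    1 makes it positive in all cases.\<close>
  define D where "D = 1 + 6 * (2 / c) ^ 3 * \<bar>M\<bar> + 2 * (2 * (2 / c) ^ 2 * \<bar>M\<bar>) ^ 2 + 2 * (2 / c)^2 * \<bar>M\<bar>"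
  have "0 < D" using cM(1) by (simp add: D_def add_pos_nonneg)
  have "0 < \<delta>" using cM(1) by (auto simp: \<delta>_def intro!: divide_pos_pos add_nonneg_pos)
  show ?thesis
  proof
    fix \<theta> assume \<theta>: "\<theta> \<in> K"
    interpret centered_exp_moment "law \<theta>" "\<lambda>y. y - mean \<theta>" c M by (rule cM(3)[OF \<theta>])
    have "\<bar>M\<bar> = M" using M_ge_1 by simp
    have r: "\<delta> = radius" by (simp add: \<delta>_def radius_def \<open>\<bar>M\<bar> = M\<close>)
    show sub: "cball \<theta> \<delta> \<subseteq> interior Theta"
      using cM(2)[OF \<theta>] cM(1) by (rule_tac order_trans[OF subset_cball]) (auto simp: \<delta>_def)
    have D: "order3_const \<le> D" "6 * (2 / c) ^ 3 * M \<le> D" "2 * (2 / c) ^ 2 * M \<le> D"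
      using cM(1) M_ge_1 by (simp_all add: D_def order3_const_def)
    show "\<bar>cumulant (\<theta> + h) - cumulant \<theta> - mean \<theta> \<bullet> h - covariance \<theta> h / 2\<bar> \<le> D * norm h ^ 3"
      if "norm h \<le> \<delta>" for h
    proof -
      have "\<theta> + h \<in> Theta" "\<theta> \<in> Theta"
        using sub interior_subset that \<open>0 < \<delta>\<close> by (force simp: dist_norm)+
      then have "\<bar>cumulant (\<theta> + h) - cumulant \<theta> - mean \<theta> \<bullet> h - covariance \<theta> h / 2\<bar> \<le> order3_const * norm h ^ 3"
        using cgf_order3[of h] that radius_le(1) by (simp add: cumulant_shift[OF cM(3)[OF \<theta>]] r covariance_def)
      also have "\<dots> \<le> D * norm h ^ 3"
        using D(1) by (intro mult_right_mono) auto
      finally show ?thesis .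
    qed
    show "integrable (law \<theta>) (\<lambda>y. y - mean \<theta>)" by (rule integrable_Y)
    show "expectation (\<lambda>y. y - mean \<theta>) = 0" by (rule centered)
    show "integrable (law \<theta>) (\<lambda>y. norm (y - mean \<theta>) ^ k)" for k by (rule integrable_moment)
    show "expectation (\<lambda>y. norm (y - mean \<theta>) ^ 2) \<le> D"
      using moment_le[of 2] D(3) by simp
    show "expectation (\<lambda>y. norm (y - mean \<theta>) ^ 3) \<le> D"
      using moment_le[of 3] D(2) by (simp add: fact_numeral)
  qed fact+
qed

end

section \<open>Quadratic forms and the power penalty\<close>

lemma norm_matrix_vector_mult_le:
  fixes A :: "real^'n^'m"
  shows "norm (A *v x) \<le> norm A * norm x"
proof -
  have "\<bar>(A *v x) $ i\<bar> \<le> norm (A $ i) * norm x" for i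
    using Cauchy_Schwarz_ineq2[of "A $ i" x] by (simp add: matrix_vector_mul_component)
  then have "norm (A *v x) \<le> L2_set (\<lambda>i. norm (A $ i) * norm x) UNIV"
    unfolding norm_vec_def[of "A *v x"] by (intro L2_set_mono) auto
  then show ?thesis
    by (simp add: norm_vec_def[of A] L2_set_left_distrib)
qed

locale pos_def_form =
  fixes J :: "real^'p^'p"
  assumes pos_def: "pos_def_matrix J"
begin

definition form :: "real^'p \<Rightarrow> real^'p \<Rightarrow> real" where
  "form x y = x \<bullet> (J *v y)"

lemma form_sym: "form x y = form y x"
  using pos_def unfolding pos_def_matrix_def form_def
  by (metis dot_lmul_matrix inner_commute transpose_matrix_vector)

lemma form_pos: "x \<noteq> 0 \<Longrightarrow> 0 < form x x"
  using pos_def by (auto simp: pos_def_matrix_def form_def)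

lemma form_nonneg: "0 \<le> form x x"
  using form_pos[of x] by (cases "x = 0") (auto simp: form_def)

lemma linear_form_right: "linear (form x)"
  by (rule linearI) (simp_all add: form_def matrix_vector_right_distrib inner_add_right matrix_vector_mult_scaleR)

lemma linear_form_left: "linear (\<lambda>x. form x y)"
  by (rule linearI) (simp_all add: form_def inner_add_left)

lemmas form_simps = linear_add[OF linear_form_right] linear_diff[OF linear_form_right]
  linear_cmul[OF linear_form_right] linear_sum[OF linear_form_right] linear_0[OF linear_form_right]
  linear_add[OF linear_form_left] linear_diff[OF linear_form_left]
  linear_cmul[OF linear_form_left] linear_sum[OF linear_form_left] linear_0[OF linear_form_left]

lemma form_le: "\<bar>form x y\<bar> \<le> norm J * norm x * norm y"
proof -
  have "\<bar>form x y\<bar> \<le> norm x * norm (J *v y)"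
    unfolding form_def by (rule Cauchy_Schwarz_ineq2)
  also have "\<dots> \<le> norm x * (norm J * norm y)"
    by (intro mult_left_mono norm_matrix_vector_mult_le) auto
  finally show ?thesis by (simp add: mult_ac)
qed

text \<open>The minimum over the compact unit sphere is positive by definiteness, and homogeneity of
  degree 2 extends it to all vectors.\<close>

lemma form_coercive:
  obtains c where "0 < c" "\<And>x. c * norm x ^ 2 \<le> form x x"
proof -
  have cont: "continuous_on (sphere 0 1) (\<lambda>x. form x x)"
    unfolding form_def by (intro continuous_intros)
  have ne: "sphere 0 1 \<noteq> ({} :: (real^'p) set)" by (simp add: sphere_eq_empty)
  obtain z where z: "z \<in> sphere 0 1" "\<And>x. x \<in> sphere 0 1 \<Longrightarrow> form z z \<le> form x x"
    using continuous_attains_inf[OF compact_sphere ne cont] by blast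
  show ?thesis
  proof
    show "0 < form z z" using z(1) by (intro form_pos) auto
    fix x :: "real^'p"
    show "form z z * norm x ^ 2 \<le> form x x"
    proof (cases "x = 0")
      case False
      define u where "u = x /\<^sub>R norm x"
      have "form z z \<le> form u u" using False by (intro z(2)) (simp add: u_def)
      moreover have "x = norm x *\<^sub>R u" using False by (simp add: u_def)
      then have "form x x = form u u * norm x ^ 2"
        by (metis form_simps(3,8) mult.assoc mult.commute power2_eq_square real_scaleR_def)
      ultimately show ?thesis by (simp add: mult_right_mono)
    qed (simp add: form_simps)
  qed
qed

text \<open>Gram-Schmidt with respect to \<open>form\<close>, adding one coordinate at a time.
  Indexing the basis by the coordinates themselves makes the number of limiting terms equal to the
  number of nonzero coefficients.\<close>

lemma coordinate_subspace_orthonormal_basis: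
  assumes "finite A"
  shows "\<exists>e. (\<forall>k\<in>A. \<forall>j. j \<notin> A \<longrightarrow> e k $ j = 0) \<and>
    (\<forall>k\<in>A. \<forall>l\<in>A. form (e k) (e l) = (if k = l then 1 else 0)) \<and>
    (\<forall>u. (\<forall>j. j \<notin> A \<longrightarrow> u $ j = 0) \<longrightarrow> u = (\<Sum>k\<in>A. form (e k) u *\<^sub>R e k))"
  using assms
proof induction
  case empty
  show ?case by (auto simp: vec_eq_iff)
next
  case (insert a A)
  then obtain e where e: "\<And>k j. k \<in> A \<Longrightarrow> j \<notin> A \<Longrightarrow> e k $ j = 0"
    "\<And>k l. k \<in> A \<Longrightarrow> l \<in> A \<Longrightarrow> form (e k) (e l) = (if k = l then 1 else 0)"
    "\<And>u. (\<forall>j. j \<notin> A \<longrightarrow> u $ j = 0) \<Longrightarrow> u = (\<Sum>k\<in>A. form (e k) u *\<^sub>R e k)"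
    by blast
  \<comment> \<open>The residual of the new axis after projection. Its coordinate \<open>a\<close>
    stays 1, since the old basis vectors vanish there; so it is nonzero and can be
    normalized.\<close>
  define v where "v = axis a 1 - (\<Sum>k\<in>A. form (e k) (axis a 1) *\<^sub>R e k)"
  have v_a: "v $ a = 1" and v_out: "\<And>j. j \<notin> insert a A \<Longrightarrow> v $ j = 0"
    using insert.hyps e(1) by (simp_all add: v_def axis_def)
  define N where "N = sqrt (form v v)"
  have "v \<noteq> 0" using v_a by auto
  then have N: "0 < N" "form v v = N * N"
    using form_pos[of v] by (auto simp: N_def)
  have orth: "form (e l) v = 0" if "l \<in> A" for l
  proof -
    have "(\<Sum>k\<in>A. form (e k) (axis a 1) * form (e l) (e k)) = (\<Sum>k\<in>A. if k = l then form (e l) (axis a 1) else 0)"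
      using that by (intro sum.cong) (auto simp: e(2))
    then show ?thesis
      using that insert.hyps by (simp add: v_def form_simps)
  qed
  define e' where "e' = e(a := (1 / N) *\<^sub>R v)"
  have e'_a: "e' a = (1 / N) *\<^sub>R v" and e'_A: "\<And>k. k \<in> A \<Longrightarrow> e' k = e k"
    using insert.hyps by (auto simp: e'_def)
  have "u = (\<Sum>k\<in>insert a A. form (e' k) u *\<^sub>R e' k)" if u: "\<forall>j. j \<notin> insert a A \<longrightarrow> u $ j = 0" for u
  proof -
    \<comment> \<open>Subtracting this multiple of \<open>v\<close> clears coordinate
      \<open>a\<close>, so the induction hypothesis expands the rest; orthogonality then identifies
      \<open>u $ a\<close> with the coefficient of \<open>v\<close>.\<close>
    define w where "w = u - (u $ a) *\<^sub>R v"
    have "w $ j = 0" if "j \<notin> A" for j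
      using that u v_a v_out[of j] by (cases "j = a") (auto simp: w_def)
    then have w: "w = (\<Sum>k\<in>A. form (e k) w *\<^sub>R e k)" by (intro e(3)) auto
    have ew: "form (e k) w = form (e k) u" if "k \<in> A" for k
      using orth[OF that] by (simp add: w_def form_simps)
    have "form v w = (\<Sum>k\<in>A. form (e k) w * form v (e k))"
      by (subst w) (simp add: form_simps)
    also have "\<dots> = 0"
      using orth by (intro sum.neutral) (auto simp: form_sym[of v])
    finally have "form v u = (u $ a) * (N * N)"
      using N(2) by (simp add: w_def form_simps)
    then have "form (e' a) u *\<^sub>R e' a = (u $ a) *\<^sub>R v"
      using N(1) by (simp add: e'_a form_simps)
    then have "(\<Sum>k\<in>insert a A. form (e' k) u *\<^sub>R e' k) = (u $ a) *\<^sub>R v + (\<Sum>k\<in>A. form (e k) w *\<^sub>R e k)"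
      using insert.hyps by (simp add: e'_A ew)
    then show ?thesis using w by (simp add: w_def)
  qed
  moreover have "form (e' k) (e' l) = (if k = l then 1 else 0)" if "k \<in> insert a A" "l \<in> insert a A" for k l
  proof -
    have "form v (e l) = 0" if "l \<in> A" for l
      using orth[OF that] form_sym by metis
    then show ?thesis
      using that N orth insert.hyps
      by (cases "k = a"; cases "l = a") (auto simp: e'_a e'_A e(2) form_simps)
  qed
  moreover have "e' k $ j = 0" if "k \<in> insert a A" "j \<notin> insert a A" for k j
    using that e(1) v_out by (auto simp: e'_a e'_A)
  ultimately show ?case by (intro exI[of _ e']) blast
qed

end

lemma powr_abs_has_real_derivative:
  fixes b :: real
  assumes "b \<noteq> 0"
  shows "((\<lambda>t. \<bar>b + t\<bar> powr g) has_real_derivative g * \<bar>b\<bar> powr (g - 1) * sgn b) (at 0)"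
proof -
  have "((\<lambda>t. (sgn b * (b + t)) powr g) has_real_derivative g * (sgn b * (b + 0)) powr (g - real 1) * sgn b) (at 0)"
    using assms by (intro DERIV_fun_powr) (auto intro!: derivative_eq_intros simp: sgn_mult_self_eq sgn_if)
  then have "((\<lambda>t. (sgn b * (b + t)) powr g) has_real_derivative g * \<bar>b\<bar> powr (g - 1) * sgn b) (at 0)"
    by (simp add: sgn_mult_self_eq abs_sgn mult.commute)
  then show ?thesis
  proof (rule has_field_derivative_transform_within_open)
    show "open (ball (0::real) \<bar>b\<bar>)" "(0::real) \<in> ball 0 \<bar>b\<bar>" using assms by auto
    show "(sgn b * (b + t)) powr g = \<bar>b + t\<bar> powr g" if "t \<in> ball 0 \<bar>b\<bar>" for t
      using that assms by (cases "b > 0") (auto simp: sgn_if abs_if)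
  qed
qed

text \<open>A bound valid for every \<open>t\<close>, not just near 0. After division by
  \<open>\<bar>b\<bar> powr g\<close> it reduces to \<open>x \<le> x powr g\<close> on the unit
  interval; for \<open>x > 1\<close> the left-hand quantity is already nonpositive.\<close>

lemma powr_abs_diff_ge:
  fixes b t g :: real
  assumes "b \<noteq> 0" "0 < g" "g \<le> 1"
  shows "- (\<bar>b\<bar> powr (g - 1) * \<bar>t\<bar>) \<le> \<bar>b + t\<bar> powr g - \<bar>b\<bar> powr g"
proof -
  define x where "x = \<bar>b + t\<bar> / \<bar>b\<bar>"
  have x: "0 \<le> x" "1 - x \<le> \<bar>t\<bar> / \<bar>b\<bar>"
  proof -
    have "1 - x = (\<bar>b\<bar> - \<bar>b + t\<bar>) / \<bar>b\<bar>" using assms by (simp add: x_def diff_divide_distrib)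
    also have "\<dots> \<le> \<bar>t\<bar> / \<bar>b\<bar>" by (intro divide_right_mono) auto
    finally show "1 - x \<le> \<bar>t\<bar> / \<bar>b\<bar>" .
  qed (simp add: x_def)
  have "1 - x powr g \<le> \<bar>t\<bar> / \<bar>b\<bar>"
  proof (cases "x \<le> 1")
    case True
    have "x \<le> x powr g"
    proof (cases "x = 0")
      case False
      then have "x powr 1 \<le> x powr g" using x True assms by (intro powr_mono') auto
      then show ?thesis using x by simp
    qed simp
    then show ?thesis using x by simp
  next
    case False
    then have "1 \<le> x powr g" using assms by (intro ge_one_powr_ge_zero) auto
    moreover have "0 \<le> \<bar>t\<bar> / \<bar>b\<bar>" by simp
    ultimately show ?thesis by linarith
  qed
  then have "\<bar>b\<bar> powr g * (1 - x powr g) \<le> \<bar>b\<bar> powr g * (\<bar>t\<bar> / \<bar>b\<bar>)"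
    by (intro mult_left_mono) auto
  also have "\<dots> = \<bar>b\<bar> powr (g - 1) * \<bar>t\<bar>"
    using assms by (simp add: powr_diff)
  finally show ?thesis
    using assms by (simp add: x_def powr_divide right_diff_distrib)
qed

text \<open>The factor \<open>sqrt n\<close> contained in \<open>real n powr (g0 / 2)\<close>
  cancels the step \<open>x / sqrt n\<close>, leaving \<open>n powr ((g0 - 1) / 2)\<close> times the
  derivative of the power. One half of \<open>\<epsilon>\<close> pays for the linearization, the
  other for the convergence of this factor.\<close>

lemma power_penalty_limit:
  fixes b g g0 \<iota> \<epsilon> \<rho> :: real
  assumes "b \<noteq> 0" "g0 \<le> 1" and \<iota>: "(\<lambda>n. real n powr ((g0 - 1) / 2)) \<longlonglongrightarrow> \<iota>" and "0 < \<epsilon>"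
  shows "\<forall>\<^sub>F n in sequentially. \<forall>x. \<bar>x\<bar> \<le> \<rho> \<longrightarrow>
    \<bar>real n powr (g0 / 2) * (\<bar>b + x / sqrt n\<bar> powr g - \<bar>b\<bar> powr g) - \<iota> * (g * \<bar>b\<bar> powr (g - 1) * sgn b) * x\<bar> \<le> \<epsilon>"
proof (cases "0 \<le> \<rho>")
  case True
  let ?k = "g * \<bar>b\<bar> powr (g - 1) * sgn b"
  \<comment> \<open>\<open>\<rho> + 1\<close> rather than \<open>\<rho>\<close> keeps the
    denominator positive when \<open>\<rho> = 0\<close>.\<close>
  define \<epsilon>1 where "\<epsilon>1 = \<epsilon> / (2 * (\<rho> + 1))"
  have "0 < \<epsilon>1" using assms True by (auto simp: \<epsilon>1_def)
  have "((\<lambda>t. \<bar>b + t\<bar> powr g) has_derivative (\<lambda>t. ?k * t)) (at 0)"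
    using powr_abs_has_real_derivative[OF \<open>b \<noteq> 0\<close>] by (simp add: has_field_derivative_def mult.commute[of _ ?k] mult_commute_abs)
  from has_derivative_at_alt[THEN iffD1, OF this] \<open>0 < \<epsilon>1\<close>
  obtain \<eta> where \<eta>: "0 < \<eta>" "\<And>t. \<bar>t\<bar> < \<eta> \<Longrightarrow> \<bar>\<bar>b + t\<bar> powr g - \<bar>b\<bar> powr g - ?k * t\<bar> \<le> \<epsilon>1 * \<bar>t\<bar>"
    by (auto simp: abs_mult)
  have "\<forall>\<^sub>F n in sequentially. \<rho> / \<eta> < sqrt (real n)"
    by (rule eventually_compose_filterlim[OF eventually_gt_at_top])
       (intro filterlim_compose[OF sqrt_at_top filterlim_real_sequentially])
  moreover have "\<forall>\<^sub>F n in sequentially. dist (real n powr ((g0 - 1) / 2)) \<iota> < \<epsilon> / (2 * (\<bar>?k\<bar> * \<rho> + 1))"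
    using assms True by (intro tendstoD[OF \<iota>] divide_pos_pos mult_pos_pos add_nonneg_pos) auto
  moreover have "\<forall>\<^sub>F n in sequentially. 1 \<le> n" by (rule eventually_ge_at_top)
  ultimately show ?thesis
  proof eventually_elim
    case (elim n)
    show ?case
    proof (intro allI impI)
      fix x :: real assume x: "\<bar>x\<bar> \<le> \<rho>"
      define t where "t = x / sqrt n"
      have n: "0 < sqrt n" "1 \<le> n" using elim by auto
      have "\<rho> / sqrt n < \<eta>" using elim(1) \<eta>(1) n by (simp add: divide_less_eq mult.commute)
      then have "\<bar>t\<bar> < \<eta>" using x n divide_right_mono[of "\<bar>x\<bar>" \<rho> "sqrt n"] by (simp add: t_def abs_divide)
      have pw: "real n powr (g0 / 2) = sqrt n * real n powr ((g0 - 1) / 2)"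
        using n by (simp add: powr_half_sqrt[symmetric] flip: powr_add) (simp add: add_divide_distrib[symmetric])
      have "real n powr ((g0 - 1) / 2) \<le> real n powr 0"
        using n assms by (intro powr_mono) auto
      then have pw1: "real n powr ((g0 - 1) / 2) \<le> 1" using n by simp
      have "\<bar>real n powr (g0 / 2) * (\<bar>b + t\<bar> powr g - \<bar>b\<bar> powr g - ?k * t)\<bar> \<le> sqrt n * 1 * (\<epsilon>1 * \<bar>t\<bar>)"
        unfolding abs_mult pw using \<eta>(2)[OF \<open>\<bar>t\<bar> < \<eta>\<close>] pw1 n by (intro mult_mono) auto
      also have "\<dots> = \<epsilon>1 * \<bar>x\<bar>" using n by (simp add: t_def abs_divide)
      also have "\<dots> \<le> \<epsilon>1 * (\<rho> + 1)" using x \<open>0 < \<epsilon>1\<close> by (intro mult_left_mono) auto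
      also have "\<dots> = \<epsilon> / 2" using True by (simp add: \<epsilon>1_def divide_simps)
      finally have 1: "\<bar>real n powr (g0 / 2) * (\<bar>b + t\<bar> powr g - \<bar>b\<bar> powr g - ?k * t)\<bar> \<le> \<epsilon> / 2" .
      have "real n powr (g0 / 2) * (?k * t) = real n powr ((g0 - 1) / 2) * (?k * x)"
        unfolding pw using n by (simp add: t_def)
      then have "real n powr (g0 / 2) * (?k * t) - \<iota> * ?k * x = (real n powr ((g0 - 1) / 2) - \<iota>) * (?k * x)"
        by (simp only: left_diff_distrib mult.assoc)
      then have "\<bar>real n powr (g0 / 2) * (?k * t) - \<iota> * ?k * x\<bar> = \<bar>real n powr ((g0 - 1) / 2) - \<iota>\<bar> * (\<bar>?k\<bar> * \<bar>x\<bar>)"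
        by (simp only: abs_mult)
      also have "\<dots> \<le> \<epsilon> / (2 * (\<bar>?k\<bar> * \<rho> + 1)) * (\<bar>?k\<bar> * \<rho> + 1)"
      proof (rule mult_mono)
        show "\<bar>?k\<bar> * \<bar>x\<bar> \<le> \<bar>?k\<bar> * \<rho> + 1"
          using mult_left_mono[OF x, of "\<bar>?k\<bar>"] by linarith
        show "\<bar>real n powr ((g0 - 1) / 2) - \<iota>\<bar> \<le> \<epsilon> / (2 * (\<bar>?k\<bar> * \<rho> + 1))"
          using elim(2) by (simp only: dist_real_def less_imp_le)
        show "0 \<le> \<epsilon> / (2 * (\<bar>?k\<bar> * \<rho> + 1))"
          using assms(4) True by (intro divide_nonneg_pos mult_pos_pos add_nonneg_pos mult_nonneg_nonneg) auto
      qed auto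
      also have "\<dots> = \<epsilon> / 2"
      proof -
        have "0 < \<bar>?k\<bar> * \<rho> + 1" using True by (intro add_nonneg_pos mult_nonneg_nonneg) auto
        moreover have "\<epsilon> / (2 * a) * a = \<epsilon> / 2" if "0 < a" for a :: real using that by simp
        ultimately show ?thesis by blast
      qed
      finally have 2: "\<bar>real n powr (g0 / 2) * (?k * t) - \<iota> * ?k * x\<bar> \<le> \<epsilon> / 2" .
      have tri: "\<bar>p - q\<bar> \<le> \<epsilon> / 2 \<Longrightarrow> \<bar>q - r\<bar> \<le> \<epsilon> / 2 \<Longrightarrow> \<bar>p - r\<bar> \<le> \<epsilon>" for p q r :: real
        by linarith
      show "\<bar>real n powr (g0 / 2) * (\<bar>b + x / sqrt n\<bar> powr g - \<bar>b\<bar> powr g) - \<iota> * ?k * x\<bar> \<le> \<epsilon>"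
        unfolding t_def[symmetric] using 1 by (intro tri[OF _ 2]) (simp only: right_diff_distrib)
    qed
  qed
qed (auto intro!: always_eventually)

section \<open>Minimizers of the penalized criterion\<close>

text \<open>Purely deterministic setting. \<open>L n\<close> is the part of the criterion left after
  the linear score term: \<open>L_growth\<close> controls it in a fixed ball,
  \<open>L_convex\<close> carries that growth outside, and \<open>L_local\<close> gives its
  quadratic shape on the scale \<open>1 / sqrt n\<close>.\<close>

locale bridge_limit = pos_def_form J for J :: "real^'p^'p" +
  fixes B :: "(real^'p) set" and \<beta>s :: "real^'p" and L :: "nat \<Rightarrow> real^'p \<Rightarrow> real"
    and g g0 lam \<delta> \<kappa> :: real
  assumes in_B: "\<beta>s \<in> B"
    and g: "0 < g" "g < 1" "g < g0" "g0 \<le> 1" and lam: "0 < lam"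
    and \<delta>: "0 < \<delta>" "cball \<beta>s \<delta> \<subseteq> B" and \<kappa>: "0 < \<kappa>"
    and L_convex: "\<And>n. convex_on {h. \<beta>s + h \<in> B} (L n)"
    and L_0: "\<And>n. L n 0 = 0"
    and L_cont: "\<And>n. continuous_on (cball 0 \<delta>) (L n)"
    and L_growth: "\<forall>\<^sub>F n in sequentially. \<forall>h. norm h \<le> \<delta> \<longrightarrow> \<kappa> * n * norm h ^ 2 \<le> L n h"
    and L_local: "\<And>\<rho> \<epsilon>. 0 < \<epsilon> \<Longrightarrow> \<forall>\<^sub>F n in sequentially. \<forall>u. norm u \<le> \<rho> \<longrightarrow>
        \<bar>L n ((1 / sqrt n) *\<^sub>R u) - form u u / 2\<bar> \<le> \<epsilon>"
begin

definition active where "active = {j. \<beta>s $ j \<noteq> 0}"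

text \<open>Limit of \<open>real n powr ((g0 - 1) / 2)\<close>, the weight with which the linearized
  penalty acts on nonzero coefficients.\<close>

definition \<iota> :: real where "\<iota> = (if g0 = 1 then 1 else 0)"

definition drift :: "real^'p" where
  "drift = (\<chi> j. if j \<in> active then lam * \<iota> * (g * \<bar>\<beta>s $ j\<bar> powr (g - 1) * sgn (\<beta>s $ j)) else 0)"

text \<open>Increment of the penalized objective from \<open>\<beta>s\<close> to
  \<open>\<beta>s + h\<close>, with the score \<open>s\<close> as a free vector.\<close>

definition criterion :: "nat \<Rightarrow> real^'p \<Rightarrow> real^'p \<Rightarrow> real" where
  "criterion n s h = - sqrt n * (s \<bullet> h) + L n h
     + real n powr (g0 / 2) * lam * (\<Sum>j\<in>UNIV. \<bar>\<beta>s $ j + h $ j\<bar> powr g - \<bar>\<beta>s $ j\<bar> powr g)"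

definition penalty_slope where "penalty_slope = lam * (\<Sum>j\<in>active. \<bar>\<beta>s $ j\<bar> powr (g - 1))"

lemma penalty_slope_nonneg: "0 \<le> penalty_slope"
  using lam by (auto simp: penalty_slope_def intro!: mult_nonneg_nonneg sum_nonneg)

lemma penalty_split:
  "(\<Sum>j\<in>UNIV. \<bar>\<beta>s $ j + h $ j\<bar> powr g - \<bar>\<beta>s $ j\<bar> powr g)
    = (\<Sum>j\<in>active. \<bar>\<beta>s $ j + h $ j\<bar> powr g - \<bar>\<beta>s $ j\<bar> powr g) + (\<Sum>j\<in>-active. \<bar>h $ j\<bar> powr g)"
proof -
  have "(\<Sum>j\<in>UNIV. \<bar>\<beta>s $ j + h $ j\<bar> powr g - \<bar>\<beta>s $ j\<bar> powr g)
    = (\<Sum>j\<in>active. \<bar>\<beta>s $ j + h $ j\<bar> powr g - \<bar>\<beta>s $ j\<bar> powr g) + (\<Sum>j\<in>-active. \<bar>\<beta>s $ j + h $ j\<bar> powr g - \<bar>\<beta>s $ j\<bar> powr g)"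
    by (subst sum.union_disjoint[symmetric]) (auto simp: Compl_partition)
  also have "(\<Sum>j\<in>-active. \<bar>\<beta>s $ j + h $ j\<bar> powr g - \<bar>\<beta>s $ j\<bar> powr g) = (\<Sum>j\<in>-active. \<bar>h $ j\<bar> powr g)"
    by (intro sum.cong) (auto simp: active_def)
  finally show ?thesis .
qed

lemma powr_le_sqrt: "1 \<le> n \<Longrightarrow> real n powr (g0 / 2) \<le> sqrt n"
  using g powr_mono[of "g0/2" "1/2" "real n"] by (simp add: powr_half_sqrt)

text \<open>Inactive coordinates can only increase the penalty, and active ones decrease it at most
  linearly. Together with \<open>powr_le_sqrt\<close> the penalty is never worse than a linear term
  of size \<open>sqrt n\<close>, like the score term.\<close>

lemma penalty_ge:
  assumes "1 \<le> n"
  shows "- (sqrt n * penalty_slope * norm h)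
    \<le> real n powr (g0 / 2) * lam * (\<Sum>j\<in>UNIV. \<bar>\<beta>s $ j + h $ j\<bar> powr g - \<bar>\<beta>s $ j\<bar> powr g)"
proof -
  have "- (\<bar>\<beta>s $ j\<bar> powr (g - 1) * norm h) \<le> \<bar>\<beta>s $ j + h $ j\<bar> powr g - \<bar>\<beta>s $ j\<bar> powr g" if "j \<in> active" for j
  proof -
    have "\<bar>\<beta>s $ j\<bar> powr (g - 1) * \<bar>h $ j\<bar> \<le> \<bar>\<beta>s $ j\<bar> powr (g - 1) * norm h"
      using component_le_norm_cart[of h j] by (intro mult_left_mono) auto
    then show ?thesis
      using that g by (intro order_trans[OF _ powr_abs_diff_ge]) (auto simp: active_def)
  qed
  then have "(\<Sum>j\<in>active. - (\<bar>\<beta>s $ j\<bar> powr (g - 1) * norm h)) \<le> (\<Sum>j\<in>active. \<bar>\<beta>s $ j + h $ j\<bar> powr g - \<bar>\<beta>s $ j\<bar> powr g)"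
    by (intro sum_mono) auto
  moreover have "0 \<le> (\<Sum>j\<in>-active. \<bar>h $ j\<bar> powr g)" by (intro sum_nonneg) auto
  ultimately have "(\<Sum>j\<in>active. - (\<bar>\<beta>s $ j\<bar> powr (g - 1) * norm h)) \<le> (\<Sum>j\<in>UNIV. \<bar>\<beta>s $ j + h $ j\<bar> powr g - \<bar>\<beta>s $ j\<bar> powr g)"
    unfolding penalty_split by linarith
  then have "real n powr (g0 / 2) * lam * (\<Sum>j\<in>active. - (\<bar>\<beta>s $ j\<bar> powr (g - 1) * norm h))
    \<le> real n powr (g0 / 2) * lam * (\<Sum>j\<in>UNIV. \<bar>\<beta>s $ j + h $ j\<bar> powr g - \<bar>\<beta>s $ j\<bar> powr g)"
    using lam by (intro mult_left_mono) auto
  also have "real n powr (g0 / 2) * lam * (\<Sum>j\<in>active. - (\<bar>\<beta>s $ j\<bar> powr (g - 1) * norm h)) = - (real n powr (g0 / 2) * (penalty_slope * norm h))"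
    by (simp add: penalty_slope_def sum_negf sum_distrib_right mult.assoc)
  finally show ?thesis
    using mult_right_mono[OF powr_le_sqrt[OF assms], of "penalty_slope * norm h"] penalty_slope_nonneg by (simp add: mult.assoc)
qed

lemma criterion_ge:
  assumes "1 \<le> n" "norm s \<le> R"
  shows "L n h - sqrt n * (R + penalty_slope) * norm h \<le> criterion n s h"
proof -
  have "s \<bullet> h \<le> norm s * norm h" by (rule norm_cauchy_schwarz)
  also have "\<dots> \<le> R * norm h" using assms by (intro mult_right_mono) auto
  finally have "sqrt n * (s \<bullet> h) \<le> sqrt n * (R * norm h)" by (intro mult_left_mono) auto
  then show ?thesis
    using penalty_ge[OF assms(1), of h] by (simp add: criterion_def algebra_simps)
qed

lemma criterion_0: "criterion n s 0 = 0"
  by (simp add: criterion_def L_0)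

text \<open>Convexity along the ray from 0 turns the growth on the sphere of radius
  \<open>\<delta>\<close> into \<open>\<kappa> * n * \<delta> * norm h\<close> beyond it, and
  \<open>n\<close> outgrows the \<open>sqrt n\<close> of the score and penalty terms.\<close>

lemma criterion_pos_far:
  "\<forall>\<^sub>F n in sequentially. \<forall>s h. norm s \<le> R \<longrightarrow> \<beta>s + h \<in> B \<longrightarrow> \<delta> \<le> norm h \<longrightarrow> 0 < criterion n s h"
proof -
  have "\<forall>\<^sub>F n in sequentially. (R + penalty_slope) / (\<kappa> * \<delta>) < sqrt (real n)"
    by (rule eventually_compose_filterlim[OF eventually_gt_at_top])
       (intro filterlim_compose[OF sqrt_at_top filterlim_real_sequentially])
  moreover have "\<forall>\<^sub>F n in sequentially. 1 \<le> n" by (rule eventually_ge_at_top)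
  ultimately show ?thesis using L_growth
  proof eventually_elim
    case (elim n)
    show ?case
    proof (intro allI impI)
      fix s h :: "real^'p" assume s: "norm s \<le> R" and h: "\<beta>s + h \<in> B" "\<delta> \<le> norm h"
      \<comment> \<open>Scales \<open>h\<close> back to the sphere of radius
        \<open>\<delta>\<close>, where \<open>L_growth\<close> applies.\<close>
      define t where "t = \<delta> / norm h"
      have t: "0 < t" "t \<le> 1" "norm (t *\<^sub>R h) = \<delta>"
        using \<delta> h by (auto simp: t_def divide_le_eq intro!: divide_pos_pos)
      have "L n ((1 - t) *\<^sub>R 0 + t *\<^sub>R h) \<le> (1 - t) * L n 0 + t * L n h"
        using t h in_B by (intro convex_onD[OF L_convex]) auto
      then have "L n (t *\<^sub>R h) \<le> t * L n h" by (simp add: L_0)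
      moreover have "\<kappa> * n * \<delta> ^ 2 \<le> L n (t *\<^sub>R h)"
        by (metis elim(3) order_refl t(3))
      ultimately have "\<kappa> * n * \<delta> ^ 2 \<le> t * L n h" by simp
      then have "\<kappa> * n * \<delta> ^ 2 * (norm h / \<delta>) \<le> t * L n h * (norm h / \<delta>)"
        using \<delta> by (intro mult_right_mono) auto
      moreover have "t * (norm h / \<delta>) = 1" using \<delta> h by (auto simp: t_def)
      then have "t * L n h * (norm h / \<delta>) = L n h" by (metis mult.assoc mult.commute mult_1)
      ultimately have Ln: "\<kappa> * n * \<delta> * norm h \<le> L n h"
        using \<delta> by (simp add: power2_eq_square)
      have n: "0 < sqrt n" using elim by auto
      have "R + penalty_slope < \<kappa> * \<delta> * sqrt n"
        using elim(1) \<delta> \<kappa> by (simp add: divide_less_eq mult_ac)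
      then have "sqrt n * (R + penalty_slope) * norm h < sqrt n * (\<kappa> * \<delta> * sqrt n) * norm h"
        using n h \<delta> by (intro mult_strict_right_mono mult_strict_left_mono) auto
      also have "\<dots> = \<kappa> * n * \<delta> * norm h"
        by (simp add: mult_ac)
      finally show "0 < criterion n s h"
        using Ln criterion_ge[OF elim(2) s, of h] by linarith
    qed
  qed
qed

lemma continuous_on_criterion: "continuous_on (cball 0 \<delta>) (criterion n s)"
  unfolding criterion_def[abs_def]
  using g by (intro continuous_intros L_cont continuous_on_powr') auto

text \<open>\<open>B\<close> is open, so existence is not automatic. A minimizer over the closed
  ball is global, since its value is at most the value 0 at the origin while the criterion is
  positive outside.\<close>

lemma minimizer_exists:
  "\<forall>\<^sub>F n in sequentially. \<forall>s. norm s \<le> R \<longrightarrow> (\<exists>h. \<beta>s + h \<in> B \<and> (\<forall>h'. \<beta>s + h' \<in> B \<longrightarrow> criterion n s h \<le> criterion n s h'))"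
  using criterion_pos_far[of R]
proof eventually_elim
  case (elim n)
  show ?case
  proof (intro allI impI)
    fix s :: "real^'p" assume s: "norm s \<le> R"
    have ne: "cball (0::real^'p) \<delta> \<noteq> {}" using \<delta> by simp
    obtain h where h: "h \<in> cball 0 \<delta>" "\<And>h'. h' \<in> cball 0 \<delta> \<Longrightarrow> criterion n s h \<le> criterion n s h'"
      using continuous_attains_inf[OF compact_cball ne continuous_on_criterion] by blast
    have "criterion n s h \<le> 0"
      using h(2)[of 0] \<delta> by (simp add: criterion_0)
    have "criterion n s h \<le> criterion n s h'" if "\<beta>s + h' \<in> B" for h'
    proof (cases "norm h' \<le> \<delta>")
      case False
      then have "0 < criterion n s h'" using elim s that by auto
      then show ?thesis using \<open>criterion n s h \<le> 0\<close> by simp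
    qed (use h(2) in auto)
    moreover have "\<beta>s + h \<in> B" using h(1) \<delta>(2) by (auto simp: dist_norm subset_iff)
    ultimately show "\<exists>h. \<beta>s + h \<in> B \<and> (\<forall>h'. \<beta>s + h' \<in> B \<longrightarrow> criterion n s h \<le> criterion n s h')"
      by blast
  qed
qed

text \<open>Any point with nonpositive criterion lies in the \<open>\<delta>\<close>-ball, where the
  quadratic growth must not exceed the linear terms; dividing by \<open>sqrt n * norm h\<close>
  gives the rate.\<close>

lemma minimizer_rate:
  "\<forall>\<^sub>F n in sequentially. \<forall>s h. norm s \<le> R \<longrightarrow> \<beta>s + h \<in> B \<longrightarrow> criterion n s h \<le> 0 \<longrightarrow>
     norm (sqrt n *\<^sub>R h) \<le> (R + penalty_slope) / \<kappa>"
  using criterion_pos_far[of R] L_growth eventually_ge_at_top[of 1]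
proof eventually_elim
  case (elim n)
  show ?case
  proof (intro allI impI)
    fix s h :: "real^'p" assume s: "norm s \<le> R" and h: "\<beta>s + h \<in> B" "criterion n s h \<le> 0"
    have "norm h < \<delta>" using elim(1) s h by (meson not_le)
    then have "\<kappa> * n * norm h ^ 2 \<le> L n h" using elim(2) by auto
    then have le: "\<kappa> * n * norm h ^ 2 \<le> sqrt n * (R + penalty_slope) * norm h"
      using criterion_ge[OF elim(3) s, of h] h by linarith
    have "norm s + penalty_slope \<le> R + penalty_slope" using s by simp
    then have nn: "0 \<le> R + penalty_slope" using penalty_slope_nonneg norm_ge_zero[of s] by linarith
    show "norm (sqrt n *\<^sub>R h) \<le> (R + penalty_slope) / \<kappa>"
    proof (cases "h = 0")
      case False
      have n: "0 < sqrt n" using elim by auto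
      have "(sqrt n * norm h) * (\<kappa> * (sqrt n * norm h)) \<le> (sqrt n * norm h) * (R + penalty_slope)"
        using le by (simp add: power2_eq_square mult_ac flip: real_sqrt_mult)
      then have "\<kappa> * (sqrt n * norm h) \<le> R + penalty_slope"
        by (rule mult_left_le_imp_le) (use n False in simp)
      then show ?thesis using \<kappa> by (simp add: le_divide_eq mult_ac)
    qed (use nn \<kappa> in simp)
  qed
qed

lemma \<iota>_limit: "(\<lambda>n. real n powr ((g0 - 1) / 2)) \<longlonglongrightarrow> \<iota>"
proof (cases "g0 = 1")
  case True
  \<comment> \<open>The equality starts at \<open>n = 1\<close>, because \<open>0 powr 0\<close> is
    0.\<close>
  have "\<forall>\<^sub>F n in sequentially. real n powr ((g0 - 1) / 2) = \<iota>"
    using eventually_gt_at_top[of 0] by eventually_elim (unfold \<iota>_def, simp add: True)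
  then show ?thesis by (rule tendsto_eventually)
next
  case False
  then have "(g0 - 1) / 2 < 0" using g by simp
  then show ?thesis
    using False by (auto simp: \<iota>_def intro!: tendsto_neg_powr filterlim_real_sequentially)
qed

lemma penalty_active_limit:
  assumes "0 < \<epsilon>"
  shows "\<forall>\<^sub>F n in sequentially. \<forall>u::real^'p. norm u \<le> \<rho> \<longrightarrow>
    \<bar>real n powr (g0 / 2) * lam * (\<Sum>j\<in>active. \<bar>\<beta>s $ j + u $ j / sqrt n\<bar> powr g - \<bar>\<beta>s $ j\<bar> powr g) - drift \<bullet> u\<bar> \<le> \<epsilon>"
proof -
  define \<epsilon>1 where "\<epsilon>1 = \<epsilon> / (lam * (card active + 1))"
  have "0 < \<epsilon>1" using assms lam by (auto simp: \<epsilon>1_def)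
  have "\<forall>\<^sub>F n in sequentially. \<forall>j\<in>active. \<forall>x. \<bar>x\<bar> \<le> \<rho> \<longrightarrow>
    \<bar>real n powr (g0 / 2) * (\<bar>\<beta>s $ j + x / sqrt n\<bar> powr g - \<bar>\<beta>s $ j\<bar> powr g)
      - \<iota> * (g * \<bar>\<beta>s $ j\<bar> powr (g - 1) * sgn (\<beta>s $ j)) * x\<bar> \<le> \<epsilon>1"
    using g \<iota>_limit \<open>0 < \<epsilon>1\<close>
    by (intro eventually_ball_finite ballI power_penalty_limit) (auto simp: active_def)
  then show ?thesis
  proof eventually_elim
    case (elim n)
    show ?case
    proof (intro allI impI)
      fix u :: "real^'p" assume u: "norm u \<le> \<rho>"
      let ?f = "\<lambda>j. real n powr (g0 / 2) * (\<bar>\<beta>s $ j + u $ j / sqrt n\<bar> powr g - \<bar>\<beta>s $ j\<bar> powr g)"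
      let ?d = "\<lambda>j. \<iota> * (g * \<bar>\<beta>s $ j\<bar> powr (g - 1) * sgn (\<beta>s $ j)) * u $ j"
      have "drift \<bullet> u = (\<Sum>j\<in>UNIV. if j \<in> active then lam * ?d j else 0)"
        unfolding inner_vec_def drift_def by (intro sum.cong) (auto simp: mult_ac)
      also have "\<dots> = (\<Sum>j\<in>active. lam * ?d j)"
        by (simp add: sum.If_cases)
      finally have dr: "drift \<bullet> u = lam * (\<Sum>j\<in>active. ?d j)" by (simp add: sum_distrib_left)
      have "real n powr (g0 / 2) * lam * (\<Sum>j\<in>active. \<bar>\<beta>s $ j + u $ j / sqrt n\<bar> powr g - \<bar>\<beta>s $ j\<bar> powr g)
        = lam * (\<Sum>j\<in>active. ?f j)"
        by (simp add: sum_distrib_left[symmetric])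
      then have "\<bar>real n powr (g0 / 2) * lam * (\<Sum>j\<in>active. \<bar>\<beta>s $ j + u $ j / sqrt n\<bar> powr g - \<bar>\<beta>s $ j\<bar> powr g) - drift \<bullet> u\<bar>
        = lam * \<bar>\<Sum>j\<in>active. ?f j - ?d j\<bar>"
        unfolding dr by (simp only: abs_mult abs_of_pos[OF lam] sum_subtractf flip: right_diff_distrib)
      also have "\<dots> \<le> lam * (\<Sum>j\<in>active. \<epsilon>1)"
      proof (intro mult_left_mono order_trans[OF sum_abs] sum_mono)
        fix j assume "j \<in> active"
        moreover have "\<bar>u $ j\<bar> \<le> \<rho>" using u component_le_norm_cart[of u j] by linarith
        ultimately show "\<bar>?f j - ?d j\<bar> \<le> \<epsilon>1" using elim by blast
      qed (use lam in auto)
      also have "\<dots> = lam * card active * \<epsilon>1" by simp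
      also have "\<dots> \<le> lam * (card active + 1) * \<epsilon>1"
        using lam \<open>0 < \<epsilon>1\<close> by (intro mult_right_mono mult_left_mono) auto
      also have "\<dots> = \<epsilon>" using lam by (simp add: \<epsilon>1_def)
      finally show "\<bar>real n powr (g0 / 2) * lam * (\<Sum>j\<in>active. \<bar>\<beta>s $ j + u $ j / sqrt n\<bar> powr g - \<bar>\<beta>s $ j\<bar> powr g) - drift \<bullet> u\<bar> \<le> \<epsilon>" .
    qed
  qed
qed

text \<open>
  The criterion at the minimizer is compared with its value at \<open>U s\<close>.  The penalty off the active
  set dominates every linear term and pushes the inactive coordinates to 0; the quadratic excess over
  the minimum on the active subspace then controls the distance to \<open>U s\<close>.
\<close>

lemma minimizer_limit:
  assumes U_supp: "\<And>s j. j \<notin> active \<Longrightarrow> U s $ j = 0"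
    and U_form: "\<And>s u. (\<And>j. j \<notin> active \<Longrightarrow> u $ j = 0) \<Longrightarrow> form u (U s) = u \<bullet> (s - drift)"
    and U_bound: "\<And>s. norm s \<le> R \<Longrightarrow> norm (U s) \<le> RU" and "0 < \<epsilon>"
  shows "\<forall>\<^sub>F n in sequentially. \<forall>s h. norm s \<le> R \<longrightarrow> \<beta>s + h \<in> B \<longrightarrow>
    (\<forall>h'. \<beta>s + h' \<in> B \<longrightarrow> criterion n s h \<le> criterion n s h') \<longrightarrow> norm (sqrt n *\<^sub>R h - U s) \<le> \<epsilon>"
proof -
  obtain c where c: "0 < c" "\<And>x. c * norm x ^ 2 \<le> form x x"
    using form_coercive by metis
  \<comment> \<open>A ball that contains both the rescaled minimizer, by
    \<open>minimizer_rate\<close>, and its claimed limit \<open>U s\<close>.\<close>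
  define \<rho> where "\<rho> = 1 + \<bar>(R + penalty_slope) / \<kappa>\<bar> + \<bar>RU\<bar>"
  have \<rho>: "1 \<le> \<rho>" "(R + penalty_slope) / \<kappa> \<le> \<rho>" "RU \<le> \<rho>" using abs_ge_self[of "(R + penalty_slope) / \<kappa>"] abs_ge_self[of RU] unfolding \<rho>_def by linarith+
  \<comment> \<open>On the ball of radius \<open>\<rho>\<close> the quadratic part varies with slope
    at most \<open>K\<close>; the summand 1 yields \<open>norm u'' \<le> K * norm u''\<close> at the
    end.\<close>
  define K where "K = 1 + norm J * \<rho> + \<bar>R\<bar> + norm drift"
  have K: "1 \<le> K" using \<rho> by (simp add: K_def)
  \<comment> \<open>The two entries produce \<open>4 * \<eta> \<le> \<epsilon> / 2\<close> for the
    inactive part and \<open>8 * \<eta> \<le> c * (\<epsilon> / 2) ^ 2\<close> for the active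
    part.\<close>
  define \<eta> where "\<eta> = min (\<epsilon> / 8) (c * \<epsilon> ^ 2 / 32)"
  have \<eta>: "0 < \<eta>" "4 * \<eta> \<le> \<epsilon> / 2" "8 * \<eta> \<le> c * (\<epsilon> / 2) ^ 2"
    using c \<open>0 < \<epsilon>\<close> by (auto simp: \<eta>_def power_divide)
  let ?m = "lam * \<rho> powr (g - 1)"
  have m: "0 < ?m" using lam \<rho> by simp
  have "(\<lambda>n. real n powr (- ((g0 - g) / 2))) \<longlonglongrightarrow> 0"
    using g by (intro tendsto_neg_powr filterlim_real_sequentially) auto
  then have "\<forall>\<^sub>F n in sequentially. real n powr (- ((g0 - g) / 2)) < ?m / (2 * K)"
    using m K by (intro order_tendstoD(2)) auto
  moreover have "\<forall>\<^sub>F n in sequentially. \<rho> / \<delta> < sqrt (real n)"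
    by (rule eventually_compose_filterlim[OF eventually_gt_at_top])
       (intro filterlim_compose[OF sqrt_at_top filterlim_real_sequentially])
  moreover note minimizer_rate[of R] L_local[OF \<open>0 < \<eta>\<close>, of \<rho>] penalty_active_limit[OF \<open>0 < \<eta>\<close>, of \<rho>] eventually_ge_at_top[of 1]
  ultimately show ?thesis
  proof eventually_elim
    case (elim n)
    have n: "0 < sqrt n" using elim by auto
    define w where "w u = real n powr (g0 / 2) * lam * (\<Sum>j\<in>-active. \<bar>u $ j / sqrt n\<bar> powr g)" for u :: "real^'p"
    define q where "q s u = form u u / 2 - (s - drift) \<bullet> u" for s u
    have crit: "\<bar>criterion n s ((1 / sqrt n) *\<^sub>R u) - (q s u + w u)\<bar> \<le> 2 * \<eta>" if "norm u \<le> \<rho>" for s u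
    proof -
      have "criterion n s ((1 / sqrt n) *\<^sub>R u) - (q s u + w u)
        = (L n ((1 / sqrt n) *\<^sub>R u) - form u u / 2)
          + (real n powr (g0 / 2) * lam * (\<Sum>j\<in>active. \<bar>\<beta>s $ j + u $ j / sqrt n\<bar> powr g - \<bar>\<beta>s $ j\<bar> powr g) - drift \<bullet> u)"
        using n unfolding criterion_def penalty_split q_def w_def
        by (simp add: inner_diff_left distrib_left)
      moreover have "\<bar>x + y\<bar> \<le> 2 * \<eta>" if "\<bar>x\<bar> \<le> \<eta>" "\<bar>y\<bar> \<le> \<eta>" for x y :: real
        using that by linarith
      ultimately show ?thesis
        using elim(4,5) that by simp
    qed
    \<comment> \<open>For \<open>\<bar>x\<bar> \<le> \<rho>\<close> concavity gives
      \<open>\<bar>x\<bar> powr g \<ge> \<rho> powr (g - 1) * \<bar>x\<bar>\<close>, and the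
      diverging factor \<open>n powr ((g0 - g) / 2)\<close> then raises the slope above
      \<open>2 * K\<close>.\<close>
    have w_ge: "2 * K * (\<Sum>j\<in>-active. \<bar>u $ j\<bar>) \<le> w u" if u: "norm u \<le> \<rho>" for u
    proof -
      have pw: "2 * K / ?m \<le> real n powr ((g0 - g) / 2)"
        using elim(1,6) m K by (simp add: powr_minus field_simps)
      have "?m * (\<Sum>j\<in>-active. \<bar>u $ j\<bar>) = lam * (\<Sum>j\<in>-active. \<rho> powr (g - 1) * \<bar>u $ j\<bar>)"
        by (simp add: sum_distrib_left mult_ac)
      also have "\<dots> \<le> lam * (\<Sum>j\<in>-active. \<bar>u $ j\<bar> powr g)"
      proof (intro mult_left_mono sum_mono)
        fix j
        have uj: "\<bar>u $ j\<bar> \<le> \<rho>" using u component_le_norm_cart[of u j] by linarith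
        show "\<rho> powr (g - 1) * \<bar>u $ j\<bar> \<le> \<bar>u $ j\<bar> powr g"
        proof (cases "u $ j = 0")
          case False
          have "\<rho> powr (g - 1) \<le> \<bar>u $ j\<bar> powr (g - 1)"
            using uj False g by (intro powr_mono2') auto
          then have "\<rho> powr (g - 1) * \<bar>u $ j\<bar> \<le> \<bar>u $ j\<bar> powr (g - 1) * \<bar>u $ j\<bar>"
            by (intro mult_right_mono) auto
          also have "\<dots> = \<bar>u $ j\<bar> powr g" using False by (simp add: powr_diff)
          finally show ?thesis .
        qed simp
      qed (use lam in auto)
      finally have F: "?m * (\<Sum>j\<in>-active. \<bar>u $ j\<bar>) \<le> lam * (\<Sum>j\<in>-active. \<bar>u $ j\<bar> powr g)" .
      have "2 * K / ?m * (?m * (\<Sum>j\<in>-active. \<bar>u $ j\<bar>)) \<le> real n powr ((g0 - g) / 2) * (lam * (\<Sum>j\<in>-active. \<bar>u $ j\<bar> powr g))"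
        by (rule mult_mono[OF pw F]) (use lam in \<open>auto intro!: sum_nonneg mult_nonneg_nonneg\<close>)
      moreover have "2 * K / a * (a * x) = 2 * K * x" if "0 < a" for a x :: real
        using that by simp
      note this[OF m]
      moreover have "w u = real n powr ((g0 - g) / 2) * (lam * (\<Sum>j\<in>-active. \<bar>u $ j\<bar> powr g))"
      proof -
        have "sqrt n powr g = (real n powr (1 / 2)) powr g"
          by (subst powr_half_sqrt) auto
        then have sq: "sqrt n powr g = real n powr (g / 2)"
          by (simp add: powr_powr)
        have e: "\<bar>u $ j / sqrt n\<bar> powr g = \<bar>u $ j\<bar> powr g * inverse (real n powr (g / 2))" for j
          unfolding abs_divide sq[symmetric] by (subst powr_divide) (auto simp: divide_inverse)
        have "w u = real n powr (g0 / 2) * lam * ((\<Sum>j\<in>-active. \<bar>u $ j\<bar> powr g) * inverse (real n powr (g / 2)))"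
          unfolding w_def e by (simp only: sum_distrib_right)
        also have "\<dots> = (real n powr (g0 / 2) * inverse (real n powr (g / 2))) * (lam * (\<Sum>j\<in>-active. \<bar>u $ j\<bar> powr g))"
          by (simp only: mult_ac)
        also have "real n powr (g0 / 2) * inverse (real n powr (g / 2)) = real n powr ((g0 - g) / 2)"
          by (simp only: diff_divide_distrib powr_diff flip: divide_inverse)
        finally show ?thesis .
      qed
      ultimately show ?thesis by simp
    qed
    show ?case
    proof (intro allI impI)
      fix s h :: "real^'p"
      assume s: "norm s \<le> R" and h: "\<beta>s + h \<in> B" "\<forall>h'. \<beta>s + h' \<in> B \<longrightarrow> criterion n s h \<le> criterion n s h'"
      define u where "u = sqrt n *\<^sub>R h"
      have hu: "h = (1 / sqrt n) *\<^sub>R u" using n by (simp add: u_def)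
      have "criterion n s h \<le> criterion n s 0" using h(2) in_B by auto
      then have u: "norm u \<le> \<rho>"
        using elim(3) s h(1) \<rho>(2) unfolding criterion_0 u_def by (meson order_trans)
      have U: "norm (U s) \<le> \<rho>" using U_bound[OF s] \<rho> by simp
      have "norm (U s) < \<delta> * sqrt n"
        using U elim(2) \<delta> by (simp add: divide_less_eq mult.commute)
      then have "norm ((1 / sqrt n) *\<^sub>R U s) \<le> \<delta>"
        using n by (simp add: divide_le_eq)
      then have "\<beta>s + (1 / sqrt n) *\<^sub>R U s \<in> cball \<beta>s \<delta>" by (simp only: mem_cball dist_norm) (simp add: norm_minus_commute)
      then have "criterion n s h \<le> criterion n s ((1 / sqrt n) *\<^sub>R U s)"
        using h(2) \<delta>(2) by blast
      moreover have "w (U s) = 0"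
        unfolding w_def using U_supp by (auto intro!: sum.neutral)
      \<comment> \<open>The approximation \<open>crit\<close> is used at two points, at a cost of
        \<open>2 * \<eta>\<close> each.\<close>
      ultimately have le: "q s u + w u \<le> q s (U s) + 4 * \<eta>"
        using crit[OF u, of s] crit[OF U, of s] unfolding hu by linarith
      define u' where "u' = (\<chi> j. if j \<in> active then u $ j else 0)"
      define u'' where "u'' = u - u'"
      have u'_supp: "u' $ j = 0" if "j \<notin> active" for j using that by (simp add: u'_def)
      have nu': "norm u' \<le> \<rho>"
        by (rule order_trans[OF norm_le_componentwise_cart u]) (simp add: u'_def)
      have nu'': "norm u'' \<le> (\<Sum>j\<in>-active. \<bar>u $ j\<bar>)"
      proof -
        have "norm u'' \<le> (\<Sum>j\<in>UNIV. \<bar>u'' $ j\<bar>)" by (rule norm_le_l1_cart)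
        also have "\<dots> = (\<Sum>j\<in>-active. \<bar>u $ j\<bar>)"
          by (rule sum.mono_neutral_cong_right) (auto simp: u''_def u'_def)
        finally show ?thesis .
      qed
      \<comment> \<open>\<open>U_form\<close> is the stationarity of \<open>q s\<close> at
        \<open>U s\<close> along the active subspace, so the expansion at \<open>U s\<close> has no
        linear term.\<close>
      have "q s u' = q s (U s) + form (u' - U s) (u' - U s) / 2"
      proof -
        have "form u' (U s) = u' \<bullet> (s - drift)" "form (U s) (U s) = U s \<bullet> (s - drift)"
          using U_form u'_supp U_supp by blast+
        then show ?thesis
          unfolding q_def form_simps form_sym[of "U s" u'] by (simp add: inner_commute add_divide_distrib diff_divide_distrib)
      qed
      moreover have "\<bar>q s u - q s u'\<bar> \<le> K * norm u''"
      proof -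
        have uu: "u = u' + u''" by (simp add: u''_def)
        have "q s u - q s u' = (form u u'' + form u' u'') / 2 - (s - drift) \<bullet> u''"
          unfolding q_def uu form_simps form_sym[of u'' u'] by (simp add: inner_add_right add_divide_distrib)
        moreover have "\<bar>form u u''\<bar> \<le> norm J * \<rho> * norm u''"
          using u by (intro order_trans[OF form_le] mult_right_mono mult_left_mono) auto
        moreover have "\<bar>form u' u''\<bar> \<le> norm J * \<rho> * norm u''"
          using nu' by (intro order_trans[OF form_le] mult_right_mono mult_left_mono) auto
        moreover have "\<bar>(s - drift) \<bullet> u''\<bar> \<le> (\<bar>R\<bar> + norm drift) * norm u''"
          using s norm_triangle_ineq4[of s drift] by (intro order_trans[OF Cauchy_Schwarz_ineq2] mult_right_mono) auto
        moreover have "\<bar>(x + y) / 2 - z\<bar> \<le> a + c" if "\<bar>x\<bar> \<le> a" "\<bar>y\<bar> \<le> a" "\<bar>z\<bar> \<le> c" for x y z a c :: real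
          using that by argo
        ultimately have "\<bar>q s u - q s u'\<bar> \<le> norm J * \<rho> * norm u'' + (\<bar>R\<bar> + norm drift) * norm u''"
          by simp
        also have "\<dots> \<le> norm u'' + norm J * \<rho> * norm u'' + (\<bar>R\<bar> + norm drift) * norm u''"
          by simp
        also have "\<dots> = K * norm u''"
          by (simp add: K_def algebra_simps)
        finally show ?thesis .
      qed
      ultimately have main: "form (u' - U s) (u' - U s) / 2 + w u \<le> K * norm u'' + 4 * \<eta>"
        using le by linarith
      \<comment> \<open>Of the slope \<open>2 * K\<close>, one \<open>K\<close> compensates the loss
        in the quadratic part and the other remains to bound \<open>norm u''\<close>.\<close>
      have Ku: "2 * (K * norm u'') \<le> w u"
      proof -
        have "2 * K * norm u'' \<le> 2 * K * (\<Sum>j\<in>-active. \<bar>u $ j\<bar>)"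
          using nu'' K by (intro mult_left_mono) auto
        also have "\<dots> \<le> w u" by (rule w_ge[OF u])
        finally show ?thesis by (simp add: mult.assoc)
      qed
      have "norm u'' \<le> K * norm u''" using K by (simp add: mult_le_cancel_right1)
      moreover have "K * norm u'' \<le> 4 * \<eta>"
        using main Ku form_nonneg[of "u' - U s"] by linarith
      ultimately have 1: "norm u'' \<le> \<epsilon> / 2" using \<eta> by linarith
      have "c * norm (u' - U s) ^ 2 \<le> 8 * \<eta>"
      proof -
        have "0 \<le> K * norm u''" using K by simp
        then show ?thesis using main Ku c(2)[of "u' - U s"] by linarith
      qed
      then have "c * norm (u' - U s) ^ 2 \<le> c * (\<epsilon> / 2) ^ 2" using \<eta> by linarith
      then have "norm (u' - U s) ^ 2 \<le> (\<epsilon> / 2) ^ 2"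
        by (rule mult_left_le_imp_le[OF _ c(1)])
      then have "norm (u' - U s) \<le> \<epsilon> / 2"
        using \<open>0 < \<epsilon>\<close> by (rule_tac power2_le_imp_le) auto
      then have "norm (u'' + (u' - U s)) \<le> \<epsilon>" using 1 norm_triangle_ineq[of u'' "u' - U s"] by linarith
      then show "norm (sqrt n *\<^sub>R h - U s) \<le> \<epsilon>"
        by (simp add: u''_def u_def)
    qed
  qed
qed

end

section \<open>Weak convergence through weighted characteristic functions\<close>

lemma borel_measurable_cnj [measurable]: "cnj \<in> borel_measurable borel"
  by (intro borel_measurable_continuous_onI continuous_intros)

context prob_space
begin

lemma integrable_bounded_mult:
  fixes \<rho> :: "'a \<Rightarrow> complex" and h :: "real \<Rightarrow> complex"
  assumes [measurable]: "\<rho> \<in> borel_measurable M" "W \<in> borel_measurable M" "h \<in> borel_measurable borel"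
    and "\<And>\<omega>. norm (\<rho> \<omega>) \<le> 1" "\<And>x. norm (h x) \<le> H"
  shows "integrable M (\<lambda>\<omega>. \<rho> \<omega> * h (W \<omega>))"
proof (rule integrable_const_bound[where B=H])
  show "AE \<omega> in M. norm (\<rho> \<omega> * h (W \<omega>)) \<le> H"
  proof (rule AE_I2)
    fix \<omega>
    have "norm (\<rho> \<omega>) * norm (h (W \<omega>)) \<le> 1 * H"
      using assms(4,5) by (intro mult_mono) auto
    then show "norm (\<rho> \<omega> * h (W \<omega>)) \<le> H" by (simp add: norm_mult)
  qed
qed simp

lemma levy_bounded_continuous:
  fixes W :: "nat \<Rightarrow> 'a \<Rightarrow> real" and h :: "real \<Rightarrow> complex"
  assumes [measurable]: "\<And>n. W n \<in> borel_measurable M"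
    and cW: "\<And>x. (\<lambda>n. expectation (\<lambda>\<omega>. iexp (x * W n \<omega>))) \<longlonglongrightarrow> of_real (exp (- x\<^sup>2 / 2))"
    and h: "\<And>x. isCont h x" "\<And>x. norm (h x) \<le> H"
  shows "(\<lambda>n. expectation (\<lambda>\<omega>. h (W n \<omega>))) \<longlonglongrightarrow> (\<integral>x. h x \<partial>std_normal_distribution)"
proof -
  have [measurable]: "h \<in> borel_measurable borel"
    using h(1) by (intro borel_measurable_continuous_onI) (simp add: continuous_on_eq_continuous_at)
  have D: "\<And>n. real_distribution (distr M borel (W n))"
    by (rule real_distribution_distr) simp
  have "weak_conv_m (\<lambda>n. distr M borel (W n)) std_normal_distribution"
    using cW by (intro levy_continuity D real_dist_normal_dist) (simp add: char_def integral_distr char_std_normal_distribution)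
  then have "(\<lambda>n. integral\<^sup>L (distr M borel (W n)) h) \<longlonglongrightarrow> integral\<^sup>L std_normal_distribution h"
    by (rule weak_conv_imp_integral_bdd_continuous_conv[OF D real_dist_normal_dist _ h])
  then show ?thesis by (simp add: integral_distr)
qed

text \<open>
  Levy's continuity theorem for the law of \<open>W\<close> under the probability with density proportional
  to \<open>2 + \<sigma>\<close>; the constant 2 keeps the normalizing factors away from 0.
\<close>

lemma levy_real_weight:
  fixes W \<sigma> :: "nat \<Rightarrow> 'a \<Rightarrow> real" and h :: "real \<Rightarrow> complex"
  assumes [measurable]: "\<And>n. W n \<in> borel_measurable M" "\<And>n. \<sigma> n \<in> borel_measurable M"
    and \<sigma>: "\<And>n \<omega>. \<bar>\<sigma> n \<omega>\<bar> \<le> 1"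
    and cW: "\<And>x. (\<lambda>n. expectation (\<lambda>\<omega>. iexp (x * W n \<omega>))) \<longlonglongrightarrow> of_real (exp (- x\<^sup>2 / 2))"
    and c\<sigma>: "\<And>x. (\<lambda>n. expectation (\<lambda>\<omega>. of_real (\<sigma> n \<omega>) * iexp (x * W n \<omega>))) \<longlonglongrightarrow> of_real (r * exp (- x\<^sup>2 / 2))"
    and h: "\<And>x. isCont h x" "\<And>x. norm (h x) \<le> H"
  shows "(\<lambda>n. expectation (\<lambda>\<omega>. of_real (\<sigma> n \<omega>) * h (W n \<omega>))) \<longlonglongrightarrow> of_real r * (\<integral>x. h x \<partial>std_normal_distribution)"
proof -
  have h_meas [measurable]: "h \<in> borel_measurable borel"
    using h(1) by (intro borel_measurable_continuous_onI) (simp add: continuous_on_eq_continuous_at)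
  define m where "m n = expectation (\<sigma> n)" for n
  have int\<sigma>: "integrable M (\<sigma> n)" for n
    using \<sigma> by (intro integrable_const_bound[where B=1]) auto
  have m_ge: "-1 \<le> m n" for n
  proof -
    have "expectation (\<lambda>_. -1) \<le> m n"
      unfolding m_def using \<sigma> int\<sigma> by (intro integral_mono) (auto simp: abs_le_iff minus_le_iff)
    then show ?thesis by (simp add: prob_space)
  qed
  have m_lim: "m \<longlonglongrightarrow> r"
  proof -
    have "(\<lambda>n. complex_of_real (m n)) \<longlonglongrightarrow> of_real r"
      using c\<sigma>[of 0] by (simp add: m_def)
    then show ?thesis by (simp add: tendsto_of_real_iff)
  qed
  then have r_ge: "-1 \<le> r" using m_ge by (intro LIMSEQ_le_const) auto
  \<comment> \<open>Both \<open>\<sigma>\<close> and its mean \<open>m\<close> are at least -1, so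
    numerator and denominator are at least 1 and \<open>f n\<close> is a probability
    density.\<close>
  define f where "f n \<omega> = (2 + \<sigma> n \<omega>) / (2 + m n)" for n \<omega>
  have [measurable]: "f n \<in> borel_measurable M" for n unfolding f_def[abs_def] by simp
  have f_pos: "0 \<le> f n \<omega>" for n \<omega>
    using \<sigma>[of n \<omega>] m_ge[of n] unfolding f_def by (intro divide_nonneg_nonneg) (auto simp: abs_le_iff)
  have int_f: "integrable M (f n)" "expectation (f n) = 1" for n
    using int\<sigma>[of n] m_ge[of n] by (simp_all add: f_def[abs_def] prob_space m_def[symmetric])
  define P where "P n = distr (density M (\<lambda>\<omega>. ennreal (f n \<omega>))) borel (W n)" for n
  have PP: "prob_space (density M (\<lambda>\<omega>. ennreal (f n \<omega>)))" for n
  proof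
    have "emeasure (density M (\<lambda>\<omega>. ennreal (f n \<omega>))) (space M) = (\<integral>\<^sup>+\<omega>. ennreal (f n \<omega>) \<partial>M)"
      by (simp add: emeasure_density cong: nn_integral_cong)
    also have "\<dots> = 1" using int_f[of n] f_pos[of n] by (subst nn_integral_eq_integral) auto
    finally show "emeasure (density M (\<lambda>\<omega>. ennreal (f n \<omega>))) (space (density M (\<lambda>\<omega>. ennreal (f n \<omega>)))) = 1" by simp
  qed
  have D: "real_distribution (P n)" for n
  proof -
    interpret P: prob_space "density M (\<lambda>\<omega>. ennreal (f n \<omega>))" by (rule PP)
    show ?thesis unfolding P_def by (rule P.real_distribution_distr) simp
  qed
  have P_int: "(2 + of_real (m n)) * integral\<^sup>L (P n) k
      = 2 * expectation (\<lambda>\<omega>. k (W n \<omega>)) + expectation (\<lambda>\<omega>. of_real (\<sigma> n \<omega>) * k (W n \<omega>))"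
    if [measurable]: "k \<in> borel_measurable borel" and k: "\<And>x. norm (k x) \<le> C" for n C and k :: "real \<Rightarrow> complex"
  proof -
    have i1: "integrable M (\<lambda>\<omega>. k (W n \<omega>))"
      using integrable_bounded_mult[where \<rho>="\<lambda>_. 1" and h=k and W="W n" and H=C] k by simp
    have i2: "integrable M (\<lambda>\<omega>. of_real (\<sigma> n \<omega>) * k (W n \<omega>))"
      using integrable_bounded_mult[where \<rho>="\<lambda>\<omega>. of_real (\<sigma> n \<omega>)" and h=k and W="W n" and H=C] k \<sigma> by simp
    have n0: "2 + complex_of_real (m n) \<noteq> 0"
      using m_ge[of n] by (metis add.commute add_neg_numeral_simps(1) complex_of_real_def linorder_not_less of_real_add of_real_eq_0_iff of_real_numeral neg_less_iff_less one_less_numeral_iff semiring_norm(76) add_eq_0_iff)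
    have "integral\<^sup>L (P n) k = expectation (\<lambda>\<omega>. f n \<omega> *\<^sub>R k (W n \<omega>))"
      unfolding P_def using f_pos by (simp add: integral_distr integral_density)
    also have "\<dots> = expectation (\<lambda>\<omega>. (2 * k (W n \<omega>) + of_real (\<sigma> n \<omega>) * k (W n \<omega>)) / (2 + of_real (m n)))"
      by (simp add: f_def scaleR_conv_of_real distrib_right)
    also have "\<dots> = (2 * expectation (\<lambda>\<omega>. k (W n \<omega>)) + expectation (\<lambda>\<omega>. of_real (\<sigma> n \<omega>) * k (W n \<omega>))) / (2 + of_real (m n))"
      using i1 i2 by simp
    finally show ?thesis using n0 by simp
  qed
  have "weak_conv_m P std_normal_distribution"
  proof (intro levy_continuity D real_dist_normal_dist)
    fix x :: real
    have n0: "2 + complex_of_real (m n) \<noteq> 0" for n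
      using m_ge[of n] by (auto simp: complex_eq_iff)
    have r0: "2 + complex_of_real r \<noteq> 0"
      using r_ge by (auto simp: complex_eq_iff)
    have "char (P n) x = (2 * expectation (\<lambda>\<omega>. iexp (x * W n \<omega>)) + expectation (\<lambda>\<omega>. of_real (\<sigma> n \<omega>) * iexp (x * W n \<omega>))) / (2 + of_real (m n))" for n
      using P_int[of "\<lambda>y. iexp (x * y)" 1 n] n0[of n] by (simp add: char_def field_simps)
    moreover have "(\<lambda>n. (2 * expectation (\<lambda>\<omega>. iexp (x * W n \<omega>)) + expectation (\<lambda>\<omega>. of_real (\<sigma> n \<omega>) * iexp (x * W n \<omega>))) / (2 + of_real (m n)))
      \<longlonglongrightarrow> (2 * of_real (exp (- x\<^sup>2 / 2)) + of_real (r * exp (- x\<^sup>2 / 2))) / (2 + of_real r)"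
      by (intro tendsto_intros cW c\<sigma> m_lim r0)
    moreover have "(2 * of_real (exp (- x\<^sup>2 / 2)) + of_real (r * exp (- x\<^sup>2 / 2))) / (2 + of_real r) = char std_normal_distribution x"
      using r0 by (simp add: char_std_normal_distribution field_simps)
    ultimately show "(\<lambda>n. char (P n) x) \<longlonglongrightarrow> char std_normal_distribution x" by simp
  qed
  then have P_lim: "(\<lambda>n. integral\<^sup>L (P n) h) \<longlonglongrightarrow> integral\<^sup>L std_normal_distribution h"
    by (rule weak_conv_imp_integral_bdd_continuous_conv[OF D real_dist_normal_dist _ h])
  \<comment> \<open>The integral under the tilted law contains twice the unweighted expectation;
    subtracting its own limit isolates the part weighted by \<open>\<sigma>\<close>.\<close>
  have "(\<lambda>n. (2 + of_real (m n)) * integral\<^sup>L (P n) h - 2 * expectation (\<lambda>\<omega>. h (W n \<omega>)))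
    \<longlonglongrightarrow> (2 + of_real r) * integral\<^sup>L std_normal_distribution h - 2 * integral\<^sup>L std_normal_distribution h"
    by (intro tendsto_intros P_lim m_lim levy_bounded_continuous[OF _ cW h]) simp
  moreover have "(2 + of_real (m n)) * integral\<^sup>L (P n) h - 2 * expectation (\<lambda>\<omega>. h (W n \<omega>))
    = expectation (\<lambda>\<omega>. of_real (\<sigma> n \<omega>) * h (W n \<omega>))" for n
    by (simp only: P_int[OF h_meas h(2)]) simp
  moreover have "(2 + of_real r) * z - 2 * z = of_real r * z" for z :: complex
    by (simp add: algebra_simps)
  ultimately show ?thesis by (simp only:)
qed

text \<open>A complex weight is split into real and imaginary parts, each a real weight bounded by
  1.\<close>

lemma levy_complex_weight:
  fixes W :: "nat \<Rightarrow> 'a \<Rightarrow> real" and \<rho> :: "nat \<Rightarrow> 'a \<Rightarrow> complex" and h :: "real \<Rightarrow> complex"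
  assumes [measurable]: "\<And>n. W n \<in> borel_measurable M" "\<And>n. \<rho> n \<in> borel_measurable M"
    and \<rho>: "\<And>n \<omega>. norm (\<rho> n \<omega>) \<le> 1"
    and cW: "\<And>x. (\<lambda>n. expectation (\<lambda>\<omega>. iexp (x * W n \<omega>))) \<longlonglongrightarrow> of_real (exp (- x\<^sup>2 / 2))"
    and c\<rho>: "\<And>x. (\<lambda>n. expectation (\<lambda>\<omega>. \<rho> n \<omega> * iexp (x * W n \<omega>))) \<longlonglongrightarrow> c * of_real (exp (- x\<^sup>2 / 2))"
    and h: "\<And>x. isCont h x" "\<And>x. norm (h x) \<le> H"
  shows "(\<lambda>n. expectation (\<lambda>\<omega>. \<rho> n \<omega> * h (W n \<omega>))) \<longlonglongrightarrow> c * (\<integral>x. h x \<partial>std_normal_distribution)"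
proof -
  have h_meas [measurable]: "h \<in> borel_measurable borel"
    using h(1) by (intro borel_measurable_continuous_onI) (simp add: continuous_on_eq_continuous_at)
  have Re_lim: "(\<lambda>n. expectation (\<lambda>\<omega>. of_real (Re (\<tau> n \<omega>)) * h (W n \<omega>))) \<longlonglongrightarrow> of_real (Re d) * (\<integral>x. h x \<partial>std_normal_distribution)"
    if [measurable]: "\<And>n. \<tau> n \<in> borel_measurable M" and \<tau>: "\<And>n \<omega>. norm (\<tau> n \<omega>) \<le> 1"
      and c\<tau>: "\<And>x. (\<lambda>n. expectation (\<lambda>\<omega>. \<tau> n \<omega> * iexp (x * W n \<omega>))) \<longlonglongrightarrow> d * of_real (exp (- x\<^sup>2 / 2))" for \<tau> d
  proof (rule levy_real_weight[OF _ _ _ cW _ h])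
    show "\<bar>Re (\<tau> n \<omega>)\<bar> \<le> 1" for n \<omega>
      using abs_Re_le_cmod[of "\<tau> n \<omega>"] \<tau>[of n \<omega>] by simp
    fix x
    have int: "integrable M (\<lambda>\<omega>. \<tau> n \<omega> * iexp (y * W n \<omega>))" for n y
      by (rule integrable_bounded_mult[where h="\<lambda>w. iexp (y * w)" and H=1]) (use \<tau> in auto)
    \<comment> \<open>The real part is half the sum of the weight and its conjugate; conjugating the
      whole expectation reverses the sign of the frequency, hence \<open>- x\<close>.\<close>
    have "expectation (\<lambda>\<omega>. of_real (Re (\<tau> n \<omega>)) * iexp (x * W n \<omega>))
      = (expectation (\<lambda>\<omega>. \<tau> n \<omega> * iexp (x * W n \<omega>)) + cnj (expectation (\<lambda>\<omega>. \<tau> n \<omega> * iexp ((- x) * W n \<omega>)))) / 2" for n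
    proof -
      have "cnj (expectation (\<lambda>\<omega>. \<tau> n \<omega> * iexp ((- x) * W n \<omega>))) = expectation (\<lambda>\<omega>. cnj (\<tau> n \<omega> * iexp ((- x) * W n \<omega>)))"
        by (rule Bochner_Integration.integral_cnj[symmetric])
      also have "\<dots> = expectation (\<lambda>\<omega>. cnj (\<tau> n \<omega>) * iexp (x * W n \<omega>))"
        by (simp add: exp_cnj)
      finally have e: "cnj (expectation (\<lambda>\<omega>. \<tau> n \<omega> * iexp ((- x) * W n \<omega>))) = expectation (\<lambda>\<omega>. cnj (\<tau> n \<omega>) * iexp (x * W n \<omega>))" .
      have i2: "integrable M (\<lambda>\<omega>. cnj (\<tau> n \<omega>) * iexp (x * W n \<omega>))"
        by (rule integrable_bounded_mult[where h="\<lambda>w. iexp (x * w)" and H=1]) (use \<tau> in auto)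
      have "of_real (Re z) * w = (z * w + cnj z * w) / 2" for z w
        by (simp add: complex_add_cnj flip: distrib_right)
      then have "expectation (\<lambda>\<omega>. of_real (Re (\<tau> n \<omega>)) * iexp (x * W n \<omega>))
        = expectation (\<lambda>\<omega>. (\<tau> n \<omega> * iexp (x * W n \<omega>) + cnj (\<tau> n \<omega>) * iexp (x * W n \<omega>)) / 2)"
        by (simp only:)
      then show ?thesis
        unfolding e using int[of n x] i2 by simp
    qed
    moreover have "(\<lambda>n. (expectation (\<lambda>\<omega>. \<tau> n \<omega> * iexp (x * W n \<omega>)) + cnj (expectation (\<lambda>\<omega>. \<tau> n \<omega> * iexp ((- x) * W n \<omega>)))) / 2)
      \<longlonglongrightarrow> (d * of_real (exp (- x\<^sup>2 / 2)) + cnj (d * of_real (exp (- (-x)\<^sup>2 / 2)))) / 2"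
      by (intro tendsto_intros c\<tau>) simp
    moreover have "(d * of_real (exp (- x\<^sup>2 / 2)) + cnj (d * of_real (exp (- (-x)\<^sup>2 / 2)))) / 2 = of_real (Re d * exp (- x\<^sup>2 / 2))"
      by (simp add: complex_add_cnj flip: distrib_right)
    ultimately show "(\<lambda>n. expectation (\<lambda>\<omega>. of_real (Re (\<tau> n \<omega>)) * iexp (x * W n \<omega>))) \<longlonglongrightarrow> of_real (Re d * exp (- x\<^sup>2 / 2))"
      by (simp only:)
  qed simp_all
  have R1: "(\<lambda>n. expectation (\<lambda>\<omega>. of_real (Re (\<rho> n \<omega>)) * h (W n \<omega>))) \<longlonglongrightarrow> of_real (Re c) * (\<integral>x. h x \<partial>std_normal_distribution)"
    by (rule Re_lim[OF _ \<rho> c\<rho>]) simp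
  \<comment> \<open>The imaginary part is the real part of the weight rotated by
    \<open>- \<i>\<close>, so the same argument applies.\<close>
  have "(\<lambda>n. expectation (\<lambda>\<omega>. of_real (Re (- \<i> * \<rho> n \<omega>)) * h (W n \<omega>))) \<longlonglongrightarrow> of_real (Re (- \<i> * c)) * (\<integral>x. h x \<partial>std_normal_distribution)"
  proof (rule Re_lim)
    show "(\<lambda>n. expectation (\<lambda>\<omega>. - \<i> * \<rho> n \<omega> * iexp (x * W n \<omega>))) \<longlonglongrightarrow> - \<i> * c * of_real (exp (- x\<^sup>2 / 2))" for x
      using tendsto_mult[OF tendsto_const[of "- \<i>"] c\<rho>[of x]] by (simp add: mult.assoc)
  qed (use \<rho> in \<open>auto simp: norm_mult\<close>)
  then have R2: "(\<lambda>n. expectation (\<lambda>\<omega>. of_real (Im (\<rho> n \<omega>)) * h (W n \<omega>))) \<longlonglongrightarrow> of_real (Im c) * (\<integral>x. h x \<partial>std_normal_distribution)"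
    by simp
  have le: "norm (complex_of_real (Re (\<rho> n \<omega>))) \<le> 1" "norm (complex_of_real (Im (\<rho> n \<omega>))) \<le> 1" for n \<omega>
    using abs_Re_le_cmod[of "\<rho> n \<omega>"] abs_Im_le_cmod[of "\<rho> n \<omega>"] \<rho>[of n \<omega>] by simp_all
  have int: "integrable M (\<lambda>\<omega>. of_real (Re (\<rho> n \<omega>)) * h (W n \<omega>))" "integrable M (\<lambda>\<omega>. of_real (Im (\<rho> n \<omega>)) * h (W n \<omega>))" for n
    by (rule integrable_bounded_mult[OF _ _ _ le(1) h(2)] integrable_bounded_mult[OF _ _ _ le(2) h(2)]; simp)+
  have "expectation (\<lambda>\<omega>. \<rho> n \<omega> * h (W n \<omega>))
     = expectation (\<lambda>\<omega>. of_real (Re (\<rho> n \<omega>)) * h (W n \<omega>)) + \<i> * expectation (\<lambda>\<omega>. of_real (Im (\<rho> n \<omega>)) * h (W n \<omega>))" for n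
  proof -
    have "expectation (\<lambda>\<omega>. \<rho> n \<omega> * h (W n \<omega>))
      = expectation (\<lambda>\<omega>. of_real (Re (\<rho> n \<omega>)) * h (W n \<omega>) + \<i> * (of_real (Im (\<rho> n \<omega>)) * h (W n \<omega>)))"
      by (rule Bochner_Integration.integral_cong[OF refl]) (subst complex_eq, simp add: distrib_right mult.assoc)
    then show ?thesis using int[of n] by simp
  qed
  moreover have "(\<lambda>n. expectation (\<lambda>\<omega>. of_real (Re (\<rho> n \<omega>)) * h (W n \<omega>)) + \<i> * expectation (\<lambda>\<omega>. of_real (Im (\<rho> n \<omega>)) * h (W n \<omega>)))
    \<longlonglongrightarrow> of_real (Re c) * (\<integral>x. h x \<partial>std_normal_distribution) + \<i> * (of_real (Im c) * (\<integral>x. h x \<partial>std_normal_distribution))"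
    by (intro tendsto_intros R1 R2)
  moreover have "of_real (Re c) * z + \<i> * (of_real (Im c) * z) = c * z" for z
    by (metis complex_eq distrib_right mult.assoc)
  ultimately show ?thesis by simp
qed

text \<open>
  A substitute for the multivariate continuity theorem: the characters are exchanged for the
  functions \<open>h k\<close> one coordinate at a time, the other factors being the weight.
\<close>

lemma prod_bounded_continuous_limit:
  fixes W :: "'k \<Rightarrow> nat \<Rightarrow> 'a \<Rightarrow> real" and h :: "'k \<Rightarrow> real \<Rightarrow> complex"
  assumes K: "finite K" and W_meas [measurable]: "\<And>k n. W k n \<in> borel_measurable M"
    and cf: "\<And>v. (\<lambda>n. expectation (\<lambda>\<omega>. iexp (\<Sum>k\<in>K. v k * W k n \<omega>))) \<longlonglongrightarrow> of_real (exp (- (\<Sum>k\<in>K. (v k)\<^sup>2) / 2))"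
    and h: "\<And>k x. isCont (h k) x" "\<And>k x. norm (h k x) \<le> 1"
  shows "(\<lambda>n. expectation (\<lambda>\<omega>. \<Prod>k\<in>K. h k (W k n \<omega>))) \<longlonglongrightarrow> (\<Prod>k\<in>K. \<integral>x. h k x \<partial>std_normal_distribution)"
proof -
  have [measurable]: "h k \<in> borel_measurable borel" for k
    using h(1) by (intro borel_measurable_continuous_onI) (simp add: continuous_on_eq_continuous_at)
  \<comment> \<open>\<open>A\<close> is the set of coordinates already exchanged. The frequencies
    \<open>v\<close> stay arbitrary, because the induction step needs every frequency
    \<open>x\<close> at the next coordinate.\<close>
  have "(\<lambda>n. expectation (\<lambda>\<omega>. (\<Prod>k\<in>A. h k (W k n \<omega>)) * iexp (\<Sum>k\<in>K-A. v k * W k n \<omega>)))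
    \<longlonglongrightarrow> (\<Prod>k\<in>A. \<integral>x. h k x \<partial>std_normal_distribution) * of_real (exp (- (\<Sum>k\<in>K-A. (v k)\<^sup>2) / 2))"
    if "A \<subseteq> K" for A v
    using finite_subset[OF that K] that
  proof (induction A arbitrary: v rule: finite_induct)
    case empty
    then show ?case using cf[of v] by simp
  next
    case (insert a A)
    have KA: "K - A = insert a (K - insert a A)" "a \<notin> K - insert a A" "finite (K - insert a A)"
      using insert K by auto
    let ?\<rho> = "\<lambda>n \<omega>. (\<Prod>k\<in>A. h k (W k n \<omega>)) * iexp (\<Sum>k\<in>K - insert a A. v k * W k n \<omega>)"
    have "(\<lambda>n. expectation (\<lambda>\<omega>. ?\<rho> n \<omega> * h a (W a n \<omega>)))
      \<longlonglongrightarrow> ((\<Prod>k\<in>A. \<integral>x. h k x \<partial>std_normal_distribution) * of_real (exp (- (\<Sum>k\<in>K - insert a A. (v k)\<^sup>2) / 2)))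
         * (\<integral>x. h a x \<partial>std_normal_distribution)"
    proof (rule levy_complex_weight[where H=1])
      show "norm (?\<rho> n \<omega>) \<le> 1" for n \<omega>
        using h(2) by (auto simp: norm_mult prod_norm[symmetric] intro!: prod_le_1)
      show "(\<lambda>n. expectation (\<lambda>\<omega>. iexp (x * W a n \<omega>))) \<longlonglongrightarrow> of_real (exp (- x\<^sup>2 / 2))" for x
      proof -
        have "(\<Sum>k\<in>K. (if k = a then x else 0) * W k n \<omega>) = x * W a n \<omega>" for n \<omega>
          using insert.prems K by (simp add: if_distrib[of "\<lambda>z. z * _"] cong: if_cong)
        moreover have "(\<Sum>k\<in>K. (if k = a then x else 0)\<^sup>2) = x\<^sup>2"
          using insert.prems K by (simp add: if_distrib[of "\<lambda>z. z\<^sup>2"] cong: if_cong)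
        ultimately show ?thesis using cf[of "\<lambda>k. if k = a then x else 0"] by simp
      qed
      show "(\<lambda>n. expectation (\<lambda>\<omega>. ?\<rho> n \<omega> * iexp (x * W a n \<omega>)))
        \<longlonglongrightarrow> ((\<Prod>k\<in>A. \<integral>x. h k x \<partial>std_normal_distribution) * of_real (exp (- (\<Sum>k\<in>K - insert a A. (v k)\<^sup>2) / 2)))
           * of_real (exp (- x\<^sup>2 / 2))" for x
      proof -
        have 1: "(\<Sum>k\<in>K - A. (v(a := x)) k * W k n \<omega>) = x * W a n \<omega> + (\<Sum>k\<in>K - insert a A. v k * W k n \<omega>)" for n \<omega>
          unfolding KA(1) using KA(2,3) by (subst sum.insert) (auto intro!: sum.cong)
        have 2: "(\<Sum>k\<in>K - A. ((v(a := x)) k)\<^sup>2) = x\<^sup>2 + (\<Sum>k\<in>K - insert a A. (v k)\<^sup>2)"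
          unfolding KA(1) using KA(2,3) by (subst sum.insert) (auto intro!: sum.cong)
        have "iexp (x * W a n \<omega> + (\<Sum>k\<in>K - insert a A. v k * W k n \<omega>))
           = iexp (\<Sum>k\<in>K - insert a A. v k * W k n \<omega>) * iexp (x * W a n \<omega>)" for n \<omega>
          by (simp add: distrib_left exp_add mult.commute)
        moreover have "exp (- (x\<^sup>2 + (\<Sum>k\<in>K - insert a A. (v k)\<^sup>2)) / 2)
           = exp (- (\<Sum>k\<in>K - insert a A. (v k)\<^sup>2) / 2) * exp (- x\<^sup>2 / 2)"
          by (simp add: add_divide_distrib diff_divide_distrib flip: exp_add)
        moreover have "A \<subseteq> K" using insert.prems by auto
        note insert.IH[OF this, of "v(a := x)"]
        ultimately show ?thesis unfolding 1 2 by (simp only: mult.assoc of_real_mult)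
      qed
    qed (use h in auto)
    then show ?case
      using insert.hyps by (simp add: mult_ac)
  qed
  from this[of K] show ?thesis by simp
qed

end

section \<open>Normalized sums of independent vectors\<close>

lemma exp_minus_approx:
  fixes y :: real
  assumes "0 \<le> y"
  shows "\<bar>exp (- y) - (1 - y)\<bar> \<le> y\<^sup>2"
proof -
  have "1 - y \<le> exp (- y)" using exp_ge_add_one_self[of "- y"] by simp
  moreover have "exp (- y) \<le> 1 - y + y\<^sup>2"
  proof -
    have "exp (- y) = 1 / exp y" by (simp add: exp_minus inverse_eq_divide)
    also have "\<dots> \<le> 1 / (1 + y)"
      using exp_ge_add_one_self[of y] assms by (intro divide_left_mono) auto
    also have "\<dots> \<le> 1 - y + y\<^sup>2"
    proof -
      have "(1 - y + y\<^sup>2) * (1 + y) = 1 + y ^ 3" by (simp add: algebra_simps power2_eq_square power3_eq_cube)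
      then show ?thesis using assms by (simp add: divide_le_eq)
    qed
    finally show ?thesis .
  qed
  ultimately show ?thesis by simp
qed

lemma abs_exp_minus_diff_le:
  fixes x y :: real
  assumes "0 \<le> x" "0 \<le> y"
  shows "\<bar>exp (- x) - exp (- y)\<bar> \<le> \<bar>x - y\<bar>"
proof -
  have *: "\<bar>exp (- x) - exp (- y)\<bar> \<le> y - x" if "0 \<le> x" "x \<le> y" for x y :: real
  proof -
    have "exp (- x) - exp (- y) = exp (- x) * (1 - exp (- (y - x)))"
      by (simp add: right_diff_distrib flip: exp_add)
    also have "\<dots> \<le> 1 * (y - x)"
    proof (rule mult_mono)
      show "1 - exp (- (y - x)) \<le> y - x"
        using exp_ge_add_one_self[of "- (y - x)"] by linarith
    qed (use that in auto)
    finally show ?thesis using that by simp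
  qed
  show ?thesis
    using *[of x y] *[of y x] assms by (cases "x \<le> y") (auto simp: abs_minus_commute)
qed

text \<open>The uniform bound on third moments is a Lyapunov condition: the vectors need not be
  identically distributed, and the error below is explicit.\<close>

locale indep_centered = prob_space +
  fixes \<xi> :: "nat \<Rightarrow> 'a \<Rightarrow> 'v::euclidean_space" and C :: real
  assumes indep: "indep_vars (\<lambda>_. borel) \<xi> UNIV"
    and int_\<xi>: "\<And>i. integrable M (\<xi> i)" and mean_0: "\<And>i. expectation (\<xi> i) = 0"
    and int_2: "\<And>i. integrable M (\<lambda>\<omega>. norm (\<xi> i \<omega>) ^ 2)"
    and int_3: "\<And>i. integrable M (\<lambda>\<omega>. norm (\<xi> i \<omega>) ^ 3)"
    and moment_2: "\<And>i. expectation (\<lambda>\<omega>. norm (\<xi> i \<omega>) ^ 2) \<le> C"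
    and moment_3: "\<And>i. expectation (\<lambda>\<omega>. norm (\<xi> i \<omega>) ^ 3) \<le> C"
begin

lemma \<xi>_meas [measurable]: "\<xi> i \<in> borel_measurable M"
  using indep by (simp add: indep_vars_def)

lemma C_nonneg: "0 \<le> C"
  by (rule order_trans[OF _ moment_2[of 0]]) simp

lemma inner_power_le: "\<bar>v \<bullet> \<xi> i \<omega>\<bar> ^ k \<le> norm v ^ k * norm (\<xi> i \<omega>) ^ k"
  using power_mono[OF Cauchy_Schwarz_ineq2[of v "\<xi> i \<omega>"], of k] by (simp add: power_mult_distrib)

lemma integrable_inner: "integrable M (\<lambda>\<omega>. v \<bullet> \<xi> i \<omega>)"
  using int_\<xi> by simp

lemma expectation_inner: "expectation (\<lambda>\<omega>. v \<bullet> \<xi> i \<omega>) = 0"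
  using integral_inner_right[of v M "\<xi> i"] int_\<xi>[of i] mean_0[of i] by simp

lemma integrable_inner_2: "integrable M (\<lambda>\<omega>. (v \<bullet> \<xi> i \<omega>)\<^sup>2)"
proof (rule Bochner_Integration.integrable_bound)
  show "integrable M (\<lambda>\<omega>. norm v ^ 2 * norm (\<xi> i \<omega>) ^ 2)" using int_2 by simp
  show "AE \<omega> in M. norm ((v \<bullet> \<xi> i \<omega>)\<^sup>2) \<le> norm (norm v ^ 2 * norm (\<xi> i \<omega>) ^ 2)"
    using inner_power_le[of v i _ 2] by (intro AE_I2) simp
qed simp

lemma expectation_inner_2: "expectation (\<lambda>\<omega>. (v \<bullet> \<xi> i \<omega>)\<^sup>2) \<le> norm v ^ 2 * C"
proof -
  have "expectation (\<lambda>\<omega>. (v \<bullet> \<xi> i \<omega>)\<^sup>2) \<le> expectation (\<lambda>\<omega>. norm v ^ 2 * norm (\<xi> i \<omega>) ^ 2)"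
    using int_2 integrable_inner_2 inner_power_le[of v i _ 2] by (intro integral_mono) auto
  also have "\<dots> \<le> norm v ^ 2 * C"
    using moment_2[of i] by (simp add: mult_left_mono)
  finally show ?thesis .
qed

lemma integrable_inner_3: "integrable M (\<lambda>\<omega>. \<bar>v \<bullet> \<xi> i \<omega>\<bar> ^ 3)"
proof (rule Bochner_Integration.integrable_bound)
  show "integrable M (\<lambda>\<omega>. norm v ^ 3 * norm (\<xi> i \<omega>) ^ 3)" using int_3 by simp
  show "AE \<omega> in M. norm (\<bar>v \<bullet> \<xi> i \<omega>\<bar> ^ 3) \<le> norm (norm v ^ 3 * norm (\<xi> i \<omega>) ^ 3)"
    using inner_power_le[of v i _ 3] by (intro AE_I2) simp
qed simp

lemma expectation_inner_3: "expectation (\<lambda>\<omega>. \<bar>v \<bullet> \<xi> i \<omega>\<bar> ^ 3) \<le> norm v ^ 3 * C"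
proof -
  have "expectation (\<lambda>\<omega>. \<bar>v \<bullet> \<xi> i \<omega>\<bar> ^ 3) \<le> expectation (\<lambda>\<omega>. norm v ^ 3 * norm (\<xi> i \<omega>) ^ 3)"
    using int_3 integrable_inner_3 inner_power_le[of v i _ 3] by (intro integral_mono) auto
  also have "\<dots> \<le> norm v ^ 3 * C"
    using moment_3[of i] by (simp add: mult_left_mono)
  finally show ?thesis .
qed

definition scaled_sum where "scaled_sum n \<omega> = (1 / sqrt (real n)) *\<^sub>R (\<Sum>i<n. \<xi> i \<omega>)"

lemma indep_inner: "indep_vars (\<lambda>_. borel) (\<lambda>i \<omega>. v \<bullet> \<xi> i \<omega>) UNIV"
  by (rule indep_vars_compose2[OF indep]) simp

text \<open>The comparison is with the Gaussian whose variance is that of the sum itself, not of the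
  limit. The error then depends on \<open>v\<close> through \<open>norm v\<close> and the common
  bound \<open>C\<close>, so it is uniform on balls. A difference of products of factors of modulus
  at most 1 is bounded by the sum of the differences.\<close>

lemma char_scaled_sum_bound:
  assumes "0 < n"
  shows "cmod (expectation (\<lambda>\<omega>. iexp (v \<bullet> scaled_sum n \<omega>))
      - of_real (exp (- ((\<Sum>i<n. expectation (\<lambda>\<omega>. (v \<bullet> \<xi> i \<omega>)\<^sup>2)) / n / 2))))
    \<le> (norm v ^ 3 * C + norm v ^ 4 * C\<^sup>2) / sqrt n"
proof -
  define t where "t = 1 / sqrt (real n)"
  have t: "0 < t" "t\<^sup>2 = 1 / n" "\<bar>t\<bar> = t" using assms by (auto simp: t_def power_divide)
  define \<sigma>2 where "\<sigma>2 i = expectation (\<lambda>\<omega>. (v \<bullet> \<xi> i \<omega>)\<^sup>2)" for i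
  have \<sigma>2: "0 \<le> \<sigma>2 i" "\<sigma>2 i \<le> norm v ^ 2 * C" for i
    using expectation_inner_2[of v i] by (auto simp: \<sigma>2_def)
  let ?c = "\<lambda>i. char (distr M borel (\<lambda>\<omega>. v \<bullet> \<xi> i \<omega>)) t"
  have "expectation (\<lambda>\<omega>. iexp (v \<bullet> scaled_sum n \<omega>)) = char (distr M borel (\<lambda>\<omega>. \<Sum>i<n. v \<bullet> \<xi> i \<omega>)) t"
    by (simp add: char_def integral_distr scaled_sum_def t_def inner_sum_right)
  also have "\<dots> = (\<Prod>i<n. ?c i)"
    by (rule char_distr_sum) (rule indep_vars_subset[OF indep_inner], simp)
  finally have 1: "expectation (\<lambda>\<omega>. iexp (v \<bullet> scaled_sum n \<omega>)) = (\<Prod>i<n. ?c i)" .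
  have 2: "complex_of_real (exp (- ((\<Sum>i<n. \<sigma>2 i) / n / 2))) = (\<Prod>i<n. of_real (exp (- (t\<^sup>2 * \<sigma>2 i / 2))))"
    by (simp add: t(2) sum_negf[symmetric] sum_divide_distrib flip: of_real_prod exp_sum)
  have each: "cmod (?c i - of_real (exp (- (t\<^sup>2 * \<sigma>2 i / 2)))) \<le> t ^ 3 * (norm v ^ 3 * C) + t ^ 4 * (norm v ^ 4 * C\<^sup>2)" for i
  proof -
    \<comment> \<open>First replacement: each characteristic function by its second-order
      polynomial, with an error from the third moment. The second, below, replaces the polynomial by
      an exponential.\<close>
    have "cmod (?c i - (1 - t^2 * \<sigma>2 i / 2)) \<le> (t^2 / 6) * expectation (\<lambda>\<omega>. min (6 * (v \<bullet> \<xi> i \<omega>)^2) (\<bar>t\<bar> * \<bar>v \<bullet> \<xi> i \<omega>\<bar>^3))"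
      by (rule char_approx3') (auto simp: integrable_inner integrable_inner_2 expectation_inner \<sigma>2_def)
    also have "\<dots> \<le> t^2 * expectation (\<lambda>\<omega>. t * \<bar>v \<bullet> \<xi> i \<omega>\<bar>^3)"
    proof (rule mult_mono)
      show "expectation (\<lambda>\<omega>. min (6 * (v \<bullet> \<xi> i \<omega>)^2) (\<bar>t\<bar> * \<bar>v \<bullet> \<xi> i \<omega>\<bar>^3)) \<le> expectation (\<lambda>\<omega>. t * \<bar>v \<bullet> \<xi> i \<omega>\<bar>^3)"
      proof (rule integral_mono)
        show "integrable M (\<lambda>\<omega>. min (6 * (v \<bullet> \<xi> i \<omega>)^2) (\<bar>t\<bar> * \<bar>v \<bullet> \<xi> i \<omega>\<bar>^3))"
          using integrable_inner_2 integrable_inner_3 by (intro integrable_min) auto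
      qed (use integrable_inner_3 t in auto)
      show "t\<^sup>2 / 6 \<le> t\<^sup>2" by simp
    qed auto
    also have "\<dots> = t^3 * expectation (\<lambda>\<omega>. \<bar>v \<bullet> \<xi> i \<omega>\<bar>^3)"
      by (simp add: power2_eq_square power3_eq_cube)
    also have "\<dots> \<le> t^3 * (norm v ^ 3 * C)"
      using t expectation_inner_3 by (intro mult_left_mono) auto
    finally have a: "cmod (?c i - (1 - t^2 * \<sigma>2 i / 2)) \<le> t^3 * (norm v ^ 3 * C)" .
    have "cmod (of_real (1 - t^2 * \<sigma>2 i / 2) - of_real (exp (- (t\<^sup>2 * \<sigma>2 i / 2)))) = \<bar>exp (- (t\<^sup>2 * \<sigma>2 i / 2)) - (1 - t\<^sup>2 * \<sigma>2 i / 2)\<bar>"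
      by (simp only: norm_of_real abs_minus_commute flip: of_real_diff)
    also have "\<dots> \<le> (t\<^sup>2 * \<sigma>2 i / 2)\<^sup>2"
      using \<sigma>2 t by (intro exp_minus_approx) auto
    also have "\<dots> \<le> (t\<^sup>2 * (norm v ^ 2 * C))\<^sup>2"
    proof (rule power_mono)
      have "t\<^sup>2 * \<sigma>2 i / 2 \<le> t\<^sup>2 * \<sigma>2 i" using \<sigma>2(1)[of i] by simp
      also have "\<dots> \<le> t\<^sup>2 * (norm v ^ 2 * C)" using \<sigma>2(2) by (intro mult_left_mono) auto
      finally show "t\<^sup>2 * \<sigma>2 i / 2 \<le> t\<^sup>2 * (norm v ^ 2 * C)" .
    qed (use \<sigma>2 in auto)
    also have "\<dots> = t ^ 4 * (norm v ^ 4 * C\<^sup>2)"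
      by (simp add: power_mult_distrib flip: power_mult)
    finally have b: "cmod (of_real (1 - t^2 * \<sigma>2 i / 2) - of_real (exp (- (t\<^sup>2 * \<sigma>2 i / 2)))) \<le> t ^ 4 * (norm v ^ 4 * C\<^sup>2)" .
    have "?c i - of_real (exp (- (t\<^sup>2 * \<sigma>2 i / 2)))
      = (?c i - (1 - t^2 * \<sigma>2 i / 2)) + (of_real (1 - t^2 * \<sigma>2 i / 2) - of_real (exp (- (t\<^sup>2 * \<sigma>2 i / 2))))"
      by simp
    then show ?thesis
      using norm_triangle_mono[OF a b] by simp
  qed
  have "cmod ((\<Prod>i<n. ?c i) - (\<Prod>i<n. of_real (exp (- (t\<^sup>2 * \<sigma>2 i / 2)))))
    \<le> (\<Sum>i<n. cmod (?c i - of_real (exp (- (t\<^sup>2 * \<sigma>2 i / 2)))))"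
  proof (rule norm_prod_diff)
    fix i
    interpret D: real_distribution "distr M borel (\<lambda>\<omega>. v \<bullet> \<xi> i \<omega>)"
      by (rule real_distribution_distr) simp
    show "cmod (?c i) \<le> 1" by (rule D.cmod_char_le_1)
    show "cmod (of_real (exp (- (t\<^sup>2 * \<sigma>2 i / 2)))) \<le> 1" using \<sigma>2(1)[of i] by simp
  qed
  also have "\<dots> \<le> (\<Sum>i<n. t ^ 3 * (norm v ^ 3 * C) + t ^ 4 * (norm v ^ 4 * C\<^sup>2))"
    by (intro sum_mono each)
  \<comment> \<open>Of the orders 3 and 4 in \<open>t\<close>, two powers cancel the number of
    summands; one power, \<open>1 / sqrt n\<close>, is the rate.\<close>
  also have "\<dots> = real n * t\<^sup>2 * (t * (norm v ^ 3 * C) + t\<^sup>2 * (norm v ^ 4 * C\<^sup>2))"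
    by (simp add: algebra_simps power2_eq_square power3_eq_cube power4_eq_xxxx)
  also have "\<dots> = t * (norm v ^ 3 * C) + t\<^sup>2 * (norm v ^ 4 * C\<^sup>2)"
    using assms by (simp add: t(2))
  also have "\<dots> \<le> t * (norm v ^ 3 * C) + t * (norm v ^ 4 * C\<^sup>2)"
  proof -
    have "t \<le> 1" using assms by (simp add: t_def)
    then have "t\<^sup>2 \<le> t" using t(1) by (simp add: power2_eq_square mult_left_le)
    then show ?thesis using C_nonneg by (simp add: mult_right_mono)
  qed
  also have "\<dots> = (norm v ^ 3 * C + norm v ^ 4 * C\<^sup>2) / sqrt n"
    by (simp add: t_def add_divide_distrib)
  finally show ?thesis
    unfolding 1 \<sigma>2_def[symmetric] 2 .
qed

lemma sum_inner_2:
  "integrable M (\<lambda>\<omega>. (\<Sum>i<n. v \<bullet> \<xi> i \<omega>)\<^sup>2) \<and>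
   expectation (\<lambda>\<omega>. (\<Sum>i<n. v \<bullet> \<xi> i \<omega>)\<^sup>2) = (\<Sum>i<n. expectation (\<lambda>\<omega>. (v \<bullet> \<xi> i \<omega>)\<^sup>2))"
proof (induction n)
  case (Suc n)
  let ?A = "\<lambda>\<omega>. \<Sum>i<n. v \<bullet> \<xi> i \<omega>"
  have ind: "indep_var borel (\<lambda>\<omega>. v \<bullet> \<xi> n \<omega>) borel ?A"
    by (rule indep_vars_sum) (auto intro: indep_vars_subset[OF indep_inner])
  have iA: "integrable M ?A" using integrable_inner by simp
  have iX: "integrable M (\<lambda>\<omega>. (v \<bullet> \<xi> n \<omega>) * ?A \<omega>)"
    by (rule indep_var_integrable[OF ind integrable_inner iA])
  have eX: "expectation (\<lambda>\<omega>. (v \<bullet> \<xi> n \<omega>) * ?A \<omega>) = 0"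
    using indep_var_lebesgue_integral[OF ind integrable_inner iA] by (simp add: expectation_inner)
  have eq: "(\<Sum>i<Suc n. v \<bullet> \<xi> i \<omega>)\<^sup>2 = (?A \<omega>)\<^sup>2 + 2 * ((v \<bullet> \<xi> n \<omega>) * ?A \<omega>) + (v \<bullet> \<xi> n \<omega>)\<^sup>2" for \<omega>
    by (simp add: power2_sum)
  show ?case
    unfolding eq using Suc iX eX integrable_inner_2[of v n] by simp
qed simp

text \<open>Second moments bounded in \<open>n\<close> supply the tightness: they control the
  truncation of the scores through Chebyshev's inequality.\<close>

lemma scaled_sum_2:
  "integrable M (\<lambda>\<omega>. norm (scaled_sum n \<omega>) ^ 2)"
  "expectation (\<lambda>\<omega>. norm (scaled_sum n \<omega>) ^ 2) \<le> DIM('v) * C"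
proof -
  have eq: "norm (scaled_sum n \<omega>) ^ 2 = (\<Sum>b\<in>Basis. (1 / n) * (\<Sum>i<n. b \<bullet> \<xi> i \<omega>)\<^sup>2)" for \<omega>
    unfolding scaled_sum_def power2_norm_eq_inner euclidean_inner[of "_ *\<^sub>R _" "_ *\<^sub>R _"]
    by (intro sum.cong refl) (simp add: inner_sum_right inner_commute power2_eq_square flip: inner_sum_right)
  show "integrable M (\<lambda>\<omega>. norm (scaled_sum n \<omega>) ^ 2)"
    unfolding eq using sum_inner_2 by simp
  have "expectation (\<lambda>\<omega>. norm (scaled_sum n \<omega>) ^ 2) = (\<Sum>b\<in>Basis. (1 / n) * (\<Sum>i<n. expectation (\<lambda>\<omega>. (b \<bullet> \<xi> i \<omega>)\<^sup>2)))"
    unfolding eq using sum_inner_2 by simp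
  also have "\<dots> \<le> (\<Sum>b\<in>(Basis::'v set). C)"
  proof (rule sum_mono)
    fix b :: 'v assume b: "b \<in> Basis"
    have "(\<Sum>i<n. expectation (\<lambda>\<omega>. (b \<bullet> \<xi> i \<omega>)\<^sup>2)) \<le> (\<Sum>i<n. C)"
      using expectation_inner_2[of b] b by (intro sum_mono) simp
    then have "(1 / n) * (\<Sum>i<n. expectation (\<lambda>\<omega>. (b \<bullet> \<xi> i \<omega>)\<^sup>2)) \<le> (1 / n) * (n * C)"
      by (intro mult_left_mono) auto
    also have "\<dots> \<le> C" using C_nonneg by (cases "n = 0") auto
    finally show "(1 / n) * (\<Sum>i<n. expectation (\<lambda>\<omega>. (b \<bullet> \<xi> i \<omega>)\<^sup>2)) \<le> C" .
  qed
  finally show "expectation (\<lambda>\<omega>. norm (scaled_sum n \<omega>) ^ 2) \<le> DIM('v) * C" by simp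
qed

end

section \<open>The limit distribution\<close>

lemma integrable_pair_fst:
  fixes f :: "'a \<Rightarrow> 'c::{banach, second_countable_topology}"
  assumes "prob_space N2" "integrable N1 f"
  shows "integrable (N1 \<Otimes>\<^sub>M N2) (\<lambda>z. f (fst z))"
proof -
  have "integrable (distr (N1 \<Otimes>\<^sub>M N2) N1 fst) f"
    using prob_space.distr_pair_fst[OF assms(1), of N1] assms(2) by simp
  then show ?thesis by (rule integrable_distr[rotated]) simp
qed

lemma integrable_pair_snd:
  fixes f :: "'b \<Rightarrow> 'c::{banach, second_countable_topology}"
  assumes "prob_space N1" "prob_space N2" "integrable N2 f"
  shows "integrable (N1 \<Otimes>\<^sub>M N2) (\<lambda>z. f (snd z))"
proof -
  interpret N1: prob_space N1 by fact
  interpret N2: prob_space N2 by fact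
  interpret pair_sigma_finite N2 N1 ..
  show ?thesis
    using integrable_product_swap[OF integrable_pair_fst[OF assms(1,3)]] by (simp add: split_def)
qed

text \<open>Conditional characteristic function at \<open>t\<close> of
  \<open>(w - w') * (w - d)\<close> given \<open>w\<close>, with \<open>w'\<close> standard normal
  and independent of \<open>w\<close>.\<close>

definition gain_weight :: "real \<Rightarrow> real \<Rightarrow> real \<Rightarrow> complex" where
  "gain_weight t d w = iexp (t * (w * (w - d))) * of_real (exp (- ((t * (w - d))\<^sup>2 / 2)))"

lemma isCont_gain_weight: "isCont (gain_weight t d) w"
  unfolding gain_weight_def[abs_def] by (intro continuous_intros) auto

lemma norm_gain_weight: "norm (gain_weight t d w) \<le> 1"
  by (simp add: gain_weight_def norm_mult)

text \<open>The witness is the law of \<open>(w - w') * (w - d)\<close> on a product of two standard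
  normals. Integrating out \<open>w'\<close> first leaves \<open>w\<^sup>2 - d * w\<close>, of mean
  1 whatever \<open>d\<close> is.\<close>

lemma gain_component_distribution:
  "\<exists>\<mu>. real_distribution \<mu> \<and> integrable \<mu> (\<lambda>z. z) \<and> (\<integral>z. z \<partial>\<mu>) = 1 \<and>
     (\<forall>t. char \<mu> t = (\<integral>w. gain_weight t d w \<partial>std_normal_distribution))"
proof -
  let ?N = std_normal_distribution
  interpret N: real_distribution ?N by (rule real_dist_normal_dist)
  interpret NN: pair_prob_space ?N ?N ..
  interpret NN: prob_space "?N \<Otimes>\<^sub>M ?N" by (rule NN.prob_space_axioms)
  define Z where "Z z = (fst z - snd z) * (fst z - d)" for z :: "real \<times> real"
  have [measurable]: "Z \<in> borel_measurable (?N \<Otimes>\<^sub>M ?N)" unfolding Z_def[abs_def] by simp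
  have m1: "integrable ?N (\<lambda>x. x)" "(\<integral>x. x \<partial>?N) = 0"
    using integrable_std_normal_distribution_moment[of 1] integral_std_normal_distribution_moment_odd[of 1] by simp_all
  have m2: "integrable ?N (\<lambda>x. x\<^sup>2)" "(\<integral>x. x\<^sup>2 \<partial>?N) = 1"
    using std_normal_distribution_even_moments[of 1] by (simp_all add: fact_numeral)
  note pN = N.prob_space_axioms
  have i: "integrable (?N \<Otimes>\<^sub>M ?N) (\<lambda>z. (fst z)\<^sup>2)" "integrable (?N \<Otimes>\<^sub>M ?N) (\<lambda>z. (snd z)\<^sup>2)"
    "integrable (?N \<Otimes>\<^sub>M ?N) (\<lambda>z. fst z)" "integrable (?N \<Otimes>\<^sub>M ?N) (\<lambda>z. snd z)"
    using integrable_pair_fst[OF pN m2(1)] integrable_pair_snd[OF pN pN m2(1)]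
      integrable_pair_fst[OF pN m1(1)] integrable_pair_snd[OF pN pN m1(1)] by simp_all
  have ixy: "integrable (?N \<Otimes>\<^sub>M ?N) (\<lambda>z. snd z * fst z)"
  proof (rule Bochner_Integration.integrable_bound)
    show "integrable (?N \<Otimes>\<^sub>M ?N) (\<lambda>z. (fst z)\<^sup>2 + (snd z)\<^sup>2)" using i by simp
    have "\<bar>x * y\<bar> \<le> y\<^sup>2 + x\<^sup>2" for x y :: real
    proof -
      have "0 \<le> (\<bar>x\<bar> - \<bar>y\<bar>)\<^sup>2" by simp
      then have "2 * (\<bar>x\<bar> * \<bar>y\<bar>) \<le> x\<^sup>2 + y\<^sup>2" by (simp add: power2_diff)
      moreover have "0 \<le> \<bar>x\<bar> * \<bar>y\<bar>" by simp
      ultimately show ?thesis by (simp only: abs_mult)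
    qed
    then show "AE z in ?N \<Otimes>\<^sub>M ?N. norm (snd z * fst z) \<le> norm ((fst z)\<^sup>2 + (snd z)\<^sup>2)"
      by (intro AE_I2) simp
  qed simp
  have Z_eq: "Z z = (fst z)\<^sup>2 - d * fst z - snd z * fst z + d * snd z" for z
    by (simp add: Z_def algebra_simps power2_eq_square)
  have iZ: "integrable (?N \<Otimes>\<^sub>M ?N) Z"
    unfolding Z_eq[abs_def] using i ixy by simp
  have "integral\<^sup>L (?N \<Otimes>\<^sub>M ?N) Z = (\<integral>x. (\<integral>y. Z (x, y) \<partial>?N) \<partial>?N)"
    by (rule NN.integral_fst'[OF iZ, symmetric])
  also have "\<dots> = (\<integral>x. x\<^sup>2 - d * x \<partial>?N)"
  proof (rule Bochner_Integration.integral_cong[OF refl])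
    fix x
    have "(\<integral>y. Z (x, y) \<partial>?N) = (\<integral>y. x\<^sup>2 - d * x + (d - x) * y \<partial>?N)"
      by (rule Bochner_Integration.integral_cong[OF refl]) (simp add: Z_eq algebra_simps)
    also have "\<dots> = x\<^sup>2 - d * x" using m1 N.prob_space by simp
    finally show "(\<integral>y. Z (x, y) \<partial>?N) = x\<^sup>2 - d * x" .
  qed
  also have "\<dots> = 1" using m1 m2 by simp
  finally have EZ: "integral\<^sup>L (?N \<Otimes>\<^sub>M ?N) Z = 1" .
  show ?thesis
  proof (intro exI[of _ "distr (?N \<Otimes>\<^sub>M ?N) borel Z"] conjI allI)
    show "real_distribution (distr (?N \<Otimes>\<^sub>M ?N) borel Z)"
      by (rule NN.real_distribution_distr) simp
    show "integrable (distr (?N \<Otimes>\<^sub>M ?N) borel Z) (\<lambda>z. z)"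
      using iZ by (simp add: integrable_distr_eq)
    show "(\<integral>z. z \<partial>distr (?N \<Otimes>\<^sub>M ?N) borel Z) = 1"
      using EZ by (simp add: integral_distr)
    fix t
    have int: "integrable (?N \<Otimes>\<^sub>M ?N) (\<lambda>z. iexp (t * Z z))"
      by (rule NN.integrable_const_bound[where B=1]) auto
    have "char (distr (?N \<Otimes>\<^sub>M ?N) borel Z) t = (\<integral>z. iexp (t * Z z) \<partial>(?N \<Otimes>\<^sub>M ?N))"
      by (simp add: char_def integral_distr)
    also have "\<dots> = (\<integral>x. (\<integral>y. iexp (t * Z (x, y)) \<partial>?N) \<partial>?N)"
      by (rule NN.integral_fst'[OF int, symmetric])
    also have "\<dots> = (\<integral>w. gain_weight t d w \<partial>?N)"
    proof (rule Bochner_Integration.integral_cong[OF refl])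
      fix x
      have "iexp (t * Z (x, y)) = iexp (t * (x * (x - d))) * iexp ((- (t * (x - d))) * y)" for y
        by (simp add: Z_def exp_add[symmetric] algebra_simps)
      then have "(\<integral>y. iexp (t * Z (x, y)) \<partial>?N) = iexp (t * (x * (x - d))) * char ?N (- (t * (x - d)))"
        unfolding char_def by simp
      then show "(\<integral>y. iexp (t * Z (x, y)) \<partial>?N) = gain_weight t d x"
        by (simp add: gain_weight_def char_std_normal_distribution)
    qed
    finally show "char (distr (?N \<Otimes>\<^sub>M ?N) borel Z) t = (\<integral>w. gain_weight t d w \<partial>?N)" .
  qed
qed

lemma convolution_distribution:
  assumes P: "real_distribution P" "integrable P (\<lambda>z. z)" and Q: "real_distribution Q" "integrable Q (\<lambda>z. z)"
  shows "\<exists>\<mu>. real_distribution \<mu> \<and> integrable \<mu> (\<lambda>z. z) \<and> (\<integral>z. z \<partial>\<mu>) = (\<integral>z. z \<partial>P) + (\<integral>z. z \<partial>Q) \<and>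
     (\<forall>t. char \<mu> t = char P t * char Q t)"
proof -
  interpret P: real_distribution P by fact
  interpret Q: real_distribution Q by fact
  interpret PQ: pair_prob_space P Q ..
  interpret PQ: prob_space "P \<Otimes>\<^sub>M Q" by (rule PQ.prob_space_axioms)
  let ?Z = "\<lambda>z::real \<times> real. fst z + snd z"
  have Z_meas [measurable]: "?Z \<in> borel_measurable (P \<Otimes>\<^sub>M Q)" by simp
  have i: "integrable (P \<Otimes>\<^sub>M Q) fst" "integrable (P \<Otimes>\<^sub>M Q) snd"
    using integrable_pair_fst[OF Q.prob_space_axioms P(2)]
      integrable_pair_snd[OF P.prob_space_axioms Q.prob_space_axioms Q(2)] by simp_all
  have iZ: "integrable (P \<Otimes>\<^sub>M Q) ?Z" using i by simp
  have "integral\<^sup>L (P \<Otimes>\<^sub>M Q) ?Z = (\<integral>x. (\<integral>y. ?Z (x, y) \<partial>Q) \<partial>P)"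
    by (rule PQ.integral_fst'[OF iZ, symmetric])
  also have "\<dots> = (\<integral>z. z \<partial>P) + (\<integral>z. z \<partial>Q)"
    using P(2) Q(2) P.prob_space Q.prob_space by simp
  finally have EZ: "integral\<^sup>L (P \<Otimes>\<^sub>M Q) ?Z = (\<integral>z. z \<partial>P) + (\<integral>z. z \<partial>Q)" .
  show ?thesis
  proof (intro exI[of _ "distr (P \<Otimes>\<^sub>M Q) borel ?Z"] conjI allI)
    show "real_distribution (distr (P \<Otimes>\<^sub>M Q) borel ?Z)"
      by (rule PQ.real_distribution_distr) simp
    show "integrable (distr (P \<Otimes>\<^sub>M Q) borel ?Z) (\<lambda>z. z)"
      using iZ by (subst integrable_distr_eq) auto
    show "(\<integral>z. z \<partial>distr (P \<Otimes>\<^sub>M Q) borel ?Z) = (\<integral>z. z \<partial>P) + (\<integral>z. z \<partial>Q)"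
      using EZ by (subst integral_distr) auto
    fix t
    have int: "integrable (P \<Otimes>\<^sub>M Q) (\<lambda>z. iexp (t * ?Z z))"
      by (rule PQ.integrable_const_bound[where B=1]) auto
    have "char (distr (P \<Otimes>\<^sub>M Q) borel ?Z) t = (\<integral>z. iexp (t * ?Z z) \<partial>(P \<Otimes>\<^sub>M Q))"
      unfolding char_def by (subst integral_distr) auto
    also have "\<dots> = (\<integral>x. (\<integral>y. iexp (t * ?Z (x, y)) \<partial>Q) \<partial>P)"
      by (rule PQ.integral_fst'[OF int, symmetric])
    also have "\<dots> = (\<integral>x. (\<integral>y. iexp (t * x) * iexp (t * y) \<partial>Q) \<partial>P)"
      by (simp add: distrib_left exp_add)
    also have "\<dots> = char P t * char Q t"
      by (simp add: char_def)
    finally show "char (distr (P \<Otimes>\<^sub>M Q) borel ?Z) t = char P t * char Q t" .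
  qed
qed

text \<open>Iterated convolution, one factor per coordinate, starting from the point mass at 0.
  Means add and characteristic functions multiply.\<close>

lemma gain_limit_distribution:
  fixes d :: "'k \<Rightarrow> real"
  assumes "finite K"
  shows "\<exists>\<mu>. real_distribution \<mu> \<and> integrable \<mu> (\<lambda>z. z) \<and> (\<integral>z. z \<partial>\<mu>) = real (card K) \<and>
     (\<forall>t. char \<mu> t = (\<Prod>k\<in>K. \<integral>w. gain_weight t (d k) w \<partial>std_normal_distribution))"
  using assms
proof induction
  case empty
  let ?\<mu> = "distr std_normal_distribution borel (\<lambda>_. 0::real)"
  interpret N: real_distribution std_normal_distribution by (rule real_dist_normal_dist)
  have "real_distribution ?\<mu>" by (rule N.real_distribution_distr) simp
  moreover have "integrable ?\<mu> (\<lambda>z. z)" by (subst integrable_distr_eq) auto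
  moreover have "(\<integral>z. z \<partial>?\<mu>) = 0" by (subst integral_distr) auto
  moreover have "char ?\<mu> t = 1" for t
    unfolding char_def by (subst integral_distr) (use N.prob_space in auto)
  ultimately show ?case by auto
next
  case (insert a K)
  obtain P where P: "real_distribution P" "integrable P (\<lambda>z. z)" "(\<integral>z. z \<partial>P) = real (card K)"
    "\<And>t. char P t = (\<Prod>k\<in>K. \<integral>w. gain_weight t (d k) w \<partial>std_normal_distribution)"
    using insert.IH by blast
  obtain Q where Q: "real_distribution Q" "integrable Q (\<lambda>z. z)" "(\<integral>z. z \<partial>Q) = 1"
    "\<And>t. char Q t = (\<integral>w. gain_weight t (d a) w \<partial>std_normal_distribution)"
    using gain_component_distribution[of "d a"] by blast
  from convolution_distribution[OF P(1,2) Q(1,2)]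
  show ?case
    using insert.hyps by (simp add: P Q mult.commute add.commute)
qed

text \<open>Fubini for the joint law of \<open>S\<close> and \<open>S'\<close>. Since the laws
  agree, the inner integral can be written with a second draw of \<open>S\<close> itself, so the
  copy disappears from the right-hand side.\<close>

lemma (in prob_space) indep_copy_expectation:
  fixes f :: "'b \<Rightarrow> 'b \<Rightarrow> complex"
  assumes ind: "indep_var N S N S'" and eq: "distr M N S' = distr M N S"
    and [measurable]: "case_prod f \<in> borel_measurable (N \<Otimes>\<^sub>M N)"
    and bound: "\<And>x y. norm (f x y) \<le> 1"
  shows "expectation (\<lambda>\<omega>. f (S \<omega>) (S' \<omega>)) = expectation (\<lambda>\<omega>. expectation (\<lambda>\<omega>'. f (S \<omega>) (S \<omega>')))"
proof -
  have [measurable]: "S \<in> measurable M N" "S' \<in> measurable M N"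
    using ind by (auto dest: indep_var_rv1 indep_var_rv2)
  let ?D = "distr M N S"
  interpret D: prob_space ?D by (rule prob_space_distr) simp
  interpret DD: pair_prob_space ?D ?D ..
  interpret DD: prob_space "?D \<Otimes>\<^sub>M ?D" by (rule DD.prob_space_axioms)
  have joint: "?D \<Otimes>\<^sub>M ?D = distr M (N \<Otimes>\<^sub>M N) (\<lambda>\<omega>. (S \<omega>, S' \<omega>))"
    using ind unfolding indep_var_distribution_eq eq by simp
  have int: "integrable (?D \<Otimes>\<^sub>M ?D) (case_prod f)"
    by (rule DD.integrable_const_bound[where B=1]) (use bound in auto)
  have "expectation (\<lambda>\<omega>. f (S \<omega>) (S' \<omega>)) = integral\<^sup>L (?D \<Otimes>\<^sub>M ?D) (case_prod f)"
    unfolding joint by (subst integral_distr) auto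
  also have "\<dots> = (\<integral>x. (\<integral>y. f x y \<partial>?D) \<partial>?D)"
    by (subst DD.integral_fst'[OF int, symmetric]) simp
  also have "\<dots> = (\<integral>x. expectation (\<lambda>\<omega>'. f x (S \<omega>')) \<partial>?D)"
    by (intro Bochner_Integration.integral_cong[OF refl] integral_distr) (auto simp: space_pair_measure)
  also have "\<dots> = expectation (\<lambda>\<omega>. expectation (\<lambda>\<omega>'. f (S \<omega>) (S \<omega>')))"
    by (rule integral_distr) auto
  finally show ?thesis .
qed

lemma cmod_iexp_diff_le: "cmod (iexp x - iexp y) \<le> \<bar>x - y\<bar>"
proof -
  have "iexp x - iexp y = iexp y * (iexp (x - y) - 1)"
    by (simp add: right_diff_distrib flip: exp_add)
  then have "cmod (iexp x - iexp y) = cmod (iexp (x - y) - 1)"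
    by (simp add: norm_mult)
  also have "\<dots> \<le> \<bar>x - y\<bar>"
    using iexp_approx1[of "x - y" 0] by simp
  finally show ?thesis .
qed

section \<open>From score and estimation error to the limiting characteristic function\<close>

context prob_space
begin

text \<open>\<open>S\<close>, \<open>St\<close> and \<open>V\<close> stand for the scores of data
  and copy and the scaled estimation error, \<open>q\<close> for the limiting covariance form. The
  convergence \<open>phi\<close> is uniform on balls because it is evaluated at a random
  frequency.\<close>

context
  fixes S St V :: "nat \<Rightarrow> 'a \<Rightarrow> real^'p" and A :: "'p set" and e :: "'p \<Rightarrow> real^'p" and d :: "'p \<Rightarrow> real"
    and q :: "real^'p \<Rightarrow> real" and C2 :: real
  assumes V_meas [measurable]: "\<And>n. V n \<in> borel_measurable M"
    and ind: "\<And>n. indep_var borel (S n) borel (St n)"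
    and same: "\<And>n. distr M borel (St n) = distr M borel (S n)"
    and int2: "\<And>n. integrable M (\<lambda>\<omega>. norm (S n \<omega>) ^ 2)"
    and C2: "\<And>n. expectation (\<lambda>\<omega>. norm (S n \<omega>) ^ 2) \<le> C2"
    and q: "\<And>c. q (\<Sum>k\<in>A. c k *\<^sub>R e k) = (\<Sum>k\<in>A. (c k)\<^sup>2)"
    and phi: "\<And>\<rho> \<epsilon>. 0 < \<epsilon> \<Longrightarrow> \<forall>\<^sub>F n in sequentially. \<forall>v. norm v \<le> \<rho> \<longrightarrow>
      cmod (expectation (\<lambda>\<omega>. iexp (v \<bullet> S n \<omega>)) - of_real (exp (- (q v / 2)))) \<le> \<epsilon>"
begin

definition limit_point where "limit_point s = (\<Sum>k\<in>A. (e k \<bullet> s - d k) *\<^sub>R e k)"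

lemma S_meas: "S n \<in> borel_measurable M" "St n \<in> borel_measurable M"
  using ind[of n] by (auto dest: indep_var_rv1 indep_var_rv2)

lemma limit_point_meas: "limit_point \<in> borel_measurable borel"
  unfolding limit_point_def[abs_def] by simp

lemma St_2: "integrable M (\<lambda>\<omega>. norm (St n \<omega>) ^ 2)" "expectation (\<lambda>\<omega>. norm (St n \<omega>) ^ 2) \<le> C2"
proof -
  note [measurable] = S_meas limit_point_meas
  have "integrable (distr M borel (S n)) (\<lambda>x. norm x ^ 2)"
    using int2 by (subst integrable_distr_eq) auto
  then show "integrable M (\<lambda>\<omega>. norm (St n \<omega>) ^ 2)"
    unfolding same[symmetric] by (subst (asm) integrable_distr_eq) auto
  have "expectation (\<lambda>\<omega>. norm (St n \<omega>) ^ 2) = (\<integral>x. norm x ^ 2 \<partial>distr M borel (St n))"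
    by (subst integral_distr) auto
  also have "\<dots> = expectation (\<lambda>\<omega>. norm (S n \<omega>) ^ 2)"
    unfolding same by (subst integral_distr) auto
  finally show "expectation (\<lambda>\<omega>. norm (St n \<omega>) ^ 2) \<le> C2" using C2 by simp
qed

lemma C2_nonneg: "0 \<le> C2"
  by (rule order_trans[OF _ C2[of 0]]) simp

text \<open>The form \<open>4 * C2 / R\<^sup>2\<close> is twice the Chebyshev bound for two vectors,
  as a difference of two characters has modulus at most 2. The summand 1 keeps \<open>R\<close>
  positive when \<open>C2 = 0\<close>.\<close>

lemma truncation_radius:
  assumes "0 < \<epsilon>"
  obtains R where "0 < R" "4 * C2 / R\<^sup>2 \<le> \<epsilon>"
proof
  let ?R = "sqrt (4 * C2 / \<epsilon> + 1)"
  have pos: "0 < 4 * C2 / \<epsilon> + 1" using C2_nonneg assms by (simp add: add_nonneg_pos)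
  then show "0 < ?R" by simp
  have "4 * C2 \<le> \<epsilon> * (4 * C2 / \<epsilon> + 1)" using assms by (simp add: distrib_left)
  then show "4 * C2 / ?R\<^sup>2 \<le> \<epsilon>" using pos by (simp add: divide_le_eq)
qed

text \<open>For scores of norm at most \<open>R\<close> the exponents are close, and
  \<open>iexp\<close> is 1-Lipschitz. Otherwise the trivial bound 2 is at most a multiple of the
  squared norms over \<open>R\<^sup>2\<close>, so one integrable majorant covers both cases.\<close>

lemma replace_by_limit_point:
  assumes V: "\<And>R \<epsilon>. 0 < \<epsilon> \<Longrightarrow> \<forall>\<^sub>F n in sequentially. \<forall>\<omega>. norm (S n \<omega>) \<le> R \<longrightarrow>
      norm (V n \<omega> - limit_point (S n \<omega>)) \<le> \<epsilon>"
  shows "(\<lambda>n. expectation (\<lambda>\<omega>. iexp (t * ((S n \<omega> - St n \<omega>) \<bullet> V n \<omega>)))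
    - expectation (\<lambda>\<omega>. iexp (t * ((S n \<omega> - St n \<omega>) \<bullet> limit_point (S n \<omega>))))) \<longlonglongrightarrow> 0"
    (is "?f \<longlonglongrightarrow> 0")
proof (rule tendstoI)
  note [measurable] = S_meas limit_point_meas
  fix \<epsilon> :: real assume \<epsilon>: "0 < \<epsilon>"
  obtain R where R: "0 < R" "4 * C2 / R\<^sup>2 \<le> \<epsilon> / 4"
    using truncation_radius[of "\<epsilon> / 4"] \<epsilon> by auto
  define \<eta> where "\<eta> = \<epsilon> / (4 * ((\<bar>t\<bar> + 1) * (2 * R)))"
  have \<eta>: "0 < \<eta>" using \<epsilon> R by (auto simp: \<eta>_def intro!: divide_pos_pos mult_pos_pos add_nonneg_pos)
  have \<eta>_eq: "(\<bar>t\<bar> + 1) * (2 * R * \<eta>) = \<epsilon> / 4"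
  proof -
    have "0 < (\<bar>t\<bar> + 1) * (2 * R)" using R by (intro mult_pos_pos add_nonneg_pos) auto
    moreover have "a * (\<epsilon> / (4 * a)) = \<epsilon> / 4" if "0 < a" for a :: real using that by simp
    ultimately show ?thesis unfolding \<eta>_def by (metis mult.assoc)
  qed
  show "\<forall>\<^sub>F n in sequentially. dist (?f n) 0 < \<epsilon>"
    using V[OF \<eta>, of R]
  proof eventually_elim
    case (elim n)
    let ?z = "\<lambda>\<omega>. (S n \<omega> - St n \<omega>) \<bullet> V n \<omega>" and ?z' = "\<lambda>\<omega>. (S n \<omega> - St n \<omega>) \<bullet> limit_point (S n \<omega>)"
    have int: "integrable M (\<lambda>\<omega>. iexp (t * ?z \<omega>))" "integrable M (\<lambda>\<omega>. iexp (t * ?z' \<omega>))"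
      by (rule integrable_const_bound[where B=1]; simp)+
    have le: "cmod (iexp (t * ?z \<omega>) - iexp (t * ?z' \<omega>)) \<le> \<epsilon> / 4 + (2 * norm (S n \<omega>) ^ 2 + 2 * norm (St n \<omega>) ^ 2) / R\<^sup>2" for \<omega>
    proof (cases "norm (S n \<omega>) \<le> R \<and> norm (St n \<omega>) \<le> R")
      case True
      have "\<bar>?z \<omega> - ?z' \<omega>\<bar> \<le> norm (S n \<omega> - St n \<omega>) * norm (V n \<omega> - limit_point (S n \<omega>))"
        unfolding inner_diff_right[symmetric] by (rule Cauchy_Schwarz_ineq2)
      also have "\<dots> \<le> (2 * R) * \<eta>"
      proof (rule mult_mono)
        show "norm (S n \<omega> - St n \<omega>) \<le> 2 * R"
          using True norm_triangle_ineq4[of "S n \<omega>" "St n \<omega>"] by linarith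
        show "norm (V n \<omega> - limit_point (S n \<omega>)) \<le> \<eta>" using elim True by blast
      qed (use R in auto)
      finally have zz: "\<bar>?z \<omega> - ?z' \<omega>\<bar> \<le> 2 * R * \<eta>" .
      have "cmod (iexp (t * ?z \<omega>) - iexp (t * ?z' \<omega>)) \<le> \<bar>t * ?z \<omega> - t * ?z' \<omega>\<bar>"
        by (rule cmod_iexp_diff_le)
      also have "\<dots> = \<bar>t\<bar> * \<bar>?z \<omega> - ?z' \<omega>\<bar>"
        unfolding right_diff_distrib[symmetric] abs_mult ..
      also have "\<dots> \<le> (\<bar>t\<bar> + 1) * (2 * R * \<eta>)"
        using zz by (intro mult_mono) auto
      also have "\<dots> \<le> \<epsilon> / 4 + (2 * norm (S n \<omega>) ^ 2 + 2 * norm (St n \<omega>) ^ 2) / R\<^sup>2"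
        unfolding \<eta>_eq by simp
      finally show ?thesis .
    next
      case False
      then have "R\<^sup>2 \<le> norm (S n \<omega>) ^ 2 \<or> R\<^sup>2 \<le> norm (St n \<omega>) ^ 2"
        using R by (auto intro!: power_mono)
      then have "R\<^sup>2 \<le> norm (S n \<omega>) ^ 2 + norm (St n \<omega>) ^ 2"
        by (auto intro: add_increasing add_increasing2)
      then have "2 \<le> (2 * norm (S n \<omega>) ^ 2 + 2 * norm (St n \<omega>) ^ 2) / R\<^sup>2"
        using R by (simp add: le_divide_eq)
      moreover have "cmod (iexp (t * ?z \<omega>) - iexp (t * ?z' \<omega>)) \<le> 1 + 1"
        by (rule norm_triangle_le_diff) simp
      ultimately show ?thesis using \<epsilon> by linarith
    qed
    have ib: "integrable M (\<lambda>\<omega>. \<epsilon> / 4 + (2 * norm (S n \<omega>) ^ 2 + 2 * norm (St n \<omega>) ^ 2) / R\<^sup>2)"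
      using int2 St_2(1) by simp
    have "norm (expectation (\<lambda>\<omega>. iexp (t * ?z \<omega>)) - expectation (\<lambda>\<omega>. iexp (t * ?z' \<omega>)))
      = norm (expectation (\<lambda>\<omega>. iexp (t * ?z \<omega>) - iexp (t * ?z' \<omega>)))"
      using int by (subst Bochner_Integration.integral_diff) auto
    also have "\<dots> \<le> expectation (\<lambda>\<omega>. norm (iexp (t * ?z \<omega>) - iexp (t * ?z' \<omega>)))"
      by (rule integral_norm_bound)
    also have "\<dots> \<le> expectation (\<lambda>\<omega>. \<epsilon> / 4 + (2 * norm (S n \<omega>) ^ 2 + 2 * norm (St n \<omega>) ^ 2) / R\<^sup>2)"
      using int by (intro integral_mono ib le) auto
    also have "\<dots> = \<epsilon> / 4 + (2 * expectation (\<lambda>\<omega>. norm (S n \<omega>) ^ 2) + 2 * expectation (\<lambda>\<omega>. norm (St n \<omega>) ^ 2)) / R\<^sup>2"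
      using int2 St_2(1) by (simp add: prob_space)
    also have "\<dots> \<le> \<epsilon> / 4 + (2 * C2 + 2 * C2) / R\<^sup>2"
      using C2[of n] St_2(2)[of n] by (intro add_left_mono divide_right_mono) auto
    also have "\<dots> \<le> \<epsilon> / 4 + \<epsilon> / 4" using R(2) by simp
    also have "\<dots> < \<epsilon>" using \<epsilon> by simp
    finally show ?case by simp
  qed
qed

lemma limit_point_bounded: "\<exists>b. \<forall>s. norm s \<le> R \<longrightarrow> norm (limit_point s) \<le> b"
proof -
  have "compact (limit_point ` cball 0 R)"
    unfolding limit_point_def[abs_def] by (intro compact_continuous_image continuous_intros compact_cball)
  then obtain b where "\<forall>x\<in>limit_point ` cball 0 R. norm x \<le> b"
    using compact_imp_bounded bounded_iff by blast
  then show ?thesis by (intro exI[of _ b]) auto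
qed

text \<open>
  Integrating out the copy leaves its characteristic function at \<open>- t\<close> times the limit point of the
  data, which is nearly Gaussian uniformly on bounded sets.
\<close>

lemma replace_copy:
  "(\<lambda>n. expectation (\<lambda>\<omega>. iexp (t * ((S n \<omega> - St n \<omega>) \<bullet> limit_point (S n \<omega>))))
    - expectation (\<lambda>\<omega>. iexp (t * (S n \<omega> \<bullet> limit_point (S n \<omega>))) * of_real (exp (- (q ((- t) *\<^sub>R limit_point (S n \<omega>)) / 2))))) \<longlonglongrightarrow> 0"
    (is "?f \<longlonglongrightarrow> 0")
proof (rule tendstoI)
  note [measurable] = S_meas limit_point_meas
  fix \<epsilon> :: real assume \<epsilon>: "0 < \<epsilon>"
  obtain R where R: "0 < R" "4 * C2 / R\<^sup>2 \<le> \<epsilon> / 4"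
    using truncation_radius[of "\<epsilon> / 4"] \<epsilon> by auto
  have \<epsilon>4: "0 < \<epsilon> / 4" using \<epsilon> by simp
  obtain b where b: "\<And>s. norm s \<le> R \<Longrightarrow> norm (limit_point s) \<le> b"
    using limit_point_bounded[of R] by blast
  \<comment> \<open>The vectors \<open>e\<close> are orthonormal for \<open>q\<close>, so the form
    of the limit point is the sum of the squared coefficients.\<close>
  have q_lp: "q ((- t) *\<^sub>R limit_point s) = (\<Sum>k\<in>A. (t * (e k \<bullet> s - d k))\<^sup>2)" for s
    using q[of "\<lambda>k. - t * (e k \<bullet> s - d k)"] by (simp add: limit_point_def scaleR_sum_right sum_negf)
  show "\<forall>\<^sub>F n in sequentially. dist (?f n) 0 < \<epsilon>"
    using phi[OF \<epsilon>4, of "\<bar>t\<bar> * b"]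
  proof eventually_elim
    case (elim n)
    define \<phi> where "\<phi> v = expectation (\<lambda>\<omega>'. iexp (v \<bullet> S n \<omega>'))" for v
    let ?v = "\<lambda>\<omega>. (- t) *\<^sub>R limit_point (S n \<omega>)"
    let ?a = "\<lambda>\<omega>. iexp (t * (S n \<omega> \<bullet> limit_point (S n \<omega>)))"
    have f: "iexp (t * ((x - y) \<bullet> limit_point x)) = iexp (t * (x \<bullet> limit_point x)) * iexp (((- t) *\<^sub>R limit_point x) \<bullet> y)" for x y
      by (simp add: inner_diff_left inner_commute[of "limit_point x" y] algebra_simps flip: exp_add)
    \<comment> \<open>\<open>limit_point (S n \<omega>)\<close> involves the data alone, so the copy
      can be integrated out with this vector held fixed.\<close>
    have "expectation (\<lambda>\<omega>. iexp (t * ((S n \<omega> - St n \<omega>) \<bullet> limit_point (S n \<omega>))))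
      = expectation (\<lambda>\<omega>. expectation (\<lambda>\<omega>'. iexp (t * ((S n \<omega> - S n \<omega>') \<bullet> limit_point (S n \<omega>)))))"
      by (rule indep_copy_expectation[OF ind same]) auto
    also have "\<dots> = expectation (\<lambda>\<omega>. ?a \<omega> * \<phi> (?v \<omega>))"
      unfolding f \<phi>_def by simp
    finally have E: "expectation (\<lambda>\<omega>. iexp (t * ((S n \<omega> - St n \<omega>) \<bullet> limit_point (S n \<omega>)))) = expectation (\<lambda>\<omega>. ?a \<omega> * \<phi> (?v \<omega>))" .
    have [measurable]: "(\<lambda>\<omega>. q (?v \<omega>)) \<in> borel_measurable M" unfolding q_lp by simp
    have [measurable]: "(\<lambda>\<omega>. \<phi> (?v \<omega>)) \<in> borel_measurable M" unfolding \<phi>_def by measurable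
    have \<phi>1: "cmod (\<phi> v) \<le> 1" for v
    proof -
      have "cmod (\<phi> v) \<le> expectation (\<lambda>\<omega>'. cmod (iexp (v \<bullet> S n \<omega>')))" unfolding \<phi>_def by (rule integral_norm_bound)
      then show ?thesis by (simp add: prob_space)
    qed
    have q1: "cmod (of_real (exp (- (q (?v \<omega>) / 2)))) \<le> 1" for \<omega>
      unfolding q_lp by (simp add: sum_nonneg)
    have int: "integrable M (\<lambda>\<omega>. ?a \<omega> * \<phi> (?v \<omega>))"
      by (rule integrable_const_bound[where B=1], use \<phi>1 in \<open>simp add: norm_mult\<close>, measurable)
    have int': "integrable M (\<lambda>\<omega>. ?a \<omega> * of_real (exp (- (q (?v \<omega>) / 2))))"
      by (rule integrable_const_bound[where B=1], use q1 in \<open>simp add: norm_mult del: norm_of_real\<close>, measurable)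
    have le: "cmod (?a \<omega> * \<phi> (?v \<omega>) - ?a \<omega> * of_real (exp (- (q (?v \<omega>) / 2)))) \<le> \<epsilon> / 4 + 2 * norm (S n \<omega>) ^ 2 / R\<^sup>2" for \<omega>
    proof -
      have "cmod (?a \<omega> * \<phi> (?v \<omega>) - ?a \<omega> * of_real (exp (- (q (?v \<omega>) / 2)))) = cmod (\<phi> (?v \<omega>) - of_real (exp (- (q (?v \<omega>) / 2))))"
        unfolding right_diff_distrib[symmetric] by (simp add: norm_mult)
      also have "\<dots> \<le> \<epsilon> / 4 + 2 * norm (S n \<omega>) ^ 2 / R\<^sup>2"
      proof (cases "norm (S n \<omega>) \<le> R")
        case True
        then have "norm (?v \<omega>) \<le> \<bar>t\<bar> * b" using b by (simp add: mult_left_mono)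
        then have "cmod (\<phi> (?v \<omega>) - of_real (exp (- (q (?v \<omega>) / 2)))) \<le> \<epsilon> / 4" using elim unfolding \<phi>_def by blast
        then show ?thesis by (rule order_trans) simp
      next
        case False
        then have "R\<^sup>2 \<le> norm (S n \<omega>) ^ 2" using R by (auto intro!: power_mono)
        then have "2 \<le> 2 * norm (S n \<omega>) ^ 2 / R\<^sup>2" using R by (simp add: le_divide_eq)
        moreover have "cmod (\<phi> (?v \<omega>) - of_real (exp (- (q (?v \<omega>) / 2)))) \<le> 1 + 1"
          by (rule norm_triangle_le_diff[OF add_mono[OF \<phi>1 q1]])
        ultimately show ?thesis using \<epsilon> by linarith
      qed
      finally show ?thesis .
    qed
    have ib: "integrable M (\<lambda>\<omega>. \<epsilon> / 4 + 2 * norm (S n \<omega>) ^ 2 / R\<^sup>2)" using int2 by simp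
    have "norm (expectation (\<lambda>\<omega>. ?a \<omega> * \<phi> (?v \<omega>)) - expectation (\<lambda>\<omega>. ?a \<omega> * of_real (exp (- (q (?v \<omega>) / 2)))))
      = norm (expectation (\<lambda>\<omega>. ?a \<omega> * \<phi> (?v \<omega>) - ?a \<omega> * of_real (exp (- (q (?v \<omega>) / 2)))))"
      using int int' by (subst Bochner_Integration.integral_diff) auto
    also have "\<dots> \<le> expectation (\<lambda>\<omega>. norm (?a \<omega> * \<phi> (?v \<omega>) - ?a \<omega> * of_real (exp (- (q (?v \<omega>) / 2)))))"
      by (rule integral_norm_bound)
    also have "\<dots> \<le> expectation (\<lambda>\<omega>. \<epsilon> / 4 + 2 * norm (S n \<omega>) ^ 2 / R\<^sup>2)"
      by (rule integral_mono[OF integrable_norm[OF Bochner_Integration.integrable_diff[OF int int']] ib le])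
    also have "\<dots> = \<epsilon> / 4 + 2 * expectation (\<lambda>\<omega>. norm (S n \<omega>) ^ 2) / R\<^sup>2"
      using int2 by (simp add: prob_space)
    also have "\<dots> \<le> \<epsilon> / 4 + 4 * C2 / R\<^sup>2"
      using C2[of n] C2_nonneg by (intro add_left_mono divide_right_mono) auto
    also have "\<dots> \<le> \<epsilon> / 4 + \<epsilon> / 4" using R(2) by simp
    also have "\<dots> < \<epsilon>" using \<epsilon> by simp
    finally show ?case unfolding E by simp
  qed
qed

text \<open>Both the phase and the Gaussian exponent are sums over the coordinates
  \<open>e k \<bullet> S n \<omega>\<close>, so the integrand factorizes into bounded continuous
  functions of one coordinate each.\<close>

lemma product_limit:
  "(\<lambda>n. expectation (\<lambda>\<omega>. iexp (t * (S n \<omega> \<bullet> limit_point (S n \<omega>))) * of_real (exp (- (q ((- t) *\<^sub>R limit_point (S n \<omega>)) / 2)))))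
    \<longlonglongrightarrow> (\<Prod>k\<in>A. \<integral>w. gain_weight t (d k) w \<partial>std_normal_distribution)"
proof -
  note [measurable] = S_meas limit_point_meas
  have q_lp: "q ((- t) *\<^sub>R limit_point s) = (\<Sum>k\<in>A. (t * (e k \<bullet> s - d k))\<^sup>2)" for s
    using q[of "\<lambda>k. - t * (e k \<bullet> s - d k)"] by (simp add: limit_point_def scaleR_sum_right sum_negf)
  have eq: "iexp (t * (s \<bullet> limit_point s)) * of_real (exp (- (q ((- t) *\<^sub>R limit_point s) / 2)))
    = (\<Prod>k\<in>A. gain_weight t (d k) (e k \<bullet> s))" for s
  proof -
    have 1: "t * (s \<bullet> limit_point s) = (\<Sum>k\<in>A. t * ((e k \<bullet> s) * (e k \<bullet> s - d k)))"
      by (simp add: limit_point_def inner_sum_right sum_distrib_left inner_commute mult_ac)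
    have 2: "- (q ((- t) *\<^sub>R limit_point s) / 2) = (\<Sum>k\<in>A. - ((t * (e k \<bullet> s - d k))\<^sup>2 / 2))"
      unfolding q_lp by (simp add: sum_negf sum_divide_distrib)
    have 3: "iexp (t * (s \<bullet> limit_point s)) = (\<Prod>k\<in>A. iexp (t * ((e k \<bullet> s) * (e k \<bullet> s - d k))))"
      unfolding 1 by (simp add: sum_distrib_left exp_sum)
    have 4: "complex_of_real (exp (- (q ((- t) *\<^sub>R limit_point s) / 2))) = (\<Prod>k\<in>A. of_real (exp (- ((t * (e k \<bullet> s - d k))\<^sup>2 / 2))))"
      unfolding 2 by (simp add: exp_sum)
    show ?thesis unfolding 3 4 gain_weight_def prod.distrib ..
  qed
  have cf: "(\<lambda>n. expectation (\<lambda>\<omega>. iexp (\<Sum>k\<in>A. v k * (e k \<bullet> S n \<omega>)))) \<longlonglongrightarrow> of_real (exp (- (\<Sum>k\<in>A. (v k)\<^sup>2) / 2))" for v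
  proof (rule LIMSEQ_I)
    fix \<epsilon> :: real assume \<epsilon>: "0 < \<epsilon>"
    let ?v = "\<Sum>k\<in>A. v k *\<^sub>R e k"
    have sum: "(\<Sum>k\<in>A. v k * (e k \<bullet> s)) = ?v \<bullet> s" for s
      by (simp add: inner_sum_left)
    have "\<forall>\<^sub>F n in sequentially. norm (expectation (\<lambda>\<omega>. iexp (?v \<bullet> S n \<omega>)) - of_real (exp (- (q ?v / 2)))) < \<epsilon>"
      using phi[of "\<epsilon> / 2" "norm ?v", OF half_gt_zero[OF \<epsilon>]]
    proof eventually_elim
      case (elim n)
      then have "norm (expectation (\<lambda>\<omega>. iexp (?v \<bullet> S n \<omega>)) - of_real (exp (- (q ?v / 2)))) \<le> \<epsilon> / 2" by blast
      then show ?case using \<epsilon> by linarith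
    qed
    then show "\<exists>no. \<forall>n\<ge>no. norm (expectation (\<lambda>\<omega>. iexp (\<Sum>k\<in>A. v k * (e k \<bullet> S n \<omega>))) - of_real (exp (- (\<Sum>k\<in>A. (v k)\<^sup>2) / 2))) < \<epsilon>"
      unfolding sum by (simp add: eventually_sequentially q)
  qed
  show ?thesis
    unfolding eq by (rule prod_bounded_continuous_limit[OF _ _ cf]) (simp_all add: isCont_gain_weight norm_gain_weight)
qed

lemma gain_char_limit:
  assumes "\<And>R \<epsilon>. 0 < \<epsilon> \<Longrightarrow> \<forall>\<^sub>F n in sequentially. \<forall>\<omega>. norm (S n \<omega>) \<le> R \<longrightarrow>
      norm (V n \<omega> - (\<Sum>k\<in>A. (e k \<bullet> S n \<omega> - d k) *\<^sub>R e k)) \<le> \<epsilon>"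
  shows "(\<lambda>n. expectation (\<lambda>\<omega>. iexp (t * ((S n \<omega> - St n \<omega>) \<bullet> V n \<omega>))))
    \<longlonglongrightarrow> (\<Prod>k\<in>A. \<integral>w. gain_weight t (d k) w \<partial>std_normal_distribution)"
  using tendsto_add[OF tendsto_add[OF replace_by_limit_point replace_copy] product_limit, of t t t] assms
  unfolding limit_point_def by simp

end

end

section \<open>The generalized linear model\<close>

lemma inner_transpose_mult: "v \<bullet> (transpose A *v w) = (A *v v) \<bullet> (w :: real^'m)"
  by (metis dot_lmul_matrix inner_commute transpose_matrix_vector)

lemma continuous_on_matrix_vector_mult [continuous_intros]:
  fixes A :: "real^'n^'m"
  assumes "continuous_on S f"
  shows "continuous_on S (\<lambda>x. A *v f x)"
  by (rule continuous_on_compose2[OF linear_continuous_on[OF matrix_vector_mul_bounded_linear] assms subset_UNIV])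

locale bridge_glm = exp_family \<nu> b + prob_space M
  for \<nu> :: "(real^'r) measure" and b :: "real^'r \<Rightarrow> real" and M :: "'w measure" +
  fixes X :: "nat \<Rightarrow> real^'p^'r" and \<X> :: "(real^'p^'r) set"
    and B :: "(real^'p) set" and \<beta>s :: "real^'p"
    and y yt :: "nat \<Rightarrow> 'w \<Rightarrow> real^'r"
    and betahat :: "nat \<Rightarrow> (nat \<Rightarrow> real^'r) \<Rightarrow> real^'p"
    and \<gamma> \<gamma>0 lam :: real and J :: "real^'p^'p"
  assumes open_B: "open B" and convex_B: "convex B" and in_B: "\<beta>s \<in> B"
    and X_in: "\<And>i. X i \<in> \<X>"
    and compact_X: "compact \<X>"
    and interior: "\<And>X \<beta>. X \<in> \<X> \<Longrightarrow> \<beta> \<in> B \<Longrightarrow> X *v \<beta> \<in> interior (natural_space \<nu> b)"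
    and J_pd: "pos_def_matrix J"
    and J_lim: "(\<lambda>n. (1 / real n) *\<^sub>R (\<Sum>i<n. fisher_term \<nu> b \<beta>s (X i))) \<longlonglongrightarrow> J"
    and indep_y: "indep_vars (\<lambda>_. borel) y UNIV"
    and dist_y: "\<And>i. distributed M \<nu> (y i) (\<lambda>v. ennreal (nef_density \<nu> b (X i *v \<beta>s) v))"
    and same_dist: "distr M (PiM UNIV (\<lambda>_. borel)) (\<lambda>\<omega> i. yt i \<omega>) = distr M (PiM UNIV (\<lambda>_. borel)) (\<lambda>\<omega> i. y i \<omega>)"
    and indep_copy: "indep_var (PiM UNIV (\<lambda>_. borel)) (\<lambda>\<omega> i. y i \<omega>) (PiM UNIV (\<lambda>_. borel)) (\<lambda>\<omega> i. yt i \<omega>)"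
    and \<gamma>: "0 < \<gamma>" "\<gamma> < 1" "\<gamma> < \<gamma>0" "\<gamma>0 \<le> 1" and lam: "0 < lam"
    and betahat: "\<And>n. bridge_estimator \<nu> b X B \<gamma> (real n powr ((\<gamma>0 - 2) / 2) * lam) n (betahat n)"
begin

sublocale J: pos_def_form J
  by unfold_locales (rule J_pd)

abbreviation "\<theta> i \<equiv> X i *v \<beta>s"
abbreviation "fisher i \<equiv> fisher_term \<nu> b \<beta>s (X i)"

definition noise where "noise i \<omega> = transpose (X i) *v (y i \<omega> - mean (\<theta> i))"

text \<open>Bregman divergence of the cumulant, that is, the Kullback-Leibler divergence of the law
  at \<open>X i *v (\<beta>s + h)\<close> from the law at \<open>\<theta> i\<close>. It contains no
  observation.\<close>

definition divergence where
  "divergence i h = cumulant (X i *v (\<beta>s + h)) - cumulant (\<theta> i) - mean (\<theta> i) \<bullet> (X i *v h)"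

lemma \<theta>_interior: "\<theta> i \<in> interior Theta"
  by (rule interior[OF X_in in_B])

lemma compact_\<theta>: "compact ((\<lambda>X. X *v \<beta>s) ` \<X>)" "(\<lambda>X. X *v \<beta>s) ` \<X> \<subseteq> interior Theta"
proof -
  have "linear (\<lambda>X :: real^'p^'r. X *v \<beta>s)"
    by (rule linearI) (simp_all add: matrix_vector_mult_add_rdistrib scaleR_matrix_vector_assoc)
  then show "compact ((\<lambda>X. X *v \<beta>s) ` \<X>)"
    by (intro compact_continuous_image compact_X linear_continuous_on) (simp add: linear_conv_bounded_linear)
  show "(\<lambda>X. X *v \<beta>s) ` \<X> \<subseteq> interior Theta"
    using interior in_B by auto
qed

lemma X_bounded: obtains XB where "0 < XB" "\<And>i. norm (X i) \<le> XB"
  using compact_imp_bounded[OF compact_X] X_in unfolding bounded_pos by blast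

lemma fisher_form: "h \<bullet> (fisher i *v h) = covariance (\<theta> i) (X i *v h)"
proof -
  have "fisher i *v h = transpose (X i) *v (hessian cumulant (\<theta> i) *v (X i *v h))"
    unfolding fisher_term_def by (simp flip: matrix_vector_mul_assoc)
  then show ?thesis
    by (simp only: inner_transpose_mult inner_hessian_cumulant[OF \<theta>_interior])
qed

text \<open>Uniform in \<open>i\<close>: the true natural parameters lie in a compact subset of the
  interior, and the matrices are bounded, which converts smallness of \<open>h\<close> into
  smallness of \<open>X i *v h\<close>.\<close>

lemma divergence_expansion:
  obtains \<delta> D where "0 < \<delta>" "0 < D" "cball \<beta>s \<delta> \<subseteq> B"
    "\<And>i h. norm h \<le> \<delta> \<Longrightarrow> \<bar>divergence i h - h \<bullet> (fisher i *v h) / 2\<bar> \<le> D * norm h ^ 3"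
proof -
  obtain XB where XB: "0 < XB" "\<And>i. norm (X i) \<le> XB" using X_bounded by metis
  have Xh: "norm (X i *v h) \<le> XB * norm h" for i h
    using norm_matrix_vector_mult_le[of "X i" h] mult_right_mono[OF XB(2), of "norm h" i] by simp
  obtain \<delta>0 M0 where 0: "0 < \<delta>0" "0 < M0"
    "\<And>\<theta> h. \<theta> \<in> (\<lambda>X. X *v \<beta>s) ` \<X> \<Longrightarrow> norm h \<le> \<delta>0 \<Longrightarrow>
      \<bar>cumulant (\<theta> + h) - cumulant \<theta> - mean \<theta> \<bullet> h - covariance \<theta> h / 2\<bar> \<le> M0 * norm h ^ 3"
    using compact_cumulant_expansion[OF compact_\<theta>] by metis
  obtain \<delta>1 where 1: "0 < \<delta>1" "cball \<beta>s \<delta>1 \<subseteq> B"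
    using open_contains_cball[of B] open_B in_B by blast
  show ?thesis
  proof
    show "0 < min \<delta>1 (\<delta>0 / XB)" using 0 1 XB by simp
    show "0 < M0 * XB ^ 3" using 0 XB by simp
    show "cball \<beta>s (min \<delta>1 (\<delta>0 / XB)) \<subseteq> B" using 1 by auto
    fix i and h :: "real^'p" assume h: "norm h \<le> min \<delta>1 (\<delta>0 / XB)"
    have "XB * norm h \<le> \<delta>0" using h XB by (simp add: le_divide_eq mult.commute)
    then have "norm (X i *v h) \<le> \<delta>0" using Xh[of i h] by simp
    then have "\<bar>divergence i h - h \<bullet> (fisher i *v h) / 2\<bar> \<le> M0 * norm (X i *v h) ^ 3"
      unfolding divergence_def fisher_form matrix_vector_right_distrib
      using 0(3)[of "\<theta> i" "X i *v h"] X_in by blast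
    also have "\<dots> \<le> M0 * (XB * norm h) ^ 3"
      using Xh 0 by (intro mult_left_mono power_mono) auto
    finally show "\<bar>divergence i h - h \<bullet> (fisher i *v h) / 2\<bar> \<le> M0 * XB ^ 3 * norm h ^ 3"
      by (simp add: power_mult_distrib)
  qed
qed

lemma y_meas [measurable]: "y i \<in> borel_measurable M"
  using indep_y unfolding indep_vars_def2 by blast

lemma distr_y: "distr M borel (y i) = law (\<theta> i)"
proof -
  have "distr M borel (y i) = distr M \<nu> (y i)"
    by (rule distr_cong) (simp_all add: sets_nu)
  then show ?thesis
    using distributed_distr_eq_density[OF dist_y[of i]] by (simp add: law_def)
qed

lemma y_integral:
  fixes f :: "real^'r \<Rightarrow> 'u::{banach, second_countable_topology}"
  assumes [measurable]: "f \<in> borel_measurable borel"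
  shows "integrable M (\<lambda>\<omega>. f (y i \<omega>)) \<longleftrightarrow> integrable (law (\<theta> i)) f"
    and "expectation (\<lambda>\<omega>. f (y i \<omega>)) = (\<integral>v. f v \<partial>law (\<theta> i))"
proof -
  show "integrable M (\<lambda>\<omega>. f (y i \<omega>)) \<longleftrightarrow> integrable (law (\<theta> i)) f"
    using integrable_distr_eq[OF y_meas assms, of i] unfolding distr_y by blast
  show "expectation (\<lambda>\<omega>. f (y i \<omega>)) = (\<integral>v. f v \<partial>law (\<theta> i))"
    using integral_distr[OF y_meas assms, of i] unfolding distr_y by (rule sym)
qed

lemma noise_indep_centered: "\<exists>C. indep_centered M noise C"
proof -
  obtain XB where XB: "0 < XB" "\<And>i. norm (X i) \<le> XB" using X_bounded by metis
  let ?K = "(\<lambda>X. X *v \<beta>s) ` \<X>"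
  obtain \<delta>0 M0 where 0: "0 < \<delta>0" "0 < M0"
    "\<And>\<theta>. \<theta> \<in> ?K \<Longrightarrow> cball \<theta> \<delta>0 \<subseteq> interior Theta"
    "\<And>\<theta> h. \<theta> \<in> ?K \<Longrightarrow> norm h \<le> \<delta>0 \<Longrightarrow>
      \<bar>cumulant (\<theta> + h) - cumulant \<theta> - mean \<theta> \<bullet> h - covariance \<theta> h / 2\<bar> \<le> M0 * norm h ^ 3"
    "\<And>\<theta>. \<theta> \<in> ?K \<Longrightarrow> integrable (law \<theta>) (\<lambda>y. y - mean \<theta>)"
    "\<And>\<theta>. \<theta> \<in> ?K \<Longrightarrow> (\<integral>y. y - mean \<theta> \<partial>law \<theta>) = 0"
    "\<And>\<theta> k. \<theta> \<in> ?K \<Longrightarrow> integrable (law \<theta>) (\<lambda>y. norm (y - mean \<theta>) ^ k)"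
    "\<And>\<theta>. \<theta> \<in> ?K \<Longrightarrow> (\<integral>y. norm (y - mean \<theta>) ^ 2 \<partial>law \<theta>) \<le> M0"
    "\<And>\<theta>. \<theta> \<in> ?K \<Longrightarrow> (\<integral>y. norm (y - mean \<theta>) ^ 3 \<partial>law \<theta>) \<le> M0"
    by (rule compact_cumulant_expansion[OF compact_\<theta>]) (rule that)
  have \<theta>K: "\<theta> i \<in> (\<lambda>X. X *v \<beta>s) ` \<X>" for i using X_in by auto
  have [measurable]: "noise i \<in> borel_measurable M" for i
    unfolding noise_def[abs_def] by (rule measurable_compose[OF y_meas])
      (intro borel_measurable_continuous_onI continuous_intros)
  \<comment> \<open>Bounds the transpose by duality: pair the noise with itself, move
    \<open>X i\<close> to the other side and cancel one factor of the norm.\<close>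
  have norm_tr: "norm (noise i \<omega>) \<le> XB * norm (y i \<omega> - mean (\<theta> i))" for i \<omega>
  proof (cases "noise i \<omega> = 0")
    case False
    have "norm (noise i \<omega>) * norm (noise i \<omega>) = noise i \<omega> \<bullet> (transpose (X i) *v (y i \<omega> - mean (\<theta> i)))"
      by (simp only: noise_def[symmetric] power2_norm_eq_inner[symmetric] power2_eq_square)
    also have "\<dots> \<le> norm (X i *v noise i \<omega>) * norm (y i \<omega> - mean (\<theta> i))"
      unfolding inner_transpose_mult by (rule norm_cauchy_schwarz)
    also have "\<dots> \<le> (XB * norm (noise i \<omega>)) * norm (y i \<omega> - mean (\<theta> i))"
      using order_trans[OF norm_matrix_vector_mult_le mult_right_mono[OF XB(2)]] by (intro mult_right_mono) auto
    finally have "norm (noise i \<omega>) * norm (noise i \<omega>) \<le> norm (noise i \<omega>) * (XB * norm (y i \<omega> - mean (\<theta> i)))"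
      by (simp add: mult_ac)
    then show ?thesis by (rule mult_left_le_imp_le) (use False in simp)
  qed (use XB in simp)
  have pow: "norm (noise i \<omega>) ^ k \<le> XB ^ k * norm (y i \<omega> - mean (\<theta> i)) ^ k" for i \<omega> k
    using power_mono[OF norm_tr norm_ge_zero, of i \<omega> k] by (simp add: power_mult_distrib)
  have intk: "integrable M (\<lambda>\<omega>. norm (y i \<omega> - mean (\<theta> i)) ^ k)" for i k
    using y_integral(1)[of "\<lambda>v. norm (v - mean (\<theta> i)) ^ k" i] 0(7)[OF \<theta>K] by simp
  have int_noise: "integrable M (\<lambda>\<omega>. norm (noise i \<omega>) ^ k)" for i k
    by (rule Bochner_Integration.integrable_bound[where f="\<lambda>\<omega>. XB ^ k * norm (y i \<omega> - mean (\<theta> i)) ^ k"])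
       (use intk pow XB in \<open>auto intro!: AE_I2\<close>)
  have mom: "expectation (\<lambda>\<omega>. norm (noise i \<omega>) ^ k) \<le> XB ^ k * M0"
    if "(\<integral>v. norm (v - mean (\<theta> i)) ^ k \<partial>law (\<theta> i)) \<le> M0" for i k
  proof -
    have "expectation (\<lambda>\<omega>. norm (noise i \<omega>) ^ k) \<le> expectation (\<lambda>\<omega>. XB ^ k * norm (y i \<omega> - mean (\<theta> i)) ^ k)"
      using intk by (intro integral_mono int_noise pow) auto
    also have "\<dots> \<le> XB ^ k * M0"
      using that XB y_integral(2)[of "\<lambda>v. norm (v - mean (\<theta> i)) ^ k" i] by simp
    finally show ?thesis .
  qed
  have lin: "bounded_linear (\<lambda>w. transpose (X i) *v w)" for i
    by (rule matrix_vector_mul_bounded_linear)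
  have int1: "integrable M (\<lambda>\<omega>. y i \<omega> - mean (\<theta> i))" "expectation (\<lambda>\<omega>. y i \<omega> - mean (\<theta> i)) = 0" for i
    using y_integral[of "\<lambda>v. v - mean (\<theta> i)" i] 0(5,6)[OF \<theta>K] by simp_all
  have "indep_centered M noise (XB ^ 2 * M0 + XB ^ 3 * M0)"
  proof
    show "indep_vars (\<lambda>_. borel) noise UNIV"
      unfolding noise_def[abs_def]
      by (rule indep_vars_compose2[OF indep_y])
         (intro borel_measurable_continuous_onI continuous_intros)
    show "integrable M (noise i)" for i
      unfolding noise_def[abs_def] by (rule integrable_bounded_linear[OF lin int1(1)])
    show "expectation (noise i) = 0" for i
      unfolding noise_def[abs_def] using integral_bounded_linear[OF lin int1(1)] int1(2) by simp
    have nn: "0 \<le> XB ^ k * M0" for k using XB 0(2) by simp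
    show "expectation (\<lambda>\<omega>. norm (noise i \<omega>) ^ 2) \<le> XB ^ 2 * M0 + XB ^ 3 * M0" for i
      using mom[OF 0(8)[OF \<theta>K]] nn[of 3] by (rule add_increasing2[rotated])
    show "expectation (\<lambda>\<omega>. norm (noise i \<omega>) ^ 3) \<le> XB ^ 2 * M0 + XB ^ 3 * M0" for i
      using nn[of 2] mom[OF 0(9)[OF \<theta>K]] by (rule add_increasing)
  qed (rule int_noise)+
  then show ?thesis ..
qed

definition Jn where "Jn n = (1 / real n) *\<^sub>R (\<Sum>i<n. fisher i)"

lemma sum_matrix_vector_mult: "(\<Sum>i\<in>I. F i) *v h = (\<Sum>i\<in>I. F i *v h)" for F :: "nat \<Rightarrow> real^'p^'p"
  by (induction I rule: infinite_finite_induct) (simp_all add: matrix_vector_mult_add_rdistrib)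

lemma Jn_form: "h \<bullet> (Jn n *v h) = (\<Sum>i<n. h \<bullet> (fisher i *v h)) / n"
  by (simp add: Jn_def scaleR_matrix_vector_assoc[symmetric] sum_matrix_vector_mult inner_sum_right)

lemma Jn_close: "\<bar>h \<bullet> (Jn n *v h) - J.form h h\<bar> \<le> norm (Jn n - J) * norm h ^ 2"
proof -
  have "h \<bullet> (Jn n *v h) - J.form h h = h \<bullet> ((Jn n - J) *v h)"
    by (simp add: J.form_def matrix_vector_mult_diff_rdistrib inner_diff_right)
  also have "\<bar>\<dots>\<bar> \<le> norm h * norm ((Jn n - J) *v h)"
    by (rule Cauchy_Schwarz_ineq2)
  also have "\<dots> \<le> norm h * (norm (Jn n - J) * norm h)"
    by (intro mult_left_mono norm_matrix_vector_mult_le) auto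
  finally show ?thesis by (simp add: power2_eq_square mult_ac)
qed

lemma eventually_Jn_close: "0 < \<epsilon> \<Longrightarrow> \<forall>\<^sub>F n in sequentially. norm (Jn n - J) < \<epsilon>"
  using tendstoD[OF J_lim, of \<epsilon>] by (simp add: dist_norm Jn_def)

definition total_divergence where "total_divergence n h = (\<Sum>i<n. divergence i h)"

lemma convex_on_total_divergence: "convex_on {h. \<beta>s + h \<in> B} (total_divergence n)"
  unfolding convex_on_def
proof (intro conjI ballI allI impI)
  have "{h. \<beta>s + h \<in> B} = (+) (- \<beta>s) ` B"
    by (force simp: image_iff)
  then show "convex {h. \<beta>s + h \<in> B}" using convex_translation[OF convex_B] by simp
  fix x z :: "real^'p" and u v :: real
  assume xz: "x \<in> {h. \<beta>s + h \<in> B}" "z \<in> {h. \<beta>s + h \<in> B}" and uv: "0 \<le> u" "0 \<le> v" "u + v = 1"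
  have "divergence i (u *\<^sub>R x + v *\<^sub>R z) \<le> u * divergence i x + v * divergence i z" for i
  proof -
    have "X i *v (\<beta>s + x) \<in> Theta" "X i *v (\<beta>s + z) \<in> Theta"
      using interior[OF X_in] xz interior_subset by blast+
    note conv = convex_combination_cumulant(2)[OF this uv]
    have "u *\<^sub>R (X i *v (\<beta>s + x)) + v *\<^sub>R (X i *v (\<beta>s + z)) = X i *v (\<beta>s + (u *\<^sub>R x + v *\<^sub>R z))"
    proof -
      have "u *\<^sub>R \<beta>s + v *\<^sub>R \<beta>s = \<beta>s"
        using uv(3) by (metis scaleR_add_left scaleR_one)
      moreover have "u *\<^sub>R (\<beta>s + x) + v *\<^sub>R (\<beta>s + z) = (u *\<^sub>R \<beta>s + v *\<^sub>R \<beta>s) + (u *\<^sub>R x + v *\<^sub>R z)"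
        by (simp only: scaleR_add_right add_ac)
      ultimately have "\<beta>s + (u *\<^sub>R x + v *\<^sub>R z) = u *\<^sub>R (\<beta>s + x) + v *\<^sub>R (\<beta>s + z)"
        by (simp only:)
      then show ?thesis by (simp only: matrix_vector_right_distrib matrix_vector_mult_scaleR)
    qed
    then have "cumulant (X i *v (\<beta>s + (u *\<^sub>R x + v *\<^sub>R z)))
      \<le> u * cumulant (X i *v (\<beta>s + x)) + v * cumulant (X i *v (\<beta>s + z))"
      using conv by (simp only:)
    moreover have "cumulant (\<theta> i) = u * cumulant (\<theta> i) + v * cumulant (\<theta> i)"
      using uv(3) by (metis distrib_right mult_1)
    moreover have "mean (\<theta> i) \<bullet> (X i *v (u *\<^sub>R x + v *\<^sub>R z)) = u * (mean (\<theta> i) \<bullet> (X i *v x)) + v * (mean (\<theta> i) \<bullet> (X i *v z))"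
      by (simp add: matrix_vector_right_distrib matrix_vector_mult_scaleR inner_add_right)
    ultimately show ?thesis unfolding divergence_def right_diff_distrib by linarith
  qed
  then show "total_divergence n (u *\<^sub>R x + v *\<^sub>R z) \<le> u * total_divergence n x + v * total_divergence n z"
    unfolding total_divergence_def sum_distrib_left sum.distrib[symmetric] by (intro sum_mono)
qed

text \<open>The second-order term is \<open>n\<close> times the averaged information, which tends to
  \<open>J\<close>; the cubic remainder is dominated by it in a small ball and is of order
  \<open>1 / sqrt n\<close> on the local scale.\<close>

lemma total_divergence_limit: "\<exists>\<delta> \<kappa>. bridge_limit J B \<beta>s total_divergence \<gamma> \<gamma>0 lam \<delta> \<kappa>"
proof -
  obtain c where c: "0 < c" "\<And>x. c * norm x ^ 2 \<le> J.form x x"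
    using J.form_coercive by metis
  obtain \<delta>0 D where D: "0 < \<delta>0" "0 < D" "cball \<beta>s \<delta>0 \<subseteq> B"
    "\<And>i h. norm h \<le> \<delta>0 \<Longrightarrow> \<bar>divergence i h - h \<bullet> (fisher i *v h) / 2\<bar> \<le> D * norm h ^ 3"
    using divergence_expansion by metis
  have expansion: "\<bar>total_divergence n h - n * (h \<bullet> (Jn n *v h) / 2)\<bar> \<le> n * (D * norm h ^ 3)" if "norm h \<le> \<delta>0" for n h
  proof -
    have "n * (h \<bullet> (Jn n *v h) / 2) = (\<Sum>i<n. h \<bullet> (fisher i *v h) / 2)"
      unfolding Jn_form by (cases "n = 0") (simp_all flip: sum_divide_distrib)
    then have "\<bar>total_divergence n h - n * (h \<bullet> (Jn n *v h) / 2)\<bar> \<le> (\<Sum>i<n. \<bar>divergence i h - h \<bullet> (fisher i *v h) / 2\<bar>)"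
      unfolding total_divergence_def by (simp add: sum_subtractf[symmetric] sum_abs)
    also have "\<dots> \<le> (\<Sum>i<n. D * norm h ^ 3)"
      by (intro sum_mono D(4) that)
    finally show ?thesis by simp
  qed
  \<comment> \<open>Here \<open>D * norm h ^ 3 \<le> c / 8 * norm h ^ 2\<close>. Once
    \<open>Jn\<close> is within \<open>c / 2\<close> of \<open>J\<close>, half the form is at least
    \<open>c / 4 * norm h ^ 2\<close>, so the growth constant \<open>c / 8\<close> remains.\<close>
  define \<delta> where "\<delta> = min \<delta>0 (c / (8 * D))"
  have \<delta>: "0 < \<delta>" "\<delta> \<le> \<delta>0" using D c by (auto simp: \<delta>_def)
  have "bridge_limit J B \<beta>s total_divergence \<gamma> \<gamma>0 lam \<delta> (c / 8)"
  proof
    show "\<beta>s \<in> B" by (rule in_B)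
    show "0 < \<gamma>" "\<gamma> < 1" "\<gamma> < \<gamma>0" "\<gamma>0 \<le> 1" "0 < lam" using \<gamma> lam by auto
    show "0 < \<delta>" by fact
    show sub: "cball \<beta>s \<delta> \<subseteq> B" using D(3) \<delta>(2) by (meson order_trans subset_cball)
    show "0 < c / 8" using c by simp
    show "convex_on {h. \<beta>s + h \<in> B} (total_divergence n)" for n by (rule convex_on_total_divergence)
    show "total_divergence n 0 = 0" for n by (simp add: total_divergence_def divergence_def)
    show "continuous_on (cball 0 \<delta>) (total_divergence n)" for n
      unfolding total_divergence_def[abs_def] divergence_def
    proof (intro continuous_intros continuous_on_compose2[OF continuous_on_cumulant])
      show "(\<lambda>h. X i *v (\<beta>s + h)) ` cball 0 \<delta> \<subseteq> interior Theta" for i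
      proof (rule image_subsetI)
        fix h assume "h \<in> cball (0::real^'p) \<delta>"
        then have "\<beta>s + h \<in> cball \<beta>s \<delta>" by (simp add: dist_norm)
        then show "X i *v (\<beta>s + h) \<in> interior Theta" using sub by (intro interior X_in) auto
      qed
    qed
    have "\<forall>\<^sub>F n in sequentially. norm (Jn n - J) < c / 2"
      using c by (intro eventually_Jn_close) auto
    then show "\<forall>\<^sub>F n in sequentially. \<forall>h. norm h \<le> \<delta> \<longrightarrow> c / 8 * real n * norm h ^ 2 \<le> total_divergence n h"
    proof eventually_elim
      case (elim n)
      show ?case
      proof (intro allI impI)
        fix h :: "real^'p" assume h: "norm h \<le> \<delta>"
        have "norm (Jn n - J) * norm h ^ 2 \<le> c / 2 * norm h ^ 2"
          using elim by (intro mult_right_mono) auto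
        then have quad: "c / 2 * norm h ^ 2 \<le> h \<bullet> (Jn n *v h)"
          using Jn_close[of h n] c(2)[of h] by linarith
        have "norm h \<le> c / (8 * D)" using h by (simp add: \<delta>_def)
        then have "D * norm h \<le> c / 8" using D by (simp add: le_divide_eq mult_ac)
        then have "D * norm h * norm h ^ 2 \<le> c / 8 * norm h ^ 2" by (intro mult_right_mono) auto
        then have cub: "D * norm h ^ 3 \<le> c / 8 * norm h ^ 2" by (simp add: power2_eq_square power3_eq_cube mult_ac)
        have "c / 8 * norm h ^ 2 \<le> h \<bullet> (Jn n *v h) / 2 - D * norm h ^ 3"
          using quad cub by linarith
        then have "n * (c / 8 * norm h ^ 2) \<le> n * (h \<bullet> (Jn n *v h) / 2 - D * norm h ^ 3)"
          by (intro mult_left_mono) auto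
        also have "\<dots> \<le> total_divergence n h"
          using expansion[of h n] h \<delta>(2) by (simp add: right_diff_distrib abs_le_iff)
        finally show "c / 8 * real n * norm h ^ 2 \<le> total_divergence n h" by (simp add: mult_ac)
      qed
    qed
    fix \<rho> \<epsilon> :: real assume \<epsilon>: "0 < \<epsilon>"
    define r where "r = \<bar>\<rho>\<bar> + 1"
    have r: "1 \<le> r" "\<rho> \<le> r" by (auto simp: r_def)
    have "\<forall>\<^sub>F n in sequentially. norm (Jn n - J) < \<epsilon> / r\<^sup>2"
      using \<epsilon> r by (intro eventually_Jn_close) auto
    \<comment> \<open>The first entry puts \<open>u / sqrt n\<close> into the ball of the expansion,
      the second makes the cubic remainder at most \<open>\<epsilon> / 2\<close>.\<close>
    moreover have "\<forall>\<^sub>F n in sequentially. max (r / \<delta>0) (2 * D * r ^ 3 / \<epsilon>) < sqrt (real n)"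
      by (rule eventually_compose_filterlim[OF eventually_gt_at_top])
         (intro filterlim_compose[OF sqrt_at_top filterlim_real_sequentially])
    moreover have "\<forall>\<^sub>F n in sequentially. 1 \<le> n" by (rule eventually_ge_at_top)
    ultimately show "\<forall>\<^sub>F n in sequentially. \<forall>u. norm u \<le> \<rho> \<longrightarrow>
        \<bar>total_divergence n ((1 / sqrt n) *\<^sub>R u) - J.form u u / 2\<bar> \<le> \<epsilon>"
    proof eventually_elim
      case (elim n)
      show ?case
      proof (intro allI impI)
        fix u :: "real^'p" assume "norm u \<le> \<rho>"
        then have u: "norm u \<le> r" using r by simp
        have n: "0 < sqrt n" "sqrt n * sqrt n = n" using elim by auto
        define h where "h = (1 / sqrt n) *\<^sub>R u"
        have nh: "norm h = norm u / sqrt n" using n by (simp add: h_def)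
        have "r < sqrt n * \<delta>0" using elim(2) D by (simp add: divide_less_eq)
        then have "norm h \<le> \<delta>0" using u n by (simp add: nh divide_le_eq mult.commute)
        from expansion[OF this, of n]
        have e1: "\<bar>total_divergence n h - n * (h \<bullet> (Jn n *v h) / 2)\<bar> \<le> n * (D * norm h ^ 3)" .
        have e2: "n * (h \<bullet> (Jn n *v h) / 2) = u \<bullet> (Jn n *v u) / 2"
          using n by (simp add: h_def matrix_vector_mult_scaleR)
        have "n * (D * norm h ^ 3) = D * norm u ^ 3 / sqrt n"
          using n by (simp add: nh power_divide power3_eq_cube)
        also have "\<dots> \<le> D * r ^ 3 / sqrt n"
          using u D by (intro divide_right_mono mult_left_mono power_mono) auto
        also have "\<dots> \<le> \<epsilon> / 2"
        proof -
          have "2 * D * r ^ 3 < sqrt n * \<epsilon>" using elim(2) \<epsilon> by (simp add: divide_less_eq)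
          then show ?thesis using n by (simp add: divide_le_eq mult_ac)
        qed
        finally have a: "\<bar>total_divergence n h - u \<bullet> (Jn n *v u) / 2\<bar> \<le> \<epsilon> / 2"
          using e1 unfolding e2 by linarith
        have "\<bar>u \<bullet> (Jn n *v u) - J.form u u\<bar> \<le> \<epsilon> / r\<^sup>2 * r\<^sup>2"
          using elim(1) u \<epsilon> by (intro order_trans[OF Jn_close] mult_mono power_mono) auto
        then have b: "\<bar>u \<bullet> (Jn n *v u) - J.form u u\<bar> \<le> \<epsilon>" using r by simp
        have tri: "\<bar>p - v / 2\<bar> \<le> \<epsilon> / 2 \<Longrightarrow> \<bar>v - w\<bar> \<le> \<epsilon> \<Longrightarrow> \<bar>p - w / 2\<bar> \<le> \<epsilon>" for p v w :: real
          by argo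
        show "\<bar>total_divergence n ((1 / sqrt n) *\<^sub>R u) - J.form u u / 2\<bar> \<le> \<epsilon>"
          using tri[OF a b] unfolding h_def .
      qed
    qed
  qed
  then show ?thesis by blast
qed

end

section \<open>Scores, the estimator and convergence in law\<close>

context bridge_glm
begin

text \<open>Gradient of the log-likelihood at \<open>\<beta>s\<close>, divided by
  \<open>sqrt n\<close>. It is a function of the data sequence, so that one definition serves the
  data and the copy.\<close>

definition score where
  "score n f = (1 / sqrt (real n)) *\<^sub>R (\<Sum>i<n. transpose (X i) *v (f i - mean (\<theta> i)))"

lemma score_inner: "score n f \<bullet> h = (1 / sqrt n) * (\<Sum>i<n. (f i - mean (\<theta> i)) \<bullet> (X i *v h))"
proof -
  have "(transpose (X i) *v w) \<bullet> h = w \<bullet> (X i *v h)" for i w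
    by (metis inner_commute inner_transpose_mult)
  then show ?thesis
    unfolding score_def inner_scaleR_left inner_sum_left by (simp only:)
qed

lemma loglik_diff:
  "glm_loglik \<nu> b (X i) v (\<beta>s + h) - glm_loglik \<nu> b (X i) v \<beta>s = (v - mean (\<theta> i)) \<bullet> (X i *v h) - divergence i h"
  by (simp add: glm_loglik_def divergence_def matrix_vector_right_distrib inner_add_right inner_diff_left)

text \<open>The divergence depends on the parameter but not on the observations, so it cancels
  between data and copy. The identity is therefore exact, with no Taylor remainder.\<close>

lemma loglik_gain_diff:
  "loglik_gain \<nu> b X n f \<beta> \<beta>s - loglik_gain \<nu> b X n f' \<beta> \<beta>s = (score n f - score n f') \<bullet> (sqrt n *\<^sub>R (\<beta> - \<beta>s))"
proof -
  have gain: "loglik_gain \<nu> b X n f \<beta> \<beta>s = (\<Sum>i<n. (f i - mean (\<theta> i)) \<bullet> (X i *v (\<beta> - \<beta>s))) - total_divergence n (\<beta> - \<beta>s)" for f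
    unfolding loglik_gain_def total_divergence_def sum_subtractf[symmetric]
    using loglik_diff[of _ _ "\<beta> - \<beta>s"] by simp
  have sc: "sqrt n * (score n f \<bullet> h) = (\<Sum>i<n. (f i - mean (\<theta> i)) \<bullet> (X i *v h))" for f h
    unfolding score_inner by (cases "n = 0") auto
  show ?thesis
    unfolding gain by (simp add: inner_diff_left right_diff_distrib sc)
qed

lemma score_meas [measurable]: "score n \<in> borel_measurable (PiM UNIV (\<lambda>_. borel))"
proof -
  have "(\<lambda>f. transpose (X i) *v (f i - mean (\<theta> i))) \<in> borel_measurable (PiM UNIV (\<lambda>_. borel))" for i
    by (rule measurable_compose[where N=borel and f="\<lambda>f. f i" and g="\<lambda>w. transpose (X i) *v (w - mean (\<theta> i))"])
       (simp, intro borel_measurable_continuous_onI continuous_intros)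
  then show ?thesis unfolding score_def[abs_def] by simp
qed

lemma score_noise: "score n (\<lambda>i. y i \<omega>) = (1 / sqrt (real n)) *\<^sub>R (\<Sum>i<n. noise i \<omega>)"
  by (simp add: score_def noise_def)

lemma score_indep:
  "indep_var borel (\<lambda>\<omega>. score n (\<lambda>i. y i \<omega>)) borel (\<lambda>\<omega>. score n (\<lambda>i. yt i \<omega>))"
  using indep_var_compose[OF indep_copy score_meas score_meas] by (simp add: comp_def)

lemma score_same_dist:
  "distr M borel (\<lambda>\<omega>. score n (\<lambda>i. yt i \<omega>)) = distr M borel (\<lambda>\<omega>. score n (\<lambda>i. y i \<omega>))"
proof -
  have [measurable]: "(\<lambda>\<omega> i. y i \<omega>) \<in> measurable M (PiM UNIV (\<lambda>_. borel))" "(\<lambda>\<omega> i. yt i \<omega>) \<in> measurable M (PiM UNIV (\<lambda>_. borel))"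
    using indep_copy by (auto dest: indep_var_rv1 indep_var_rv2)
  have "distr (distr M (PiM UNIV (\<lambda>_. borel)) (\<lambda>\<omega> i. yt i \<omega>)) borel (score n)
    = distr (distr M (PiM UNIV (\<lambda>_. borel)) (\<lambda>\<omega> i. y i \<omega>)) borel (score n)"
    by (simp only: same_dist)
  then show ?thesis by (simp add: distr_distr comp_def)
qed

lemma noise_2: "expectation (\<lambda>\<omega>. (v \<bullet> noise i \<omega>)\<^sup>2) = v \<bullet> (fisher i *v v)"
  unfolding noise_def inner_transpose_mult fisher_form covariance_def
  by (rule y_integral(2)[of "\<lambda>w. ((X i *v v) \<bullet> (w - mean (\<theta> i)))\<^sup>2"]) simp

text \<open>Half of \<open>\<epsilon>\<close> covers the Gaussian approximation with the actual
  covariance \<open>Jn\<close>, the other half the passage from \<open>Jn\<close> to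
  \<open>J\<close>; the latter uses that \<open>exp (- x)\<close> is 1-Lipschitz for nonnegative
  \<open>x\<close>.\<close>

lemma score_char:
  assumes "0 < \<epsilon>"
  shows "\<forall>\<^sub>F n in sequentially. \<forall>v. norm v \<le> \<rho> \<longrightarrow>
    cmod (expectation (\<lambda>\<omega>. iexp (v \<bullet> score n (\<lambda>i. y i \<omega>))) - of_real (exp (- (J.form v v / 2)))) \<le> \<epsilon>"
proof -
  obtain C where "indep_centered M noise C" using noise_indep_centered by blast
  then interpret N: indep_centered M noise C .
  define r where "r = \<bar>\<rho>\<bar> + 1"
  have r: "1 \<le> r" "\<rho> \<le> r" by (auto simp: r_def)
  let ?c = "r ^ 3 * C + r ^ 4 * C\<^sup>2"
  have "\<forall>\<^sub>F n in sequentially. norm (Jn n - J) < \<epsilon> / r\<^sup>2"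
    using assms r by (intro eventually_Jn_close) auto
  moreover have "\<forall>\<^sub>F n in sequentially. ?c / (\<epsilon> / 2) < sqrt (real n)"
    by (rule eventually_compose_filterlim[OF eventually_gt_at_top])
       (intro filterlim_compose[OF sqrt_at_top filterlim_real_sequentially])
  moreover have "\<forall>\<^sub>F n in sequentially. 1 \<le> n" by (rule eventually_ge_at_top)
  ultimately show ?thesis
  proof eventually_elim
    case (elim n)
    show ?case
    proof (intro allI impI)
      fix v :: "real^'p" assume "norm v \<le> \<rho>"
      then have v: "norm v \<le> r" using r by simp
      have n: "0 < n" "0 < sqrt n" using elim by auto
      have "cmod (expectation (\<lambda>\<omega>. iexp (v \<bullet> score n (\<lambda>i. y i \<omega>))) - of_real (exp (- (v \<bullet> (Jn n *v v) / 2))))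
        \<le> (norm v ^ 3 * C + norm v ^ 4 * C\<^sup>2) / sqrt n"
        using N.char_scaled_sum_bound[OF n(1), of v]
        unfolding N.scaled_sum_def score_noise[symmetric] noise_2 Jn_form .
      also have "\<dots> \<le> ?c / sqrt n"
        using v N.C_nonneg by (intro divide_right_mono add_mono mult_right_mono power_mono) auto
      also have "\<dots> \<le> \<epsilon> / 2"
      proof -
        have "?c < sqrt n * (\<epsilon> / 2)"
          using elim(2) pos_divide_less_eq[of "\<epsilon> / 2" ?c "sqrt n"] assms by simp
        then show ?thesis using n by (simp add: divide_le_eq mult.commute)
      qed
      finally have a: "cmod (expectation (\<lambda>\<omega>. iexp (v \<bullet> score n (\<lambda>i. y i \<omega>))) - of_real (exp (- (v \<bullet> (Jn n *v v) / 2)))) \<le> \<epsilon> / 2" .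
      have nn: "0 \<le> v \<bullet> (Jn n *v v)"
        unfolding Jn_form noise_2[symmetric] by (intro divide_nonneg_nonneg sum_nonneg) auto
      have "\<bar>v \<bullet> (Jn n *v v) - J.form v v\<bar> \<le> \<epsilon> / r\<^sup>2 * r\<^sup>2"
        using elim(1) v assms by (intro order_trans[OF Jn_close] mult_mono power_mono) auto
      then have close: "\<bar>v \<bullet> (Jn n *v v) - J.form v v\<bar> \<le> \<epsilon>" using r by simp
      have "\<bar>exp (- (v \<bullet> (Jn n *v v) / 2)) - exp (- (J.form v v / 2))\<bar> \<le> \<bar>v \<bullet> (Jn n *v v) / 2 - J.form v v / 2\<bar>"
        using nn J.form_nonneg by (intro abs_exp_minus_diff_le) auto
      also have "\<dots> \<le> \<epsilon> / 2"
        using close by (simp add: diff_divide_distrib[symmetric])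
      finally have "cmod (of_real (exp (- (v \<bullet> (Jn n *v v) / 2))) - of_real (exp (- (J.form v v / 2)))) \<le> \<epsilon> / 2"
        by (simp only: norm_of_real flip: of_real_diff)
      from norm_diff_triangle_le[OF a this]
      show "cmod (expectation (\<lambda>\<omega>. iexp (v \<bullet> score n (\<lambda>i. y i \<omega>))) - of_real (exp (- (J.form v v / 2)))) \<le> \<epsilon>"
        by simp
    qed
  qed
qed

definition estimate where "estimate n \<omega> = sqrt n *\<^sub>R (betahat n (\<lambda>i\<in>{..<n}. y i \<omega>) - \<beta>s)"

lemma estimate_meas [measurable]: "estimate n \<in> borel_measurable M"
proof -
  have "betahat n \<in> borel_measurable (PiM {..<n} (\<lambda>_. borel))"
    using betahat[of n] by (simp add: bridge_estimator_def)
  moreover have "(\<lambda>\<omega>. \<lambda>i\<in>{..<n}. y i \<omega>) \<in> measurable M (PiM {..<n} (\<lambda>_. borel))"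
    by (rule measurable_restrict) simp
  ultimately have "(\<lambda>\<omega>. betahat n (\<lambda>i\<in>{..<n}. y i \<omega>)) \<in> borel_measurable M"
    by (rule measurable_compose[rotated])
  then show ?thesis unfolding estimate_def[abs_def] by simp
qed

text \<open>The factor \<open>real n\<close> in front of the tuning parameter turns its exponent
  \<open>(\<gamma>0 - 2) / 2\<close> into \<open>\<gamma>0 / 2\<close>. The data then enter the
  increment of the objective through the score alone.\<close>

lemma objective_criterion:
  assumes L: "bridge_limit J B \<beta>s total_divergence \<gamma> \<gamma>0 lam \<delta> \<kappa>" and n: "1 \<le> n"
  shows "bridge_objective \<nu> b X \<gamma> (real n powr ((\<gamma>0 - 2) / 2) * lam) n f (\<beta>s + h)
    = bridge_objective \<nu> b X \<gamma> (real n powr ((\<gamma>0 - 2) / 2) * lam) n f \<beta>s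
      + bridge_limit.criterion \<beta>s total_divergence \<gamma> \<gamma>0 lam n (score n f) h"
proof -
  interpret L: bridge_limit J B \<beta>s total_divergence \<gamma> \<gamma>0 lam \<delta> \<kappa> by (rule L)
  have "real n * real n powr ((\<gamma>0 - 2) / 2) = real n powr (1 + (\<gamma>0 - 2) / 2)"
    using n by (simp add: powr_add)
  also have "1 + (\<gamma>0 - 2) / 2 = \<gamma>0 / 2" by (simp add: field_simps)
  finally have pw: "real n * (real n powr ((\<gamma>0 - 2) / 2) * lam) = real n powr (\<gamma>0 / 2) * lam"
    by (simp only: mult.assoc[symmetric])
  have sc: "sqrt n * (score n f \<bullet> h) = (\<Sum>i<n. (f i - mean (\<theta> i)) \<bullet> (X i *v h))"
    unfolding score_inner using n by simp
  have "(\<Sum>i<n. glm_loglik \<nu> b (X i) (f i) (\<beta>s + h)) - (\<Sum>i<n. glm_loglik \<nu> b (X i) (f i) \<beta>s)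
    = sqrt n * (score n f \<bullet> h) - total_divergence n h"
    unfolding sc total_divergence_def sum_subtractf[symmetric] loglik_diff ..
  moreover have "real n powr (\<gamma>0 / 2) * lam * (\<Sum>j\<in>UNIV. \<bar>(\<beta>s + h) $ j\<bar> powr \<gamma>) - real n powr (\<gamma>0 / 2) * lam * (\<Sum>j\<in>UNIV. \<bar>\<beta>s $ j\<bar> powr \<gamma>)
    = real n powr (\<gamma>0 / 2) * lam * (\<Sum>j\<in>UNIV. \<bar>\<beta>s $ j + h $ j\<bar> powr \<gamma> - \<bar>\<beta>s $ j\<bar> powr \<gamma>)"
    by (simp add: sum_subtractf right_diff_distrib)
  ultimately show ?thesis
    unfolding bridge_objective_def L.criterion_def pw by linarith
qed

lemma estimate_limit:
  obtains e :: "'p \<Rightarrow> real^'p" and d where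
    "\<And>c. J.form (\<Sum>k\<in>{j. \<beta>s $ j \<noteq> 0}. c k *\<^sub>R e k) (\<Sum>k\<in>{j. \<beta>s $ j \<noteq> 0}. c k *\<^sub>R e k) = (\<Sum>k\<in>{j. \<beta>s $ j \<noteq> 0}. (c k)\<^sup>2)"
    "\<And>R \<epsilon>. 0 < \<epsilon> \<Longrightarrow> \<forall>\<^sub>F n in sequentially. \<forall>\<omega>. norm (score n (\<lambda>i. y i \<omega>)) \<le> R \<longrightarrow>
      norm (estimate n \<omega> - (\<Sum>k\<in>{j. \<beta>s $ j \<noteq> 0}. (e k \<bullet> score n (\<lambda>i. y i \<omega>) - d k) *\<^sub>R e k)) \<le> \<epsilon>"
proof -
  obtain \<delta> \<kappa> where L: "bridge_limit J B \<beta>s total_divergence \<gamma> \<gamma>0 lam \<delta> \<kappa>"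
    using total_divergence_limit by blast
  interpret L: bridge_limit J B \<beta>s total_divergence \<gamma> \<gamma>0 lam \<delta> \<kappa> by (rule L)
  obtain e where basis: "(\<forall>k\<in>L.active. \<forall>j. j \<notin> L.active \<longrightarrow> e k $ j = 0) \<and>
    (\<forall>k\<in>L.active. \<forall>l\<in>L.active. J.form (e k) (e l) = (if k = l then 1 else 0)) \<and>
    (\<forall>u. (\<forall>j. j \<notin> L.active \<longrightarrow> u $ j = 0) \<longrightarrow> u = (\<Sum>k\<in>L.active. J.form (e k) u *\<^sub>R e k))"
    using J.coordinate_subspace_orthonormal_basis[OF finite] by (rule exE)
  have e: "\<And>k j. k \<in> L.active \<Longrightarrow> j \<notin> L.active \<Longrightarrow> e k $ j = 0"
    "\<And>k l. k \<in> L.active \<Longrightarrow> l \<in> L.active \<Longrightarrow> J.form (e k) (e l) = (if k = l then 1 else 0)"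
    "\<And>u. (\<And>j. j \<notin> L.active \<Longrightarrow> u $ j = 0) \<Longrightarrow> u = (\<Sum>k\<in>L.active. J.form (e k) u *\<^sub>R e k)"
    using basis by blast+
  \<comment> \<open>The coordinates of the drift; with them \<open>U s\<close> solves the
    stationarity equation of the quadratic limit on the active subspace.\<close>
  define d where "d k = e k \<bullet> L.drift" for k
  define U where "U s = (\<Sum>k\<in>L.active. (e k \<bullet> s - d k) *\<^sub>R e k)" for s
  have form_e: "J.form (\<Sum>k\<in>L.active. c k *\<^sub>R e k) (\<Sum>k\<in>L.active. c' k *\<^sub>R e k) = (\<Sum>k\<in>L.active. c k * c' k)" for c c'
  proof -
    have "J.form (\<Sum>k\<in>L.active. c k *\<^sub>R e k) (\<Sum>k\<in>L.active. c' k *\<^sub>R e k) = (\<Sum>k\<in>L.active. \<Sum>l\<in>L.active. c k * (c' l * J.form (e k) (e l)))"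
      by (simp add: J.form_simps sum_distrib_left) (subst sum.swap, simp add: mult.left_commute)
    also have "\<dots> = (\<Sum>k\<in>L.active. \<Sum>l\<in>L.active. if l = k then c k * c' k else 0)"
      by (intro sum.cong refl) (simp add: e(2))
    finally show ?thesis by simp
  qed
  have U_supp: "U s $ j = 0" if "j \<notin> L.active" for s j
    using e(1)[OF _ that] by (simp add: U_def)
  have U_form: "J.form u (U s) = u \<bullet> (s - L.drift)" if "\<And>j. j \<notin> L.active \<Longrightarrow> u $ j = 0" for s u
  proof -
    have u: "u = (\<Sum>k\<in>L.active. J.form (e k) u *\<^sub>R e k)" by (rule e(3)[OF that])
    have "J.form u (U s) = (\<Sum>k\<in>L.active. J.form (e k) u * (e k \<bullet> s - d k))"
      by (subst u) (simp add: U_def form_e)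
    also have "\<dots> = (\<Sum>k\<in>L.active. J.form (e k) u *\<^sub>R e k) \<bullet> (s - L.drift)"
      by (simp add: inner_sum_left d_def inner_diff_right right_diff_distrib sum_subtractf)
    finally show ?thesis using u by simp
  qed
  have U_bound: "norm (U s) \<le> (\<Sum>k\<in>L.active. (norm (e k) * R + \<bar>d k\<bar>) * norm (e k))" if "norm s \<le> R" for s R
    unfolding U_def
  proof (rule order_trans[OF norm_sum sum_mono])
    fix k
    have "\<bar>e k \<bullet> s\<bar> \<le> norm (e k) * R"
      using Cauchy_Schwarz_ineq2[of "e k" s] mult_left_mono[OF that, of "norm (e k)"] by simp
    then have "\<bar>e k \<bullet> s - d k\<bar> \<le> norm (e k) * R + \<bar>d k\<bar>" by linarith
    then show "norm ((e k \<bullet> s - d k) *\<^sub>R e k) \<le> (norm (e k) * R + \<bar>d k\<bar>) * norm (e k)"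
      by (simp add: mult_right_mono)
  qed
  show ?thesis
  proof
    show "J.form (\<Sum>k\<in>{j. \<beta>s $ j \<noteq> 0}. c k *\<^sub>R e k) (\<Sum>k\<in>{j. \<beta>s $ j \<noteq> 0}. c k *\<^sub>R e k) = (\<Sum>k\<in>{j. \<beta>s $ j \<noteq> 0}. (c k)\<^sup>2)" for c
      using form_e[of c c] by (simp add: L.active_def power2_eq_square)
    fix R \<epsilon> :: real assume "0 < \<epsilon>"
    have near_U: "\<forall>\<^sub>F n in sequentially. \<forall>s h. norm s \<le> R \<longrightarrow> \<beta>s + h \<in> B \<longrightarrow>
      (\<forall>h'. \<beta>s + h' \<in> B \<longrightarrow> L.criterion n s h \<le> L.criterion n s h') \<longrightarrow> norm (sqrt n *\<^sub>R h - U s) \<le> \<epsilon>"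
    proof (rule L.minimizer_limit)
      show "U s $ j = 0" if "j \<notin> L.active" for s j by (rule U_supp[OF that])
      show "J.form u (U s) = u \<bullet> (s - L.drift)" if "\<And>j. j \<notin> L.active \<Longrightarrow> u $ j = 0" for s u by (rule U_form[OF that])
      show "norm (U s) \<le> (\<Sum>k\<in>L.active. (norm (e k) * R + \<bar>d k\<bar>) * norm (e k))" if "norm s \<le> R" for s by (rule U_bound[OF that])
    qed fact
    show "\<forall>\<^sub>F n in sequentially. \<forall>\<omega>. norm (score n (\<lambda>i. y i \<omega>)) \<le> R \<longrightarrow>
      norm (estimate n \<omega> - (\<Sum>k\<in>{j. \<beta>s $ j \<noteq> 0}. (e k \<bullet> score n (\<lambda>i. y i \<omega>) - d k) *\<^sub>R e k)) \<le> \<epsilon>"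
      using L.minimizer_exists[of R] near_U eventually_ge_at_top[of 1]
    proof eventually_elim
      case (elim n)
      show ?case
      proof (intro allI impI)
        fix \<omega> assume R: "norm (score n (\<lambda>i. y i \<omega>)) \<le> R"
        let ?f = "\<lambda>i\<in>{..<n}. y i \<omega>"
        let ?obj = "bridge_objective \<nu> b X \<gamma> (real n powr ((\<gamma>0 - 2) / 2) * lam) n ?f"
        define s where "s = score n (\<lambda>i. y i \<omega>)"
        \<comment> \<open>The estimator receives the data restricted to indices below
          \<open>n\<close>; the score reads no other entries, so the restriction leaves it
          unchanged.\<close>
        have s: "score n ?f = s" by (simp add: s_def score_def)
        have obj: "?obj (\<beta>s + h) = ?obj \<beta>s + L.criterion n s h" for h
          using objective_criterion[OF L elim(3), of ?f h] unfolding s .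
        obtain h0 where h0: "\<beta>s + h0 \<in> B" "\<And>h'. \<beta>s + h' \<in> B \<Longrightarrow> L.criterion n s h0 \<le> L.criterion n s h'"
          using elim(1) R unfolding s_def by blast
        \<comment> \<open>The estimator is constrained only where a minimizer exists, so attainment
          has to be shown first, by transferring a minimizer of the criterion.\<close>
        have "is_arg_min ?obj (\<lambda>\<beta>. \<beta> \<in> B) (\<beta>s + h0)"
          unfolding is_arg_min_def
        proof (intro conjI h0(1) notI)
          assume "\<exists>z. z \<in> B \<and> ?obj z < ?obj (\<beta>s + h0)"
          then obtain z where z: "z \<in> B" "?obj z < ?obj (\<beta>s + h0)" by blast
          then show False
            using obj[of "z - \<beta>s"] obj[of h0] h0(2)[of "z - \<beta>s"] by simp
        qed
        moreover have data: "?f \<in> space (PiM {..<n} (\<lambda>_. borel))"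
          by (simp add: space_PiM)
        ultimately have am: "is_arg_min ?obj (\<lambda>\<beta>. \<beta> \<in> B) (betahat n ?f)"
          using betahat[of n] data unfolding bridge_estimator_def by blast
        define h where "h = betahat n ?f - \<beta>s"
        have hB: "\<beta>s + h \<in> B" using am by (simp add: h_def is_arg_min_def)
        have "L.criterion n s h \<le> L.criterion n s h'" if "\<beta>s + h' \<in> B" for h'
        proof -
          have "\<not> ?obj (\<beta>s + h') < ?obj (\<beta>s + h)"
            using am that by (auto simp: h_def is_arg_min_def)
          then show ?thesis unfolding obj by simp
        qed
        then have "norm (sqrt n *\<^sub>R h - U s) \<le> \<epsilon>"
          using elim(2) R hB unfolding s_def by blast
        then show "norm (estimate n \<omega> - (\<Sum>k\<in>{j. \<beta>s $ j \<noteq> 0}. (e k \<bullet> score n (\<lambda>i. y i \<omega>) - d k) *\<^sub>R e k)) \<le> \<epsilon>"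
          by (simp add: estimate_def h_def U_def s_def L.active_def)
      qed
    qed
  qed
qed

lemma gain_limit:
  "\<exists>zlimit :: real measure. real_distribution zlimit \<and>
     weak_conv_m
       (\<lambda>n. distr M borel (\<lambda>\<omega>.
          loglik_gain \<nu> b X n (\<lambda>i. y i \<omega>) (betahat n (\<lambda>i\<in>{..<n}. y i \<omega>)) \<beta>s
          - loglik_gain \<nu> b X n (\<lambda>i. yt i \<omega>) (betahat n (\<lambda>i\<in>{..<n}. y i \<omega>)) \<beta>s))
       zlimit \<and>
     integrable zlimit (\<lambda>z. z) \<and>
     (\<integral>z. z \<partial>zlimit) = real (card {j. \<beta>s $ j \<noteq> 0})"
proof -
  let ?A = "{j. \<beta>s $ j \<noteq> 0}"
  obtain e d where e: "\<And>c. J.form (\<Sum>k\<in>?A. c k *\<^sub>R e k) (\<Sum>k\<in>?A. c k *\<^sub>R e k) = (\<Sum>k\<in>?A. (c k)\<^sup>2)"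
    and lim: "\<And>R \<epsilon>. 0 < \<epsilon> \<Longrightarrow> \<forall>\<^sub>F n in sequentially. \<forall>\<omega>. norm (score n (\<lambda>i. y i \<omega>)) \<le> R \<longrightarrow>
      norm (estimate n \<omega> - (\<Sum>k\<in>?A. (e k \<bullet> score n (\<lambda>i. y i \<omega>) - d k) *\<^sub>R e k)) \<le> \<epsilon>"
    by (rule estimate_limit) blast
  obtain C where "indep_centered M noise C" using noise_indep_centered by blast
  then interpret N: indep_centered M noise C .
  have S: "(\<lambda>\<omega>. score n (\<lambda>i. y i \<omega>)) = N.scaled_sum n" for n
    by (simp add: fun_eq_iff N.scaled_sum_def score_noise)
  obtain zl where zl: "real_distribution zl" "integrable zl (\<lambda>z. z)" "(\<integral>z. z \<partial>zl) = real (card ?A)"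
    "\<And>t. char zl t = (\<Prod>k\<in>?A. \<integral>w. gain_weight t (d k) w \<partial>std_normal_distribution)"
    using gain_limit_distribution[of ?A d] by auto
  define z where "z n \<omega> = (score n (\<lambda>i. y i \<omega>) - score n (\<lambda>i. yt i \<omega>)) \<bullet> estimate n \<omega>" for n \<omega>
  have z_eq: "loglik_gain \<nu> b X n (\<lambda>i. y i \<omega>) (betahat n (\<lambda>i\<in>{..<n}. y i \<omega>)) \<beta>s
          - loglik_gain \<nu> b X n (\<lambda>i. yt i \<omega>) (betahat n (\<lambda>i\<in>{..<n}. y i \<omega>)) \<beta>s = z n \<omega>" for n \<omega>
    unfolding loglik_gain_diff z_def estimate_def ..
  have [measurable]: "(\<lambda>\<omega>. score n (\<lambda>i. y i \<omega>)) \<in> borel_measurable M" "(\<lambda>\<omega>. score n (\<lambda>i. yt i \<omega>)) \<in> borel_measurable M" for n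
    using score_indep[of n] by (auto dest: indep_var_rv1 indep_var_rv2)
  have z_meas: "z n \<in> borel_measurable M" for n
    unfolding z_def[abs_def] by measurable
  have "(\<lambda>n. expectation (\<lambda>\<omega>. iexp (t * z n \<omega>))) \<longlonglongrightarrow> (\<Prod>k\<in>?A. \<integral>w. gain_weight t (d k) w \<partial>std_normal_distribution)" for t
    unfolding z_def
  proof (rule gain_char_limit[where q="\<lambda>v. J.form v v" and e=e and d=d])
    show "integrable M (\<lambda>\<omega>. norm (score n (\<lambda>i. y i \<omega>)) ^ 2)" for n
      using N.scaled_sum_2(1)[of n] by (simp add: N.scaled_sum_def score_noise)
    show "expectation (\<lambda>\<omega>. norm (score n (\<lambda>i. y i \<omega>)) ^ 2) \<le> DIM(real^'p) * C" for n
      using N.scaled_sum_2(2)[of n] by (simp add: N.scaled_sum_def score_noise)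
  qed (fact estimate_meas score_indep score_same_dist e score_char lim)+
  then have "weak_conv_m (\<lambda>n. distr M borel (z n)) zl"
    using z_meas zl(1) by (intro levy_continuity real_distribution_distr)
      (auto simp: char_def[of "distr _ _ _"] integral_distr zl(4))
  then show ?thesis
    unfolding z_eq using zl(1,2,3) by blast
qed

end

theorem theorem7:
  fixes M :: "'w measure"
    and \<nu> :: "(real^'r) measure" and b :: "real^'r \<Rightarrow> real"
    and X :: "nat \<Rightarrow> real^'p^'r" and \<X> :: "(real^'p^'r) set"
    and B :: "(real^'p) set" and \<beta>s :: "real^'p"
    and y yt :: "nat \<Rightarrow> 'w \<Rightarrow> real^'r"
    and betahat :: "nat \<Rightarrow> (nat \<Rightarrow> real^'r) \<Rightarrow> real^'p"
    and \<gamma> \<gamma>0 lam :: real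
  assumes "sigma_finite_measure \<nu>" and "sets \<nu> = sets borel" and "b \<in> borel_measurable borel"
    and "\<forall>\<theta>\<in>interior (natural_space \<nu> b). pos_def_matrix (hessian (cumulant_fn \<nu> b) \<theta>)"
    and "open B" and "convex B" and "\<beta>s \<in> B"
    and "\<forall>i. X i \<in> \<X>"
    and "regressors_admissible \<nu> b \<X> B"
    and "regressors_invariant \<nu> b \<X> B X"
    and "prob_space M"
    and "prob_space.indep_vars M (\<lambda>_. borel) y UNIV"
    and "\<forall>i. distributed M \<nu> (y i) (\<lambda>v. ennreal (nef_density \<nu> b (X i *v \<beta>s) v))"
    and "distr M (PiM UNIV (\<lambda>_. borel)) (\<lambda>\<omega> i. yt i \<omega>) = distr M (PiM UNIV (\<lambda>_. borel)) (\<lambda>\<omega> i. y i \<omega>)"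
    and "prob_space.indep_var M (PiM UNIV (\<lambda>_. borel)) (\<lambda>\<omega> i. y i \<omega>)
           (PiM UNIV (\<lambda>_. borel)) (\<lambda>\<omega> i. yt i \<omega>)"
    and "0 < \<gamma>" and "\<gamma> < 1" and "\<gamma> < \<gamma>0" and "\<gamma>0 \<le> 1" and "0 < lam"
    and "\<forall>n. bridge_estimator \<nu> b X B \<gamma> (real n powr ((\<gamma>0 - 2) / 2) * lam) n (betahat n)"
  shows "\<exists>zlimit :: real measure.
           real_distribution zlimit \<and>
           weak_conv_m
             (\<lambda>n. distr M borel (\<lambda>\<omega>.
                loglik_gain \<nu> b X n (\<lambda>i. y i \<omega>) (betahat n (\<lambda>i\<in>{..<n}. y i \<omega>)) \<beta>s
                - loglik_gain \<nu> b X n (\<lambda>i. yt i \<omega>) (betahat n (\<lambda>i\<in>{..<n}. y i \<omega>)) \<beta>s))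
             zlimit \<and>
           integrable zlimit (\<lambda>z. z) \<and>
           (\<integral>z. z \<partial>zlimit) = real (card {j. \<beta>s $ j \<noteq> 0})"
proof -
  \<comment> \<open>\<open>J\<close> is the \<open>\<mu>\<close>-integral of the information terms
    at the true parameter.\<close>
  obtain J where J: "pos_def_matrix J" "(\<lambda>n. (1 / real n) *\<^sub>R (\<Sum>i<n. fisher_term \<nu> b \<beta>s (X i))) \<longlonglongrightarrow> J"
    using assms(7,10) unfolding regressors_invariant_def by blast
  interpret prob_space M by fact
  interpret bridge_glm \<nu> b M X \<X> B \<beta>s y yt betahat \<gamma> \<gamma>0 lam J
    using assms J by unfold_locales (auto simp: regressors_admissible_def)
  show ?thesis by (rule gain_limit)
qed

end
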